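(* Let $\{Y_i\}_{i\in\mathbb{Z}}$ be a stationary real-valued time series, $h:\mathbb{R}^2\to\mathbb{R}$ a measurable kernel, $b\in(0,1)$ fixed, and suppose the null hypothesis $H_0$ of no change holds, i.e. the observations are $X_i=Y_i$ for all $i\ge 1$. Assume that the weight function $w(m,k)$ (with associated function $\rho$ and exponent $\gamma$) satisfies Conditions (W), and that $\{Y_i\}$ and $h$ satisfy Conditions (R) with this $\gamma$. Let $\Psi_1,\Psi_2,\Psi_3$ be the CUSUM, modified MOSUM and Page-CUSUM monitoring statistics. Then, as $m\to\infty$, (i) $\displaystyle \sup_{k\geq 1}w(m,k)\left|\Psi_1(m,k)\right|\stackrel{\mathcal{D}}{\rightarrow}\sup_{t>0}\rho(t)\left|\sigma_2W_2(t)+t\,\sigma_1W_1(1)\right|$, (ii) $\displaystyle \sup_{k\geq 1}w(m,k)\left|\Psi_2(m,k)\right|\stackrel{\mathcal{D}}{\rightarrow}\sup_{t>0}\rho(t)\left|\sigma_2(W_2(t)-W_2(tb))+t(1-b)\,\sigma_1W_1(1)\right|$, (iii) $\displaystyle \sup_{k\geq 1}w(m,k)\left|\Psi_3(m,k)\right|\stackrel{\mathcal{D}}{\rightarrow}\sup_{t>0}\rho(t)\sup_{0<s\leq t}\left|\sigma_2(W_2(t)-W_2(s))+(t-s)\,\sigma_1W_1(1)\right|$, where $\{W_1(t):t>0\}$ and $\{W_2(t):t>0\}$ are two independent standard Wiener processes and $\sigma_1,\sigma_2$ are the square roots of the long-run variances in Conditions (R).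
   Context: Setting. $m\ge1$ is the length of a historic data set $X_1,\dots,X_m$; $k\ge1$ is the monitoring time. Let $Y$ be an independent copy of $Y_1$ and $\theta=\operatorname{E}(h(Y,Y_1))$ (all expectations below are assumed to exist). Define $$\Gamma(m,k)=\frac1m\sum_{i=1}^m\sum_{j=m+1}^{m+k}(h(X_i,X_j)-\theta),$$ and the monitoring statistics $\Psi_1(m,k)=\Gamma(m,k)$; $\Psi_2(m,k)=\Gamma(m,k)-\Gamma(m,\lfloor kb\rfloor)=\frac1m\sum_{i=1}^m\sum_{j=m+\lfloor kb\rfloor+1}^{m+k}(h(X_i,X_j)-\theta)$; $\Psi_3(m,k)=\sup_{0\le l\le k}|\Gamma(m,k)-\Gamma(m,l)|$ with $\Gamma(m,0)=0$ ($l$ integer). Hoeffding decomposition: $h(x_1,x_2)=\theta+h_1(x_1)+h_2(x_2)+r(x_1,x_2)$, where $h_1(x_1)=\operatorname{E}(h(x_1,Y_1))-\theta$, $h_2(x_2)=\operatorname{E}(h(Y_1,x_2))-\theta$, $r(x_1,x_2)=h(x_1,x_2)-h_1(x_1)-h_2(x_2)-\theta$. Conditions (W) on the weight function: (i) $w(m,k)=m^{-1/2}\tilde w(m,k)$, where $\tilde w(m,k)=\rho(k/m)$ for $k>l_m$ and $\tilde w(m,k)=0$ for $k\le l_m$, for a sequence $l_m$ with $l_m/m\to0$; the function $\rho:(0,\infty)\to\mathbb{R}^+$ is positive and continuous. (ii) $\lim_{t\to0}t^\gamma\rho(t)$ exists and is finite for some $0\le\gamma<\frac12$. (iii) $\lim_{t\to\infty}t\rho(t)$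 exists and is finite. Conditions (R) on $\{Y_i\}$ and $h$: (i) $\operatorname{E}\big(\big|\sum_{i=1}^m\sum_{j=k_1}^{k_2}r(Y_i,Y_j)\big|^2\big)\le u(m)(k_2-k_1+1)$ for all $m+1\le k_1\le k_2$, with $\frac{u(m)}{m^{2-2\gamma}}\log(m)^2\to0$ as $m\to\infty$, $\gamma$ as in (W)(ii). (ii) For any $T>0$, $\{\frac1{\sqrt m}\sum_{i=1}^{\lfloor mt\rfloor}(h_1(Y_i),h_2(Y_i)):0<t\le T\}\stackrel{D}{\to}\{(\tilde W_1(t),\tilde W_2(t)):0<t\le T\}$ (functional central limit theorem), where $(\tilde W_1,\tilde W_2)$ is a bivariate Wiener process with mean zero and covariance matrix $\Sigma=\begin{pmatrix}\sigma_1^2&\varrho\\ \varrho&\sigma_2^2\end{pmatrix}$ (for some $\varrho$), with $\sigma_1^2=\sum_{n\in\mathbb{Z}}\operatorname{Cov}(h_1(Y_0),h_1(Y_n))$, $\sigma_2^2=\sum_{n\in\mathbb{Z}}\operatorname{Cov}(h_2(Y_0),h_2(Y_n))$. (iii) For all $0\le\alpha<\frac12$: $\sup_{1\le k\le m}\frac{1}{m^{1/2-\alpha}k^\alpha}\big|\sum_{j=1}^kh_2(Y_j)\big|=O_P(1)$ as $m\to\infty$. (iv) Uniformly in $m$, for any sequence $k_m>0$: $\sup_{k\ge k_m}\frac1k\big|\sum_{j=1}^kh_2(Y_j)\big|=O_P(1/\sqrt{k_m})$ as $k_m\to\infty$. *)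

theory Defs
  imports "HOL-Probability.Probability"
begin

section \<open>Convergence of random variables\<close>

text \<open>The suprema over an unbounded monitoring period have values in \<^typ>\<open>ereal\<close>, so
  convergence in distribution to an almost surely finite limit is stated for \<^typ>\<open>ereal\<close>-valued
  random variables, as the library's weak convergence of distribution functions. The \<open>X m\<close> may
  be infinite with a probability that vanishes as \<open>m \<rightarrow> \<infinity>\<close>. For real-valued random
  variables this is \<^const>\<open>weak_conv_m\<close>, see \<open>conv_in_distr_real_iff\<close>.\<close>

definition conv_in_distr ::
  "'a measure \<Rightarrow> (nat \<Rightarrow> 'a \<Rightarrow> ereal) \<Rightarrow> 'b measure \<Rightarrow> ('b \<Rightarrow> ereal) \<Rightarrow> bool" where
  "conv_in_distr M X N Z \<longleftrightarrow>
     (\<forall>m. X m \<in> borel_measurable M) \<and> Z \<in> borel_measurable N \<and> (AE \<omega> in N. \<bar>Z \<omega>\<bar> \<noteq> \<infinity>) \<and>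
     weak_conv (\<lambda>m x. measure M {\<omega>\<in>space M. X m \<omega> \<le> ereal x})
               (\<lambda>x. measure N {\<omega>\<in>space N. Z \<omega> \<le> ereal x})"

lemma conv_in_distr_real_iff:
  assumes [measurable]: "\<And>m. X m \<in> borel_measurable M" "Z \<in> borel_measurable N"
  shows "conv_in_distr M (\<lambda>m \<omega>. ereal (X m \<omega>)) N (\<lambda>\<omega>. ereal (Z \<omega>)) \<longleftrightarrow>
         weak_conv_m (\<lambda>m. distr M borel (X m)) (distr N borel Z)"
proof -
  have "(\<lambda>m. cdf (distr M borel (X m))) = (\<lambda>m x. measure M {\<omega>\<in>space M. X m \<omega> \<le> x})"
    by (simp add: cdf_def measure_distr vimage_def Int_def conj_commute fun_eq_iff)
  moreover have "cdf (distr N borel Z) = (\<lambda>x. measure N {\<omega>\<in>space N. Z \<omega> \<le> x})"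
    by (simp add: cdf_def measure_distr vimage_def Int_def conj_commute fun_eq_iff)
  ultimately show ?thesis
    by (simp add: conv_in_distr_def weak_conv_m_def)
qed

text \<open>\<open>X m = O\<^sub>P(a m)\<close> as \<open>m \<rightarrow> \<infinity>\<close>, for nonnegative \<open>X m\<close>.\<close>

definition bigO_prob :: "'a measure \<Rightarrow> (nat \<Rightarrow> 'a \<Rightarrow> ereal) \<Rightarrow> (nat \<Rightarrow> real) \<Rightarrow> bool" where
  "bigO_prob M X a \<longleftrightarrow>
     (\<forall>\<epsilon>>0. \<exists>C::real. \<forall>\<^sub>F m in sequentially.
        measure M {\<omega>\<in>space M. X m \<omega> > ereal (C * a m)} \<le> \<epsilon>)"


section \<open>Wiener processes and the functional central limit theorem\<close>

text \<open>Wiener process with covariance operator \<open>C\<close>: continuous paths from \<open>0\<close> with independent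
  increments such that \<open>W t - W s\<close> has the law \<open>N(0, (t - s) C)\<close>, given by its characteristic
  function because \<open>C\<close> may be singular.\<close>

definition wiener_process ::
  "'b measure \<Rightarrow> ('v::euclidean_space \<Rightarrow> 'v) \<Rightarrow> (real \<Rightarrow> 'b \<Rightarrow> 'v) \<Rightarrow> bool" where
  "wiener_process N C W \<longleftrightarrow> prob_space N \<and>
     (\<forall>t\<ge>0. W t \<in> borel_measurable N) \<and>
     (\<forall>\<omega>\<in>space N. W 0 \<omega> = 0 \<and> continuous_on {0..} (\<lambda>t. W t \<omega>)) \<and>
     (\<forall>n (t :: nat \<Rightarrow> real). 0 \<le> t 0 \<and> (\<forall>i<n. t i < t (Suc i)) \<longrightarrow>
        prob_space.indep_vars N (\<lambda>_. borel) (\<lambda>i \<omega>. W (t (Suc i)) \<omega> - W (t i) \<omega>) {..<n}) \<and>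
     (\<forall>s t u. 0 \<le> s \<and> s < t \<longrightarrow>
        (CLINT \<omega>|N. iexp (u \<bullet> (W t \<omega> - W s \<omega>))) =
          complex_of_real (exp (- (t - s) * (u \<bullet> C u) / 2)))"

abbreviation standard_wiener_process :: "'b measure \<Rightarrow> (real \<Rightarrow> 'b \<Rightarrow> real) \<Rightarrow> bool" where
  "standard_wiener_process N W \<equiv> wiener_process N (\<lambda>u. u) W"

definition indep_processes ::
  "'b measure \<Rightarrow> (real \<Rightarrow> 'b \<Rightarrow> real) \<Rightarrow> (real \<Rightarrow> 'b \<Rightarrow> real) \<Rightarrow> bool" where
  "indep_processes N V W \<longleftrightarrow>
     prob_space.indep_var N
       (Pi\<^sub>M {0..} (\<lambda>_. borel)) (\<lambda>\<omega>. \<lambda>t\<in>{0..}. V t \<omega>)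
       (Pi\<^sub>M {0..} (\<lambda>_. borel)) (\<lambda>\<omega>. \<lambda>t\<in>{0..}. W t \<omega>)"

text \<open>The Skorokhod space \<open>D[0,T]\<close>. Its elements are represented by functions on all of
  \<^typ>\<open>real\<close>, whose values outside \<open>[0,T]\<close> play no role.\<close>

definition cadlag :: "real \<Rightarrow> (real \<Rightarrow> 'v::metric_space) set" where
  "cadlag T = {x. (\<forall>t\<in>{0..<T}. (x \<longlongrightarrow> x t) (at_right t)) \<and>
                  (\<forall>t\<in>{0<..T}. \<exists>l. (x \<longlongrightarrow> l) (at_left t))}"

definition time_changes :: "real \<Rightarrow> (real \<Rightarrow> real) set" where
  "time_changes T = {\<tau>. strict_mono_on {0..T} \<tau> \<and> \<tau> ` {0..T} = {0..T}}"

definition skorokhod_dist ::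
  "real \<Rightarrow> (real \<Rightarrow> 'v::metric_space) \<Rightarrow> (real \<Rightarrow> 'v) \<Rightarrow> real" where
  "skorokhod_dist T x y =
     (INF \<tau>\<in>time_changes T.
        max (SUP t\<in>{0..T}. \<bar>\<tau> t - t\<bar>) (SUP t\<in>{0..T}. dist (x (\<tau> t)) (y t)))"

definition skorokhod_continuous ::
  "real \<Rightarrow> ((real \<Rightarrow> 'v::metric_space) \<Rightarrow> real) \<Rightarrow> bool" where
  "skorokhod_continuous T f \<longleftrightarrow>
     (\<forall>x\<in>cadlag T. \<forall>\<epsilon>>0. \<exists>\<delta>>0. \<forall>y\<in>cadlag T.
        skorokhod_dist T x y < \<delta> \<longrightarrow> \<bar>f x - f y\<bar> < \<epsilon>)"

text \<open>Convergence in distribution in \<open>D[0,T]\<close>.\<close>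

definition conv_in_distr_D ::
  "real \<Rightarrow> 'a measure \<Rightarrow> (nat \<Rightarrow> real \<Rightarrow> 'a \<Rightarrow> 'v::metric_space) \<Rightarrow>
   'b measure \<Rightarrow> (real \<Rightarrow> 'b \<Rightarrow> 'v) \<Rightarrow> bool" where
  "conv_in_distr_D T M X P Z \<longleftrightarrow>
     (\<forall>f. bounded (f ` cadlag T) \<and> skorokhod_continuous T f \<longrightarrow>
        (\<lambda>m. LINT \<omega>|M. f (\<lambda>t. X m t \<omega>)) \<longlonglongrightarrow> (LINT \<omega>|P. f (\<lambda>t. Z t \<omega>)))"


section \<open>The time series and the Hoeffding decomposition of the kernel\<close>

definition stationary_series :: "'a measure \<Rightarrow> (int \<Rightarrow> 'a \<Rightarrow> real) \<Rightarrow> bool" where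
  "stationary_series M Y \<longleftrightarrow>
     (\<forall>i. Y i \<in> borel_measurable M) \<and>
     (\<forall>s. distr M (Pi\<^sub>M UNIV (\<lambda>_. borel)) (\<lambda>\<omega> i. Y (i + s) \<omega>) =
          distr M (Pi\<^sub>M UNIV (\<lambda>_. borel)) (\<lambda>\<omega> i. Y i \<omega>))"

text \<open>The joint law of \<open>Y 1\<close> and an independent copy of it.\<close>

definition indep_copy_law :: "'a measure \<Rightarrow> (int \<Rightarrow> 'a \<Rightarrow> real) \<Rightarrow> (real \<times> real) measure" where
  "indep_copy_law M Y = distr M borel (Y 1) \<Otimes>\<^sub>M distr M borel (Y 1)"

definition kernel_mean :: "'a measure \<Rightarrow> (int \<Rightarrow> 'a \<Rightarrow> real) \<Rightarrow> (real \<Rightarrow> real \<Rightarrow> real) \<Rightarrow> real" where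
  "kernel_mean M Y h = (LINT (x, y)|indep_copy_law M Y. h x y)"

definition hoeffding1 ::
  "'a measure \<Rightarrow> (int \<Rightarrow> 'a \<Rightarrow> real) \<Rightarrow> (real \<Rightarrow> real \<Rightarrow> real) \<Rightarrow> real \<Rightarrow> real" where
  "hoeffding1 M Y h x = (LINT \<omega>|M. h x (Y 1 \<omega>)) - kernel_mean M Y h"

definition hoeffding2 ::
  "'a measure \<Rightarrow> (int \<Rightarrow> 'a \<Rightarrow> real) \<Rightarrow> (real \<Rightarrow> real \<Rightarrow> real) \<Rightarrow> real \<Rightarrow> real" where
  "hoeffding2 M Y h x = (LINT \<omega>|M. h (Y 1 \<omega>) x) - kernel_mean M Y h"

definition hoeffding_rem ::
  "'a measure \<Rightarrow> (int \<Rightarrow> 'a \<Rightarrow> real) \<Rightarrow> (real \<Rightarrow> real \<Rightarrow> real) \<Rightarrow> real \<Rightarrow> real \<Rightarrow> real" where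
  "hoeffding_rem M Y h x y =
     h x y - hoeffding1 M Y h x - hoeffding2 M Y h y - kernel_mean M Y h"

definition kernel_expectations_exist ::
  "'a measure \<Rightarrow> (int \<Rightarrow> 'a \<Rightarrow> real) \<Rightarrow> (real \<Rightarrow> real \<Rightarrow> real) \<Rightarrow> bool" where
  "kernel_expectations_exist M Y h \<longleftrightarrow>
     integrable (indep_copy_law M Y) (\<lambda>(x, y). h x y) \<and>
     (\<forall>x. integrable M (\<lambda>\<omega>. h x (Y 1 \<omega>)) \<and> integrable M (\<lambda>\<omega>. h (Y 1 \<omega>) x))"

definition covariance :: "'a measure \<Rightarrow> ('a \<Rightarrow> real) \<Rightarrow> ('a \<Rightarrow> real) \<Rightarrow> real" where
  "covariance M U V = (LINT \<omega>|M. (U \<omega> - (LINT \<omega>|M. U \<omega>)) * (V \<omega> - (LINT \<omega>|M. V \<omega>)))"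

text \<open>\<open>\<sigma>\<close> is the square root of the long-run variance of \<open>(g (Y n))\<close>.\<close>

definition long_run_sd ::
  "'a measure \<Rightarrow> (int \<Rightarrow> 'a \<Rightarrow> real) \<Rightarrow> (real \<Rightarrow> real) \<Rightarrow> real \<Rightarrow> bool" where
  "long_run_sd M Y g \<sigma> \<longleftrightarrow> \<sigma> \<ge> 0 \<and>
     integrable M (\<lambda>\<omega>. (g (Y 0 \<omega>))\<^sup>2) \<and>
     ((\<lambda>n::int. covariance M (\<lambda>\<omega>. g (Y 0 \<omega>)) (\<lambda>\<omega>. g (Y n \<omega>))) has_sum \<sigma>\<^sup>2) UNIV"


section \<open>Conditions on the weight function\<close>

definition weight_conditions ::
  "(nat \<Rightarrow> nat \<Rightarrow> real) \<Rightarrow> (real \<Rightarrow> real) \<Rightarrow> real \<Rightarrow> bool" where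
  "weight_conditions w \<rho> \<gamma> \<longleftrightarrow>
     (\<exists>l :: nat \<Rightarrow> real. (\<lambda>m. l m / real m) \<longlonglongrightarrow> 0 \<and>
        (\<forall>m\<ge>1. \<forall>k\<ge>1. w m k =
           real m powr (- 1 / 2) * (if real k > l m then \<rho> (real k / real m) else 0))) \<and>
     (\<forall>t>0. \<rho> t > 0) \<and> continuous_on {0<..} \<rho> \<and>
     0 \<le> \<gamma> \<and> \<gamma> < 1 / 2 \<and>
     (\<exists>c. ((\<lambda>t. t powr \<gamma> * \<rho> t) \<longlongrightarrow> c) (at_right 0)) \<and>
     (\<exists>c. ((\<lambda>t. t * \<rho> t) \<longlongrightarrow> c) at_top)"


section \<open>Conditions on the time series and the kernel\<close>

definition remainder_condition ::
  "'a measure \<Rightarrow> (int \<Rightarrow> 'a \<Rightarrow> real) \<Rightarrow> (real \<Rightarrow> real \<Rightarrow> real) \<Rightarrow> real \<Rightarrow> bool" where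
  "remainder_condition M Y h \<gamma> \<longleftrightarrow>
     (\<exists>u :: nat \<Rightarrow> real.
        (\<forall>m k1 k2. 1 \<le> m \<and> m + 1 \<le> k1 \<and> k1 \<le> k2 \<longrightarrow>
           (let R = (\<lambda>\<omega>. \<Sum>i=1..m. \<Sum>j=k1..k2. hoeffding_rem M Y h (Y (int i) \<omega>) (Y (int j) \<omega>))
            in integrable M (\<lambda>\<omega>. \<bar>R \<omega>\<bar>\<^sup>2) \<and>
               (LINT \<omega>|M. \<bar>R \<omega>\<bar>\<^sup>2) \<le> u m * (real k2 - real k1 + 1))) \<and>
        (\<lambda>m. u m / real m powr (2 - 2 * \<gamma>) * (ln (real m))\<^sup>2) \<longlonglongrightarrow> 0)"

text \<open>The covariance matrix of the limit has rows \<open>(\<sigma>1\<^sup>2, c)\<close> and \<open>(c, \<sigma>2\<^sup>2)\<close>.\<close>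

definition fclt_condition ::
  "'a measure \<Rightarrow> (int \<Rightarrow> 'a \<Rightarrow> real) \<Rightarrow> (real \<Rightarrow> real \<Rightarrow> real) \<Rightarrow> real \<Rightarrow> real \<Rightarrow>
   real \<Rightarrow> 'p measure \<Rightarrow> (real \<Rightarrow> 'p \<Rightarrow> real \<times> real) \<Rightarrow> bool" where
  "fclt_condition M Y h \<sigma>1 \<sigma>2 c P Z \<longleftrightarrow>
     long_run_sd M Y (hoeffding1 M Y h) \<sigma>1 \<and>
     long_run_sd M Y (hoeffding2 M Y h) \<sigma>2 \<and>
     wiener_process P (\<lambda>(a, b). (\<sigma>1\<^sup>2 * a + c * b, c * a + \<sigma>2\<^sup>2 * b)) Z \<and>
     (\<forall>T>0. conv_in_distr_D T M
        (\<lambda>m t \<omega>. (1 / sqrt (real m)) *\<^sub>R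
           (\<Sum>i=1..nat \<lfloor>real m * t\<rfloor>.
              (hoeffding1 M Y h (Y (int i) \<omega>), hoeffding2 M Y h (Y (int i) \<omega>))))
        P Z)"

definition early_sum_condition ::
  "'a measure \<Rightarrow> (int \<Rightarrow> 'a \<Rightarrow> real) \<Rightarrow> (real \<Rightarrow> real \<Rightarrow> real) \<Rightarrow> bool" where
  "early_sum_condition M Y h \<longleftrightarrow>
     (\<forall>\<alpha>. 0 \<le> \<alpha> \<and> \<alpha> < 1 / 2 \<longrightarrow>
        bigO_prob M
          (\<lambda>m \<omega>. SUP k\<in>{1..m}. ereal (1 / (real m powr (1 / 2 - \<alpha>) * real k powr \<alpha>) *
             \<bar>\<Sum>j=1..k. hoeffding2 M Y h (Y (int j) \<omega>)\<bar>))
          (\<lambda>_. 1))"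

definition late_sum_condition ::
  "'a measure \<Rightarrow> (int \<Rightarrow> 'a \<Rightarrow> real) \<Rightarrow> (real \<Rightarrow> real \<Rightarrow> real) \<Rightarrow> bool" where
  "late_sum_condition M Y h \<longleftrightarrow>
     (\<forall>\<kappa> :: nat \<Rightarrow> real. (\<forall>m. \<kappa> m > 0) \<and> filterlim \<kappa> at_top sequentially \<longrightarrow>
        bigO_prob M
          (\<lambda>m \<omega>. SUP k\<in>{k. real k \<ge> \<kappa> m}. ereal (1 / real k *
             \<bar>\<Sum>j=1..k. hoeffding2 M Y h (Y (int j) \<omega>)\<bar>))
          (\<lambda>m. 1 / sqrt (\<kappa> m)))"


section \<open>Monitoring statistics\<close>

definition Gamma_stat ::
  "(real \<Rightarrow> real \<Rightarrow> real) \<Rightarrow> real \<Rightarrow> (nat \<Rightarrow> 'a \<Rightarrow> real) \<Rightarrow> nat \<Rightarrow> nat \<Rightarrow> 'a \<Rightarrow> real" where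
  "Gamma_stat h \<theta> X m k \<omega> =
     1 / real m * (\<Sum>i=1..m. \<Sum>j=m+1..m+k. (h (X i \<omega>) (X j \<omega>) - \<theta>))"

definition Psi1 ::
  "(real \<Rightarrow> real \<Rightarrow> real) \<Rightarrow> real \<Rightarrow> (nat \<Rightarrow> 'a \<Rightarrow> real) \<Rightarrow> nat \<Rightarrow> nat \<Rightarrow> 'a \<Rightarrow> real" where
  "Psi1 h \<theta> X m k \<omega> = Gamma_stat h \<theta> X m k \<omega>"

definition Psi2 ::
  "real \<Rightarrow> (real \<Rightarrow> real \<Rightarrow> real) \<Rightarrow> real \<Rightarrow> (nat \<Rightarrow> 'a \<Rightarrow> real) \<Rightarrow> nat \<Rightarrow> nat \<Rightarrow> 'a \<Rightarrow> real" where
  "Psi2 b h \<theta> X m k \<omega> =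
     Gamma_stat h \<theta> X m k \<omega> - Gamma_stat h \<theta> X m (nat \<lfloor>real k * b\<rfloor>) \<omega>"

definition Psi3 ::
  "(real \<Rightarrow> real \<Rightarrow> real) \<Rightarrow> real \<Rightarrow> (nat \<Rightarrow> 'a \<Rightarrow> real) \<Rightarrow> nat \<Rightarrow> nat \<Rightarrow> 'a \<Rightarrow> real" where
  "Psi3 h \<theta> X m k \<omega> =
     (SUP l\<in>{0..k}. \<bar>Gamma_stat h \<theta> X m k \<omega> - Gamma_stat h \<theta> X m l \<omega>\<bar>)"

end

theory Submission
  imports Defs
begin

text \<open>All three statistics are weighted suprema of increments: with \<open>U = {0}\<close>, \<open>U = {b}\<close> and
  \<open>U = {0<..1}\<close>, respectively, they are \<open>sup w(m,k) \<bar>\<Gamma>(m,k) - \<Gamma>(m,\<lfloor>ku\<rfloor>)\<bar>\<close> over \<open>k \<ge> 1\<close>, \<open>u \<in> U\<close>, and the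
  limits are \<open>sup \<rho>(t) \<bar>D(t) - D(tu)\<bar>\<close> over \<open>t > 0\<close>, \<open>u \<in> U\<close>, where \<open>D(t) = \<sigma>2 W2(t) + t \<sigma>1 W1(1)\<close>.
  The Hoeffding remainder is removed by a Rademacher-Menshov maximal inequality on dyadic blocks.
  On a window \<open>1/s \<le> k/m \<le> s\<^sup>2\<close> the functional central limit theorem on \<open>[0, 1 + s\<^sup>2]\<close> applies, where
  \<open>Z1(1)\<close> is independent of \<open>Z2(1 + t) - Z2(1)\<close> although \<open>Z1\<close> and \<open>Z2\<close> may be correlated.
  Below the window the weighted statistic is small by the early sum condition. Beyond the window
  the late sum condition shows that it exceeds its value at \<open>k = s\<^sup>2 m\<close> by little, because \<open>t \<rho>(t)\<close>
  converges. Since this comparison takes place before the limit, neither path properties of the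
  Wiener process near \<open>0\<close> and \<open>\<infinity>\<close> nor the almost sure finiteness of the limit are needed
  beforehand; the latter is a consequence.\<close>

section \<open>Maximal inequality and the remainder\<close>

text \<open>The difficult end is infinity. There \<open>t * \<rho> t\<close> may tend to a positive
  constant, so that \<open>\<rho> t * t * (1 - u) * \<bar>A\<bar>\<close> with the random slope
  \<open>A\<close> stays of order one: the tail cannot be discarded and has to be absorbed by the
  right end of the window. The drift is largest for the smallest \<open>u\<close>, hence the
  parameter \<open>u0\<close> that accompanies \<open>U\<close>. Intermediate comparisons have the
  form \<open>P(F \<le> a) \<le> P(G \<le> a + e) + \<epsilon>\<close>, in both directions. Such
  bounds can be chained without knowing the continuity points of any law; these matter only when
  weak convergence is read off at the end. The statistics live on the grid \<open>k / m\<close>, so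
  the functional applied to the partial sum path changes with \<open>m\<close>. Therefore the
  mapping theorem is set up for a sequence of functionals that converge along paths uniformly close
  to a continuous one. The same grid functionals link the process \<open>Z\<close> on
  \<open>P\<close> to \<open>W1\<close>, \<open>W2\<close> on \<open>N\<close>: they see finitely
  many increments, whose joint law is fixed by characteristic functions and independence.\<close>

lemma maximal_square_bound:
  fixes S :: "nat \<Rightarrow> 'a \<Rightarrow> real" and C :: real
  assumes int: "\<And>a b. a < b \<Longrightarrow> integrable M (\<lambda>\<omega>. (S b \<omega> - S a \<omega>)\<^sup>2)"
    and bnd: "\<And>a b. a < b \<Longrightarrow> (LINT \<omega>|M. (S b \<omega> - S a \<omega>)\<^sup>2) \<le> C * real (b - a)"
  shows "\<exists>g. integrable M g \<and> (\<forall>\<omega>. 0 \<le> g \<omega>) \<and>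
           (\<forall>\<omega>. \<forall>k\<le>2^n. (S (a + k) \<omega> - S a \<omega>)\<^sup>2 \<le> g \<omega>) \<and>
           (LINT \<omega>|M. g \<omega>) \<le> C * 2^n * (real n + 1)\<^sup>2"
\<comment> \<open>The block is halved at \<open>a + 2^n\<close>. An explicit majorant
  \<open>g\<close> is carried along instead of the maximum, because the majorants of the two halves
  and the square of the middle increment can simply be added.\<close>
proof (induction n arbitrary: a)
  case 0
  show ?case
  proof (intro exI conjI allI impI)
    show "integrable M (\<lambda>\<omega>. (S (a + 1) \<omega> - S a \<omega>)\<^sup>2)" by (rule int) simp
    show "(LINT \<omega>|M. (S (a + 1) \<omega> - S a \<omega>)\<^sup>2) \<le> C * 2^0 * (real 0 + 1)\<^sup>2"
      using bnd[of a "a + 1"] by simp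
    show "(S (a + k) \<omega> - S a \<omega>)\<^sup>2 \<le> (S (a + 1) \<omega> - S a \<omega>)\<^sup>2" if "k \<le> 2^0" for k \<omega>
      using that by (cases k) auto
  qed auto
next
  case (Suc n)
  obtain g1 where g1: "integrable M g1" "\<And>\<omega>. 0 \<le> g1 \<omega>"
    "\<And>\<omega> k. k \<le> 2^n \<Longrightarrow> (S (a + k) \<omega> - S a \<omega>)\<^sup>2 \<le> g1 \<omega>"
    "(LINT \<omega>|M. g1 \<omega>) \<le> C * 2^n * (real n + 1)\<^sup>2" using Suc.IH[of a] by blast
  obtain g2 where g2: "integrable M g2" "\<And>\<omega>. 0 \<le> g2 \<omega>"
    "\<And>\<omega> k. k \<le> 2^n \<Longrightarrow> (S (a + 2^n + k) \<omega> - S (a + 2^n) \<omega>)\<^sup>2 \<le> g2 \<omega>"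
    "(LINT \<omega>|M. g2 \<omega>) \<le> C * 2^n * (real n + 1)\<^sup>2" using Suc.IH[of "a + 2^n"] by blast
  define B where "B = (\<lambda>\<omega>. S (a + 2^n) \<omega> - S a \<omega>)"
  have iB: "integrable M (\<lambda>\<omega>. (B \<omega>)\<^sup>2)" unfolding B_def by (rule int) simp
  have eB: "(LINT \<omega>|M. (B \<omega>)\<^sup>2) \<le> C * 2^n"
    unfolding B_def using bnd[of a "a + 2^n"] by simp
  \<comment> \<open>Young's inequality \<open>(x + y)\<^sup>2 \<le> (1 + p) * x\<^sup>2 + (1 + 1 /
    p) * y\<^sup>2\<close> with \<open>p = n + 1\<close>, where \<open>x\<close> is the increment
    over the first half. Taking \<open>g1 + g2\<close> for the larger of the two costs a factor 2,
    which is the doubled block length. The factor \<open>(n + 2) / (n + 1)\<close> turns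
    \<open>(n + 1)\<^sup>2\<close> into \<open>(n + 1) * (n + 2)\<close>, and the term with
    \<open>B\<close> adds half of \<open>n + 2\<close>, so that the total stays below
    \<open>(n + 2)\<^sup>2\<close>.\<close>
  define g where "g = (\<lambda>\<omega>. (real n + 2) * (B \<omega>)\<^sup>2 + (1 + 1 / (real n + 1)) * (g1 \<omega> + g2 \<omega>))"
  have ig: "integrable M g" unfolding g_def using iB g1(1) g2(1) by auto
  have young: "(x + y)\<^sup>2 \<le> (real n + 2) * x\<^sup>2 + (1 + 1 / (real n + 1)) * y\<^sup>2" for x y :: real
  proof -
    have "0 \<le> ((real n + 1) * x - y)\<^sup>2 / (real n + 1)" by simp
    also have "\<dots> = (real n + 1) * x\<^sup>2 - 2 * x * y + y\<^sup>2 / (real n + 1)"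
      by (simp add: power2_eq_square field_simps)
    finally show ?thesis by (simp add: power2_eq_square algebra_simps)
  qed
  have "(S (a + k) \<omega> - S a \<omega>)\<^sup>2 \<le> g \<omega>" if "k \<le> 2^Suc n" for k \<omega>
  proof (cases "k \<le> 2^n")
    case True
    have "(S (a + k) \<omega> - S a \<omega>)\<^sup>2 \<le> 1 * (g1 \<omega> + g2 \<omega>)"
      using g1(3)[OF True, of \<omega>] g2(2)[of \<omega>] by simp
    also have "\<dots> \<le> (1 + 1 / (real n + 1)) * (g1 \<omega> + g2 \<omega>)"
      by (intro mult_right_mono) (auto simp: g1 g2)
    also have "\<dots> \<le> g \<omega>" unfolding g_def by simp
    finally show ?thesis .
  next
    case False
    then obtain k' where k: "k = 2^n + k'" using nat_le_linear le_Suc_ex by blast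
    with that have k': "k = 2^n + k'" "k' \<le> 2^n" by auto
    have "(S (a + k) \<omega> - S a \<omega>)\<^sup>2 = (B \<omega> + (S (a + 2^n + k') \<omega> - S (a + 2^n) \<omega>))\<^sup>2"
      by (simp add: B_def k' add.assoc)
    also have "\<dots> \<le> (real n + 2) * (B \<omega>)\<^sup>2 +
        (1 + 1 / (real n + 1)) * (S (a + 2^n + k') \<omega> - S (a + 2^n) \<omega>)\<^sup>2" by (rule young)
    also have "\<dots> \<le> g \<omega>"
      unfolding g_def using g2(3)[OF k'(2), of \<omega>] g1(2)[of \<omega>]
      by (intro add_left_mono mult_left_mono) auto
    finally show ?thesis .
  qed
  moreover have "(LINT \<omega>|M. g \<omega>) \<le> C * 2^Suc n * (real (Suc n) + 1)\<^sup>2"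
  proof -
    have C: "0 \<le> C"
    proof -
      have "0 \<le> (LINT \<omega>|M. (B \<omega>)\<^sup>2)" by simp
      with eB have "0 \<le> C * 2^n" by linarith
      then show ?thesis by (meson mult_neg_pos not_le zero_less_numeral zero_less_power)
    qed
    have "(LINT \<omega>|M. g \<omega>) = (real n + 2) * (LINT \<omega>|M. (B \<omega>)\<^sup>2) +
        (1 + 1 / (real n + 1)) * ((LINT \<omega>|M. g1 \<omega>) + (LINT \<omega>|M. g2 \<omega>))"
      unfolding g_def using iB g1(1) g2(1) by simp
    also have "\<dots> \<le> (real n + 2) * (C * 2^n) +
        (1 + 1 / (real n + 1)) * (C * 2^n * (real n + 1)\<^sup>2 + C * 2^n * (real n + 1)\<^sup>2)"
      using eB g1(4) g2(4) by (intro add_mono mult_left_mono) auto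
    also have "\<dots> = C * 2^n * (real n + 2) * (1 + 2 * (real n + 1))"
      by (simp add: power2_eq_square field_simps)
    also have "\<dots> \<le> C * 2^n * (real n + 2) * (2 * (real n + 2))"
      using C by (intro mult_left_mono) auto
    also have "\<dots> = C * 2^Suc n * (real (Suc n) + 1)\<^sup>2"
      by (simp add: power2_eq_square algebra_simps)
    finally show ?thesis .
  qed
  moreover have "0 \<le> g \<omega>" for \<omega> unfolding g_def using g1(2)[of \<omega>] g2(2)[of \<omega>] by auto
  ultimately show ?case using ig by blast
qed

lemma (in prob_space) maximal_prob_bound:
  fixes S :: "nat \<Rightarrow> 'a \<Rightarrow> real" and C t :: real
  assumes int: "\<And>a b. a < b \<Longrightarrow> integrable M (\<lambda>\<omega>. (S b \<omega> - S a \<omega>)\<^sup>2)"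
    and bnd: "\<And>a b. a < b \<Longrightarrow> (LINT \<omega>|M. (S b \<omega> - S a \<omega>)\<^sup>2) \<le> C * real (b - a)"
    and "t > 0" and [measurable]: "\<And>k. S k \<in> borel_measurable M"
  shows "prob {\<omega>\<in>space M. \<exists>k\<le>2^n. t < \<bar>S k \<omega> - S 0 \<omega>\<bar>} \<le> C * 2^n * (real n + 1)\<^sup>2 / t\<^sup>2"
proof -
  obtain g where g: "integrable M g" "\<And>\<omega>. 0 \<le> g \<omega>"
    "\<And>\<omega> k. k \<le> 2^n \<Longrightarrow> (S (0 + k) \<omega> - S 0 \<omega>)\<^sup>2 \<le> g \<omega>"
    "(LINT \<omega>|M. g \<omega>) \<le> C * 2^n * (real n + 1)\<^sup>2"
    using maximal_square_bound[where M = M and S = S and C = C and n = n and a = 0, OF int bnd] by blast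
  have [measurable]: "g \<in> borel_measurable M" using g(1) by auto
  have "prob {\<omega>\<in>space M. \<exists>k\<le>2^n. t < \<bar>S k \<omega> - S 0 \<omega>\<bar>} \<le> prob {\<omega>\<in>space M. t\<^sup>2 \<le> g \<omega>}"
  proof (intro finite_measure_mono subsetI)
    fix \<omega> assume "\<omega> \<in> {\<omega>\<in>space M. \<exists>k\<le>2^n. t < \<bar>S k \<omega> - S 0 \<omega>\<bar>}"
    then obtain k where k: "\<omega> \<in> space M" "k \<le> 2^n" "t < \<bar>S k \<omega> - S 0 \<omega>\<bar>" by auto
    have "t\<^sup>2 \<le> \<bar>S k \<omega> - S 0 \<omega>\<bar>\<^sup>2" using k \<open>t > 0\<close> by (intro power_mono) auto
    with g(3)[OF k(2), of \<omega>] k(1) show "\<omega> \<in> {\<omega>\<in>space M. t\<^sup>2 \<le> g \<omega>}" by simp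
  qed auto
  also have "\<dots> \<le> (LINT \<omega>|M. g \<omega>) / t\<^sup>2"
    using g(1,2) \<open>t > 0\<close> by (intro integral_Markov_inequality_measure[where A = "{}"]) auto
  also have "\<dots> \<le> C * 2^n * (real n + 1)\<^sup>2 / t\<^sup>2"
    using g(4) by (intro divide_right_mono) auto
  finally show ?thesis .
qed

section \<open>Weight bounds and negligibility of the Hoeffding remainder\<close>

text \<open>The two limits control \<open>\<rho>\<close> near 0 and near infinity, compactness
  covers the rest. The two ranges overlap on \<open>[1, 2]\<close> on purpose: a power of two
  between \<open>m\<close> and \<open>2 * m\<close> will separate the regimes, so
  \<open>k / m\<close> may reach 2 in the first one.\<close>

lemma weight_function_bound:
  fixes \<rho> :: "real \<Rightarrow> real"
  assumes \<rho>: "continuous_on {0<..} \<rho>"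
    and lim0: "((\<lambda>t. t powr \<gamma> * \<rho> t) \<longlongrightarrow> c0) (at_right 0)" and lim1: "((\<lambda>t. t * \<rho> t) \<longlongrightarrow> c1) at_top"
  shows "\<exists>C>0. (\<forall>t. 0 < t \<and> t \<le> 2 \<longrightarrow> \<rho> t \<le> C * t powr (- \<gamma>)) \<and> (\<forall>t\<ge>1. \<rho> t \<le> C / t)"
proof -
  have "\<forall>\<^sub>F t in at_right 0. t powr \<gamma> * \<rho> t < c0 + 1" using lim0 by (rule order_tendstoD) simp
  then obtain d where d: "d > 0" "\<And>t. 0 < t \<Longrightarrow> t < d \<Longrightarrow> t powr \<gamma> * \<rho> t < c0 + 1"
    unfolding eventually_at_right_field by auto
  have "\<forall>\<^sub>F t in at_top. t * \<rho> t < c1 + 1" using lim1 by (rule order_tendstoD) simp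
  then obtain Q where Q: "\<And>t. t \<ge> Q \<Longrightarrow> t * \<rho> t < c1 + 1" unfolding eventually_at_top_linorder by auto
  have "bounded ((\<lambda>t. t powr \<gamma> * \<rho> t) ` {d..2})"
    using d(1) by (intro compact_imp_bounded compact_continuous_image continuous_intros continuous_on_subset[OF \<rho>]) auto
  then obtain C0 where "\<forall>x\<in>(\<lambda>t. t powr \<gamma> * \<rho> t) ` {d..2}. \<bar>x\<bar> \<le> C0" unfolding bounded_real by blast
  then have "\<bar>t powr \<gamma> * \<rho> t\<bar> \<le> C0" if "d \<le> t" "t \<le> 2" for t using that by simp
  then have C0: "t powr \<gamma> * \<rho> t \<le> C0" if "d \<le> t" "t \<le> 2" for t using that abs_le_D1 by blast
  have "bounded ((\<lambda>t. t * \<rho> t) ` {1..Q})"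
    by (intro compact_imp_bounded compact_continuous_image continuous_intros continuous_on_subset[OF \<rho>]) auto
  then obtain C1 where "\<forall>x\<in>(\<lambda>t. t * \<rho> t) ` {1..Q}. \<bar>x\<bar> \<le> C1" unfolding bounded_real by blast
  then have "\<bar>t * \<rho> t\<bar> \<le> C1" if "1 \<le> t" "t \<le> Q" for t using that by simp
  then have C1: "t * \<rho> t \<le> C1" if "1 \<le> t" "t \<le> Q" for t using that abs_le_D1 by blast
  define C where "C = max 1 (max (c0 + 1) (max (c1 + 1) (max C0 C1)))"
  have "\<rho> t \<le> C * t powr (- \<gamma>)" if t: "0 < t" "t \<le> 2" for t
  proof -
    have "t powr \<gamma> * \<rho> t \<le> C"
      using d(2)[OF t(1)] C0[OF _ t(2)] unfolding C_def by (cases "t < d") (auto simp: le_max_iff_disj)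
    have "\<rho> t = t powr (- \<gamma>) * (t powr \<gamma> * \<rho> t)" using t by (simp add: powr_minus)
    also have "\<dots> \<le> t powr (- \<gamma>) * C" using \<open>t powr \<gamma> * \<rho> t \<le> C\<close> by (intro mult_left_mono) auto
    finally show ?thesis by (simp only: mult.commute)
  qed
  moreover have "\<rho> t \<le> C / t" if t: "1 \<le> t" for t
  proof -
    have "t * \<rho> t \<le> C"
      using Q[of t] C1[OF t] unfolding C_def by (cases "t < Q") (auto simp: le_max_iff_disj)
    then show ?thesis using t by (simp add: le_divide_eq mult.commute)
  qed
  moreover have "C > 0" by (simp add: C_def)
  ultimately show ?thesis by blast
qed

lemma summable_square_geometric: "summable (\<lambda>i. (real i + 1)\<^sup>2 * (1 / 2) ^ i)"
\<comment> \<open>Consecutive terms have the ratio \<open>((i + 2) / (i + 1))\<^sup>2 / 2\<close>,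
  which is below 3/4 from \<open>i = 4\<close> on.\<close>
proof (rule summable_ratio_test[where c = "3 / 4" and N = 4])
  fix i :: nat assume "4 \<le> i"
  then obtain j where "i = 4 + j" using le_Suc_ex by blast
  then have "2 * (real (Suc i) + 1)\<^sup>2 \<le> 3 * (real i + 1)\<^sup>2" by (simp add: power2_eq_square algebra_simps)
  then have "(real (Suc i) + 1)\<^sup>2 * (1 / 2) \<le> 3 / 4 * (real i + 1)\<^sup>2" by simp
  then have "(real (Suc i) + 1)\<^sup>2 * (1 / 2) * (1 / 2) ^ i \<le> 3 / 4 * (real i + 1)\<^sup>2 * (1 / 2) ^ i"
    by (intro mult_right_mono) auto
  then show "norm ((real (Suc i) + 1)\<^sup>2 * (1 / 2) ^ Suc i) \<le> 3 / 4 * norm ((real i + 1)\<^sup>2 * (1 / 2) ^ i)"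
    by (simp add: abs_mult mult_ac)
qed simp

lemma dyadic_exponent:
  assumes "1 \<le> m"
  shows "\<exists>n. real m \<le> 2 ^ n \<and> 2 ^ n \<le> 2 * real m \<and> (2 \<le> m \<longrightarrow> real n + 1 \<le> 3 / ln 2 * ln (real m))"
proof -
  define n where "n = (LEAST n. m \<le> 2 ^ n)"
  have ex: "m \<le> 2 ^ m" using less_exp[of m] by simp
  have 1: "m \<le> 2 ^ n" unfolding n_def using ex by (rule LeastI)
  have 2: "2 ^ n \<le> 2 * m"
  proof (cases n)
    case (Suc n')
    then have "\<not> m \<le> 2 ^ n'" using not_less_Least[of n' "\<lambda>n. m \<le> 2 ^ n"] unfolding n_def by simp
    then show ?thesis using Suc by simp
  qed (use assms in simp)
  have n1: "real m \<le> 2 ^ n" using 1 by (metis of_nat_le_iff of_nat_numeral of_nat_power)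
  have n2: "2 ^ n \<le> 2 * real m" using 2 by (metis of_nat_le_iff of_nat_mult of_nat_numeral of_nat_power)
  \<comment> \<open>From \<open>2 ^ n \<le> 2 * m\<close> follows
    \<open>(n + 1) * ln 2 \<le> 2 * ln 2 + ln m\<close>, and \<open>ln 2 \<le> ln m\<close> bounds
    this by \<open>3 * ln m\<close>. The case \<open>m = 1\<close> is left out because
    \<open>ln 1 = 0\<close>.\<close>
  have "real n + 1 \<le> 3 / ln 2 * ln (real m)" if "2 \<le> m"
  proof -
    have "ln ((2::real) ^ n) \<le> ln (2 * real m)" using n2 by (subst ln_le_cancel_iff) (use that in auto)
    then have "real n * ln 2 \<le> ln 2 + ln (real m)" using that by (simp add: ln_realpow ln_mult)
    moreover have "ln 2 \<le> ln (real m)" using that by simp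
    ultimately have "(real n + 1) * ln 2 \<le> 3 * ln (real m)" by (simp add: algebra_simps)
    then show ?thesis by (simp add: field_simps)
  qed
  with n1 n2 show ?thesis by blast
qed

text \<open>A union bound over the index ranges \<open>l \<le> 2 ^ (n + i)\<close>, where
  \<open>2 ^ n\<close> is about \<open>m\<close>. On range \<open>i\<close> the weight is at most of
  order \<open>m powr \<gamma> / 2 ^ i\<close>, while the maximal inequality contributes
  \<open>u m * 2 ^ (n + i) * (n + i + 1)\<^sup>2\<close>. Dividing by the squared threshold leaves,
  up to constants, the summable \<open>(i + 1)\<^sup>2 / 2 ^ i\<close> times
  \<open>u m * (n + 1)\<^sup>2 / m powr (2 - 2 * \<gamma>)\<close>: the squared logarithm in the
  remainder condition pays for the maximal inequality. The weight is taken at \<open>k\<close> and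
  the sum at any \<open>l \<le> k\<close>, because an increment from \<open>l\<close> to
  \<open>k\<close> is weighted at \<open>k\<close>.\<close>

lemma (in prob_space) remainder_negligible:
  fixes R :: "nat \<Rightarrow> nat \<Rightarrow> 'a \<Rightarrow> real" and u :: "nat \<Rightarrow> real" and \<rho> :: "real \<Rightarrow> real"
  assumes R[measurable]: "\<And>m k. R m k \<in> borel_measurable M" and R0: "\<And>m \<omega>. R m 0 \<omega> = 0"
    and int: "\<And>m a b. 1 \<le> m \<Longrightarrow> a < b \<Longrightarrow> integrable M (\<lambda>\<omega>. (R m b \<omega> - R m a \<omega>)\<^sup>2)"
    and bnd: "\<And>m a b. 1 \<le> m \<Longrightarrow> a < b \<Longrightarrow> (LINT \<omega>|M. (R m b \<omega> - R m a \<omega>)\<^sup>2) \<le> u m * real (b - a)"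
    and u: "(\<lambda>m. u m / real m powr (2 - 2 * \<gamma>) * (ln (real m))\<^sup>2) \<longlonglongrightarrow> 0"
    and \<gamma>: "0 \<le> \<gamma>" and C: "C > 0" "\<And>t. 0 < t \<Longrightarrow> t \<le> 2 \<Longrightarrow> \<rho> t \<le> C * t powr (- \<gamma>)" "\<And>t. t \<ge> 1 \<Longrightarrow> \<rho> t \<le> C / t"
    and "e > 0" "\<epsilon> > 0"
  shows "\<forall>\<^sub>F m in sequentially. prob {\<omega>\<in>space M. \<exists>k\<ge>1. \<exists>l\<le>k.
      e < \<rho> (real k / real m) * (\<bar>R m l \<omega>\<bar> / (real m * sqrt (real m)))} \<le> \<epsilon>"
proof -
  define Q where "Q = (\<Sum>i. (real i + 1)\<^sup>2 * (1 / 2) ^ i)"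
  have Q: "0 \<le> Q" unfolding Q_def by (intro suminf_nonneg summable_square_geometric) auto
  \<comment> \<open>The 8 is the 2 from \<open>2 ^ n \<le> 2 * m\<close> times the square of the 2
    in the weight bound \<open>2 * C * m powr \<gamma> / 2 ^ i\<close>; the last factor is the
    squared constant of \<open>dyadic_exponent\<close>.\<close>
  define D where "D = 8 * C\<^sup>2 / e\<^sup>2 * Q * (3 / ln 2)\<^sup>2"
  have bound: "prob {\<omega>\<in>space M. \<exists>k\<ge>1. \<exists>l\<le>k. e < \<rho> (real k / real m) * (\<bar>R m l \<omega>\<bar> / (real m * sqrt (real m)))}
      \<le> D * (u m / real m powr (2 - 2 * \<gamma>) * (ln (real m))\<^sup>2)" if m2: "2 \<le> m" for m
  proof -
    have m: "1 \<le> m" "0 < real m" using m2 by auto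
    have "0 \<le> (LINT \<omega>|M. (R m 1 \<omega> - R m 0 \<omega>)\<^sup>2)" by simp
    also have "\<dots> \<le> u m" using bnd[OF m(1), of 0 1] by simp
    finally have um: "0 \<le> u m" .
    obtain n where n: "real m \<le> 2 ^ n" "2 ^ n \<le> 2 * real m" "real n + 1 \<le> 3 / ln 2 * ln (real m)"
      using dyadic_exponent[OF m(1)] m2 by blast
    \<comment> \<open>\<open>t i\<close> is what \<open>\<bar>R m l \<omega>\<bar>\<close> must
      exceed for the weighted remainder to exceed \<open>e\<close>, once the weight is replaced by
      its bound on range \<open>i\<close>.\<close>
    define t where "t = (\<lambda>i. e * (real m * sqrt (real m)) * 2 ^ i / (2 * C * real m powr \<gamma>))"
    have t: "0 < t i" for i unfolding t_def using \<open>e > 0\<close> C(1) m by (intro divide_pos_pos mult_pos_pos) auto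
    define A where "A = (\<lambda>i. {\<omega>\<in>space M. \<exists>l\<le>2 ^ (n + i). t i < \<bar>R m l \<omega> - R m 0 \<omega>\<bar>})"
    have [measurable]: "A i \<in> sets M" for i unfolding A_def by measurable
    \<comment> \<open>For \<open>k \<le> 2 ^ n\<close> the crude \<open>m / k \<le> m\<close>
      produces the factor \<open>m powr \<gamma>\<close>. For larger \<open>k\<close> the smallest
      admissible \<open>i\<close> gives \<open>k / m \<ge> 2 ^ (i - 1)\<close>, and
      \<open>1 \<le> m powr \<gamma>\<close> lets both cases share one formula.\<close>
    have \<rho>_block: "\<exists>i. k \<le> 2 ^ (n + i) \<and> \<rho> (real k / real m) \<le> 2 * C * real m powr \<gamma> / 2 ^ i" if k: "1 \<le> k" for k
    proof (cases "k \<le> 2 ^ n")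
      case True
      have "real k \<le> 2 ^ n" using True by (metis of_nat_le_iff of_nat_numeral of_nat_power)
      then have "real k \<le> 2 * real m" using n(2) by linarith
      then have k2: "real k / real m \<le> 2" using m by (simp add: divide_le_eq)
      have "\<rho> (real k / real m) \<le> C * (real k / real m) powr (- \<gamma>)" using k m k2 by (intro C(2)) auto
      also have "(real k / real m) powr (- \<gamma>) = (real m / real k) powr \<gamma>"
        using k m by (simp add: powr_minus powr_divide)
      also have "C * (real m / real k) powr \<gamma> \<le> C * (2 * real m powr \<gamma>)"
      proof -
        have "(real m / real k) powr \<gamma> \<le> real m powr \<gamma>"
          using k m \<gamma> by (intro powr_mono2) (auto simp: divide_le_eq mult_le_cancel_left1)
        moreover have "0 \<le> real m powr \<gamma>" by simp
        ultimately show ?thesis using C(1) by (intro mult_left_mono) (linarith, simp)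
      qed
      finally show ?thesis using True by (intro exI[of _ 0]) (simp add: mult_ac)
    next
      case False
      define i where "i = (LEAST i. k \<le> 2 ^ (n + i))"
      have "k \<le> 2 ^ (n + k)" using less_exp[of k] power_increasing[of k "n + k" "2::nat"] by linarith
      then have i: "k \<le> 2 ^ (n + i)" unfolding i_def by (rule LeastI)
      then obtain i' where i': "i = Suc i'" using False by (cases i) auto
      then have "\<not> k \<le> 2 ^ (n + i')" using not_less_Least[of i' "\<lambda>i. k \<le> 2 ^ (n + i)"] unfolding i_def by simp
      then have "2 ^ (n + i') \<le> real k"
        by (metis nat_le_linear of_nat_le_iff of_nat_numeral of_nat_power)
      moreover have "real m * 2 ^ i' \<le> 2 ^ (n + i')" using n(1) by (simp add: power_add)
      ultimately have "real m * 2 ^ i' \<le> real k" by linarith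
      then have k1: "2 ^ i' \<le> real k / real m" using m by (simp add: le_divide_eq mult.commute)
      moreover have "1 \<le> (2::real) ^ i'" by simp
      ultimately have "\<rho> (real k / real m) \<le> C / (real k / real m)" by (intro C(3)) linarith
      also have "\<dots> \<le> C / 2 ^ i'" using k1 C(1) k m by (intro divide_left_mono mult_pos_pos divide_pos_pos) auto
      also have "\<dots> = 2 * C * 1 / 2 ^ i" by (simp add: i')
      also have "\<dots> \<le> 2 * C * real m powr \<gamma> / 2 ^ i"
        using C(1) m \<gamma> by (intro divide_right_mono mult_left_mono) (auto intro: ge_one_powr_ge_zero)
      finally show ?thesis using i by blast
    qed
    have "{\<omega>\<in>space M. \<exists>k\<ge>1. \<exists>l\<le>k. e < \<rho> (real k / real m) * (\<bar>R m l \<omega>\<bar> / (real m * sqrt (real m)))} \<subseteq> (\<Union>i. A i)"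
    proof
      fix \<omega> assume "\<omega> \<in> {\<omega>\<in>space M. \<exists>k\<ge>1. \<exists>l\<le>k. e < \<rho> (real k / real m) * (\<bar>R m l \<omega>\<bar> / (real m * sqrt (real m)))}"
      then obtain k l where kl: "\<omega> \<in> space M" "1 \<le> k" "l \<le> k"
        "e < \<rho> (real k / real m) * (\<bar>R m l \<omega>\<bar> / (real m * sqrt (real m)))" by auto
      obtain i where i: "k \<le> 2 ^ (n + i)" "\<rho> (real k / real m) \<le> 2 * C * real m powr \<gamma> / 2 ^ i"
        using \<rho>_block[OF kl(2)] by blast
      have "e < 2 * C * real m powr \<gamma> / 2 ^ i * (\<bar>R m l \<omega>\<bar> / (real m * sqrt (real m)))"
        using kl(4) i(2) by (rule less_le_trans[OF _ mult_right_mono]) (use m in auto)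
      then have "t i < \<bar>R m l \<omega>\<bar>" using m C(1) unfolding t_def by (simp add: field_simps)
      moreover have "l \<le> 2 ^ (n + i)" using kl(3) i(1) by simp
      ultimately have "\<omega> \<in> A i" using kl(1) R0 by (auto simp: A_def)
      then show "\<omega> \<in> (\<Union>i. A i)" by blast
    qed
    then have "prob {\<omega>\<in>space M. \<exists>k\<ge>1. \<exists>l\<le>k. e < \<rho> (real k / real m) * (\<bar>R m l \<omega>\<bar> / (real m * sqrt (real m)))} \<le> prob (\<Union>i. A i)"
      by (intro finite_measure_mono) auto
    moreover define B where "B = 8 * C\<^sup>2 / e\<^sup>2 * (u m / real m powr (2 - 2 * \<gamma>)) * (real n + 1)\<^sup>2"
    have A_le: "prob (A i) \<le> B * ((real i + 1)\<^sup>2 * (1 / 2) ^ i)" for i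
    proof -
      have "prob (A i) \<le> u m * 2 ^ (n + i) * (real (n + i) + 1)\<^sup>2 / (t i)\<^sup>2"
        unfolding A_def by (rule maximal_prob_bound[OF int[OF m(1)] bnd[OF m(1)] t R])
      also have "\<dots> \<le> u m * (2 * real m * 2 ^ i) * ((real n + 1) * (real i + 1))\<^sup>2 / (t i)\<^sup>2"
      proof (intro divide_right_mono mult_mono power_mono)
        show "2 ^ (n + i) \<le> 2 * real m * 2 ^ i" using n(2) by (simp add: power_add)
        \<comment> \<open>Separates the dependence on \<open>m\<close>, through \<open>n\<close>,
          from the index \<open>i\<close> over which the bounds are summed.\<close>
        show "real (n + i) + 1 \<le> (real n + 1) * (real i + 1)" by (simp add: algebra_simps)
      qed (use um in auto)
      also have "(t i)\<^sup>2 = e\<^sup>2 * real m ^ 3 * 4 ^ i / (4 * C\<^sup>2 * (real m powr \<gamma>)\<^sup>2)"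
      proof -
        have "(sqrt (real m))\<^sup>2 = real m" by simp
        moreover have "((2::real) ^ i)\<^sup>2 = 4 ^ i" by (simp add: power2_eq_square power_mult_distrib[symmetric])
        ultimately show ?thesis
          unfolding t_def by (simp add: power_divide power_mult_distrib power3_eq_cube power2_eq_square[of "real m"])
      qed
      also have "u m * (2 * real m * 2 ^ i) * ((real n + 1) * (real i + 1))\<^sup>2 /
          (e\<^sup>2 * real m ^ 3 * 4 ^ i / (4 * C\<^sup>2 * (real m powr \<gamma>)\<^sup>2)) =
          8 * C\<^sup>2 / e\<^sup>2 * (u m * ((real m powr \<gamma>)\<^sup>2 / (real m)\<^sup>2)) * (real n + 1)\<^sup>2 * ((real i + 1)\<^sup>2 * (2 ^ i / 4 ^ i))"
        using m \<open>e > 0\<close> by (simp add: power_mult_distrib power2_eq_square power3_eq_cube field_simps)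
      also have "(2::real) ^ i / 4 ^ i = (1 / 2) ^ i" by (simp add: power_divide[symmetric])
      also have "(real m powr \<gamma>)\<^sup>2 / (real m)\<^sup>2 = 1 / real m powr (2 - 2 * \<gamma>)"
      proof -
        have "(real m powr \<gamma>)\<^sup>2 = real m powr (2 * \<gamma>)" by (simp add: power2_eq_square powr_add[symmetric])
        moreover have "(real m)\<^sup>2 = real m powr 2" using m by simp
        ultimately show ?thesis using m by (simp add: powr_diff)
      qed
      finally show ?thesis by (simp add: B_def mult.assoc)
    qed
    moreover have "prob (\<Union>i. A i) \<le> B * Q"
    proof -
      have s: "summable (\<lambda>i. B * ((real i + 1)\<^sup>2 * (1 / 2) ^ i))"
        by (intro summable_mult summable_square_geometric)
      have s': "summable (\<lambda>i. prob (A i))"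
        by (rule summable_comparison_test'[OF s, of 0]) (use A_le in auto)
      have "prob (\<Union>i. A i) \<le> (\<Sum>i. prob (A i))"
        by (intro finite_measure_subadditive_countably s') auto
      also have "\<dots> \<le> (\<Sum>i. B * ((real i + 1)\<^sup>2 * (1 / 2) ^ i))" by (intro suminf_le A_le s s')
      also have "\<dots> = B * Q" unfolding Q_def by (rule suminf_mult[OF summable_square_geometric])
      finally show ?thesis .
    qed
    moreover have "B * Q \<le> D * (u m / real m powr (2 - 2 * \<gamma>) * (ln (real m))\<^sup>2)"
    proof -
      have "(real n + 1)\<^sup>2 \<le> (3 / ln 2 * ln (real m))\<^sup>2" using n(3) by (intro power_mono) auto
      then have "8 * C\<^sup>2 / e\<^sup>2 * (u m / real m powr (2 - 2 * \<gamma>)) * Q * (real n + 1)\<^sup>2 \<le>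
          8 * C\<^sup>2 / e\<^sup>2 * (u m / real m powr (2 - 2 * \<gamma>)) * Q * (3 / ln 2 * ln (real m))\<^sup>2"
        using um Q by (intro mult_left_mono mult_nonneg_nonneg) auto
      then show ?thesis
        unfolding B_def D_def power_mult_distrib[of "3 / ln 2" "ln (real m)"] by (simp only: mult_ac)
    qed
    ultimately show ?thesis by linarith
  qed
  have "(\<lambda>m. D * (u m / real m powr (2 - 2 * \<gamma>) * (ln (real m))\<^sup>2)) \<longlonglongrightarrow> D * 0"
    by (intro tendsto_intros u)
  then have "\<forall>\<^sub>F m in sequentially. D * (u m / real m powr (2 - 2 * \<gamma>) * (ln (real m))\<^sup>2) < \<epsilon>"
    using \<open>\<epsilon> > 0\<close> by (intro order_tendstoD) auto
  with eventually_ge_at_top[of 2] show ?thesis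
    by eventually_elim (use bound in \<open>meson less_imp_le order_trans\<close>)
qed

section \<open>From truncated suprema to the full supremum\<close>

text \<open>A truncation argument: \<open>H n m\<close> approximates \<open>V m\<close> for large \<open>n\<close>, uniformly in large \<open>m\<close>, and
  converges to \<open>G n\<close> as \<open>m \<rightarrow> \<infinity>\<close>.\<close>

lemma conv_in_distr_truncation:
  fixes V :: "nat \<Rightarrow> 'a \<Rightarrow> ereal" and H :: "nat \<Rightarrow> nat \<Rightarrow> 'a \<Rightarrow> real"
    and Z :: "'b \<Rightarrow> ereal" and G :: "nat \<Rightarrow> 'b \<Rightarrow> real"
  assumes "prob_space M" and "prob_space N"
    and V[measurable]: "\<And>m. V m \<in> borel_measurable M"
    and H[measurable]: "\<And>n m. H n m \<in> borel_measurable M"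
    and G[measurable]: "\<And>n. G n \<in> borel_measurable N"
    and Z: "\<And>\<omega>. \<omega> \<in> space N \<Longrightarrow> Z \<omega> = (SUP n. ereal (G n \<omega>))"
    and inc: "\<And>\<omega> n. \<omega> \<in> space N \<Longrightarrow> G n \<omega> \<le> G (Suc n) \<omega>"
    and nonneg: "\<And>n \<omega>. \<omega> \<in> space N \<Longrightarrow> 0 \<le> G n \<omega>"
    and up: "\<And>n a e \<epsilon>. \<lbrakk>e > 0; \<epsilon> > 0\<rbrakk> \<Longrightarrow> \<forall>\<^sub>F m in sequentially.
        measure M {\<omega>\<in>space M. H n m \<omega> \<le> a} \<le> measure N {\<omega>\<in>space N. G n \<omega> \<le> a + e} + \<epsilon>"
    and low: "\<And>n a e \<epsilon>. \<lbrakk>e > 0; \<epsilon> > 0\<rbrakk> \<Longrightarrow> \<forall>\<^sub>F m in sequentially.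
        measure N {\<omega>\<in>space N. G n \<omega> \<le> a} \<le> measure M {\<omega>\<in>space M. H n m \<omega> \<le> a + e} + \<epsilon>"
    and VH: "\<And>e \<epsilon>. \<lbrakk>e > 0; \<epsilon> > 0\<rbrakk> \<Longrightarrow> \<exists>n. \<forall>\<^sub>F m in sequentially.
        measure M {\<omega>\<in>space M. ereal (H n m \<omega> + e) < V m \<omega>} \<le> \<epsilon>"
    and HV: "\<And>n e \<epsilon>. \<lbrakk>e > 0; \<epsilon> > 0\<rbrakk> \<Longrightarrow> \<forall>\<^sub>F m in sequentially.
        measure M {\<omega>\<in>space M. V m \<omega> < ereal (H n m \<omega> - e)} \<le> \<epsilon>"
  shows "conv_in_distr M V N Z"
proof -
  interpret M: prob_space M by fact
  interpret N: prob_space N by fact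
  define Fm where "Fm = (\<lambda>m x. measure M {\<omega>\<in>space M. V m \<omega> \<le> ereal x})"
  define F where "F = (\<lambda>x. measure N {\<omega>\<in>space N. Z \<omega> \<le> ereal x})"
  define FH where "FH = (\<lambda>n m x. measure M {\<omega>\<in>space M. H n m \<omega> \<le> x})"
  define FG where "FG = (\<lambda>n x. measure N {\<omega>\<in>space N. G n \<omega> \<le> x})"
  have Zm[measurable]: "Z \<in> borel_measurable N"
    using Z by (subst measurable_cong[where g = "\<lambda>\<omega>. SUP n. ereal (G n \<omega>)"]) auto
  have Z_le: "Z \<omega> \<le> ereal x \<longleftrightarrow> (\<forall>n. G n \<omega> \<le> x)" if "\<omega> \<in> space N" for \<omega> x
    using Z[OF that] by (auto simp: SUP_le_iff)
  have F_le: "F x \<le> FG n x" for n x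
    unfolding F_def FG_def by (intro N.finite_measure_mono) (auto simp: Z_le)
  have FG_lim: "(\<lambda>n. FG n x) \<longlonglongrightarrow> F x" for x
  proof -
    have "(\<lambda>n. FG n x) \<longlonglongrightarrow> measure N (\<Inter>n. {\<omega>\<in>space N. G n \<omega> \<le> x})"
      unfolding FG_def
    proof (rule N.finite_Lim_measure_decseq)
      show "decseq (\<lambda>n. {\<omega>\<in>space N. G n \<omega> \<le> x})"
        by (intro decseq_SucI) (auto intro: order_trans[OF inc])
    qed auto
    also have "(\<Inter>n. {\<omega>\<in>space N. G n \<omega> \<le> x}) = {\<omega>\<in>space N. Z \<omega> \<le> ereal x}"
      using Z_le by auto
    finally show ?thesis by (simp add: F_def)
  qed
  have Fm_le: "\<forall>\<^sub>F m in sequentially. Fm m x \<le> FH n m (x + e) + \<epsilon>" if "e > 0" "\<epsilon> > 0" for n x e \<epsilon>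
  proof -
    have "Fm m x \<le> FH n m (x + e) + measure M {\<omega>\<in>space M. V m \<omega> < ereal (H n m \<omega> - e)}" for m
    proof -
      have "Fm m x \<le> measure M ({\<omega>\<in>space M. H n m \<omega> \<le> x + e} \<union> {\<omega>\<in>space M. V m \<omega> < ereal (H n m \<omega> - e)})"
        unfolding Fm_def
      proof (intro M.finite_measure_mono subsetI)
        fix \<omega> assume *: "\<omega> \<in> {\<omega>\<in>space M. V m \<omega> \<le> ereal x}"
        show "\<omega> \<in> {\<omega>\<in>space M. H n m \<omega> \<le> x + e} \<union> {\<omega>\<in>space M. V m \<omega> < ereal (H n m \<omega> - e)}"
        proof (cases "H n m \<omega> \<le> x + e")
          case False
          then have "ereal x < ereal (H n m \<omega> - e)" by simp
          with * have "V m \<omega> < ereal (H n m \<omega> - e)" by (auto intro: le_less_trans)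
          with * show ?thesis by simp
        qed (use * in auto)
      qed auto
      also have "\<dots> \<le> FH n m (x + e) + measure M {\<omega>\<in>space M. V m \<omega> < ereal (H n m \<omega> - e)}"
        unfolding FH_def by (intro measure_Un_le) auto
      finally show ?thesis .
    qed
    then show ?thesis using HV[OF that, of n] by (auto elim!: eventually_mono intro: order_trans add_left_mono)
  qed
  have Fm_ge: "\<exists>n. \<forall>\<^sub>F m in sequentially. \<forall>x. FH n m (x - e) - \<epsilon> \<le> Fm m x" if "e > 0" "\<epsilon> > 0" for e \<epsilon>
  proof -
    have "FH n m (x - e) \<le> Fm m x + measure M {\<omega>\<in>space M. ereal (H n m \<omega> + e) < V m \<omega>}" for n m x
    proof -
      have "FH n m (x - e) \<le> measure M ({\<omega>\<in>space M. V m \<omega> \<le> ereal x} \<union> {\<omega>\<in>space M. ereal (H n m \<omega> + e) < V m \<omega>})"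
        unfolding FH_def
      proof (intro M.finite_measure_mono subsetI)
        fix \<omega> assume *: "\<omega> \<in> {\<omega>\<in>space M. H n m \<omega> \<le> x - e}"
        show "\<omega> \<in> {\<omega>\<in>space M. V m \<omega> \<le> ereal x} \<union> {\<omega>\<in>space M. ereal (H n m \<omega> + e) < V m \<omega>}"
        proof (cases "V m \<omega> \<le> ereal x")
          case False
          moreover have "ereal (H n m \<omega> + e) \<le> ereal x" using * by auto
          ultimately have "ereal (H n m \<omega> + e) < V m \<omega>" unfolding not_le by (rule le_less_trans[rotated])
          with * show ?thesis by simp
        qed (use * in auto)
      qed auto
      also have "\<dots> \<le> Fm m x + measure M {\<omega>\<in>space M. ereal (H n m \<omega> + e) < V m \<omega>}"
        unfolding Fm_def by (intro measure_Un_le) auto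
      finally show ?thesis .
    qed
    then have *: "FH n m (x - e) - measure M {\<omega>\<in>space M. ereal (H n m \<omega> + e) < V m \<omega>} \<le> Fm m x" for n m x
      by (simp add: algebra_simps)
    obtain n where "\<forall>\<^sub>F m in sequentially. measure M {\<omega>\<in>space M. ereal (H n m \<omega> + e) < V m \<omega>} \<le> \<epsilon>"
      using VH[OF \<open>e > 0\<close> \<open>\<epsilon> > 0\<close>] by auto
    then show ?thesis
      by (intro exI[of _ n], elim eventually_mono) (use * in \<open>meson diff_left_mono order_trans\<close>)
  qed
  \<comment> \<open>The two directions choose \<open>n\<close> for different reasons. Here
    \<open>n\<close> must be large for \<open>G n\<close> to be close to \<open>Z\<close>, while
    \<open>HV\<close> is available at every \<open>n\<close>. For the lower bound
    \<open>F \<le> FG n\<close> holds at every \<open>n\<close>, and \<open>VH\<close> dictates the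
    choice.\<close>
  have upper: "\<forall>\<^sub>F m in sequentially. Fm m x \<le> F (x + e) + \<epsilon>" if "e > 0" "\<epsilon> > 0" for x e \<epsilon>
  proof -
    have "\<forall>\<^sub>F n in sequentially. FG n (x + e) < F (x + e) + \<epsilon> / 3"
      using FG_lim[of "x + e"] \<open>\<epsilon> > 0\<close> by (intro order_tendstoD) auto
    then obtain n where n: "FG n (x + e) < F (x + e) + \<epsilon> / 3" by (auto simp: eventually_sequentially)
    have "\<forall>\<^sub>F m in sequentially. Fm m x \<le> FH n m (x + e / 2) + \<epsilon> / 3"
      using that by (intro Fm_le) auto
    moreover have "\<forall>\<^sub>F m in sequentially. FH n m (x + e / 2) \<le> FG n (x + e / 2 + e / 2) + \<epsilon> / 3"
      unfolding FH_def FG_def using that by (intro up) auto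
    ultimately show ?thesis
    proof eventually_elim
      case (elim m)
      have "x + e / 2 + e / 2 = x + e" by simp
      with elim n show ?case by (simp only:)
    qed
  qed
  have lower: "\<forall>\<^sub>F m in sequentially. F (x - e) - \<epsilon> \<le> Fm m x" if "e > 0" "\<epsilon> > 0" for x e \<epsilon>
  proof -
    obtain n where "\<forall>\<^sub>F m in sequentially. \<forall>x. FH n m (x - e / 2) - \<epsilon> / 2 \<le> Fm m x"
      using Fm_ge[of "e / 2" "\<epsilon> / 2"] \<open>e > 0\<close> \<open>\<epsilon> > 0\<close> by fastforce
    moreover have "\<forall>\<^sub>F m in sequentially. FG n (x - e) \<le> FH n m (x - e + e / 2) + \<epsilon> / 2"
      unfolding FH_def FG_def using that by (intro low) auto
    ultimately show ?thesis
    proof eventually_elim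
      case (elim m)
      have "x - e + e / 2 = x - e / 2" by (simp add: field_simps)
      with elim F_le[of "x - e" n] show ?case by (smt (verit) field_sum_of_halves)
    qed
  qed
  \<comment> \<open>Finiteness of the limit is obtained by going around through \<open>V\<close>.
    The real-valued \<open>G n0\<close> exceeds a large level with small probability; this passes to
    \<open>H n0 m\<close>, to \<open>V m\<close> by \<open>VH\<close>, then to \<open>H n m\<close>
    and to \<open>G n\<close> for every \<open>n\<close>. Each of the four passages raises the level
    by 1 and costs one \<open>\<epsilon>\<close>, the tail of \<open>G n0\<close> costs a fifth. The
    bound does not depend on \<open>n\<close>, so it survives in the limit.\<close>
  have F_one: "(\<lambda>i. F (real i)) \<longlonglongrightarrow> 1"
  proof (rule LIMSEQ_I)
    fix r :: real assume "r > 0"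
    define \<epsilon> where "\<epsilon> = r / 8"
    have "\<epsilon> > 0" using \<open>r > 0\<close> by (simp add: \<epsilon>_def)
    obtain n0 where n0: "\<forall>\<^sub>F m in sequentially. \<forall>x. FH n0 m (x - 1) - \<epsilon> \<le> Fm m x"
      using Fm_ge[of 1 \<epsilon>] \<open>\<epsilon> > 0\<close> by auto
    have "(\<lambda>i. FG n0 (real i)) \<longlonglongrightarrow> measure N (\<Union>i. {\<omega>\<in>space N. G n0 \<omega> \<le> real i})"
      unfolding FG_def by (intro N.finite_Lim_measure_incseq) (auto simp: incseq_def)
    also have "(\<Union>i. {\<omega>\<in>space N. G n0 \<omega> \<le> real i}) = space N"
      using real_arch_simple by auto
    finally have "(\<lambda>i. FG n0 (real i)) \<longlonglongrightarrow> 1" by (simp add: N.prob_space)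
    then have "\<forall>\<^sub>F i in sequentially. 1 - \<epsilon> < FG n0 (real i)"
      using \<open>\<epsilon> > 0\<close> by (intro order_tendstoD) auto
    then obtain i where i: "1 - \<epsilon> < FG n0 (real i)" by (auto simp: eventually_sequentially)
    have FG: "1 - 5 * \<epsilon> \<le> FG n (real i + 4)" for n
    proof -
      have "\<forall>\<^sub>F m in sequentially. FG n0 (real i) \<le> FH n0 m (real i + 1) + \<epsilon>"
        unfolding FH_def FG_def using \<open>\<epsilon> > 0\<close> by (intro low) auto
      moreover have "\<forall>\<^sub>F m in sequentially. Fm m (real i + 2) \<le> FH n m (real i + 2 + 1) + \<epsilon>"
        using \<open>\<epsilon> > 0\<close> by (intro Fm_le) auto
      moreover have "\<forall>\<^sub>F m in sequentially. FH n m (real i + 3) \<le> FG n (real i + 3 + 1) + \<epsilon>"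
        unfolding FH_def FG_def using \<open>\<epsilon> > 0\<close> by (intro up) auto
      ultimately have "\<forall>\<^sub>F m in sequentially. 1 - 5 * \<epsilon> \<le> FG n (real i + 4)"
        using n0
      proof eventually_elim
        case (elim m)
        have "FH n0 m (real i + 1) - \<epsilon> \<le> Fm m (real i + 2)"
          using elim(4)[rule_format, of "real i + 2"] by (simp add: algebra_simps)
        moreover have "real i + 2 + 1 = real i + 3" "real i + 3 + 1 = real i + 4" by auto
        ultimately show ?case using elim(1-3) i by (simp only:)
      qed
      then show ?thesis by (auto simp: eventually_sequentially)
    qed
    have "1 - 5 * \<epsilon> \<le> F (real i + 4)"
      by (rule LIMSEQ_le_const[OF FG_lim]) (use FG in auto)
    moreover have "F x \<le> F y" if "x \<le> y" for x y
      unfolding F_def using that by (intro N.finite_measure_mono) (auto elim: order_trans)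
    ultimately have "1 - 5 * \<epsilon> \<le> F (real j)" if "i + 4 \<le> j" for j
    proof -
      have "real i + 4 \<le> real j" using that by linarith
      then show ?thesis using \<open>\<And>x y. x \<le> y \<Longrightarrow> F x \<le> F y\<close> \<open>1 - 5 * \<epsilon> \<le> F (real i + 4)\<close>
        by (meson order_trans)
    qed
    moreover have "F x \<le> 1" for x unfolding F_def by simp
    ultimately have "norm (F (real j) - 1) \<le> 5 * \<epsilon>" if "i + 4 \<le> j" for j
      using that \<open>\<epsilon> > 0\<close> by (smt (verit) real_norm_def)
    moreover have "5 * \<epsilon> < r" using \<open>r > 0\<close> by (simp add: \<epsilon>_def)
    ultimately show "\<exists>no. \<forall>j\<ge>no. norm (F (real j) - 1) < r" by (meson le_less_trans)
  qed
  have fin: "AE \<omega> in N. \<bar>Z \<omega>\<bar> \<noteq> \<infinity>"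
  proof -
    have "(\<lambda>n. F (real n)) \<longlonglongrightarrow>
        measure N (\<Union>n. {\<omega>\<in>space N. Z \<omega> \<le> ereal (real n)})"
      unfolding F_def by (intro N.finite_Lim_measure_incseq)
         (auto simp: incseq_def elim: order_trans)
    with F_one have "measure N (\<Union>n. {\<omega>\<in>space N. Z \<omega> \<le> ereal (real n)}) = 1"
      using LIMSEQ_unique by blast
    then have "AE \<omega> in N. \<omega> \<in> (\<Union>n. {\<omega>\<in>space N. Z \<omega> \<le> ereal (real n)})"
      by (subst N.AE_in_set_eq_1) auto
    then show ?thesis
    proof (rule AE_mp, intro AE_I2 impI)
      fix \<omega> assume "\<omega> \<in> space N" and *: "\<omega> \<in> (\<Union>n. {\<omega>\<in>space N. Z \<omega> \<le> ereal (real n)})"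
      have "ereal 0 \<le> ereal (G 0 \<omega>)" using nonneg \<open>\<omega> \<in> space N\<close> by simp
      also have "\<dots> \<le> Z \<omega>" unfolding Z[OF \<open>\<omega> \<in> space N\<close>] by (intro SUP_upper) auto
      finally show "\<bar>Z \<omega>\<bar> \<noteq> \<infinity>" using * by (cases "Z \<omega>") auto
    qed
  qed
  \<comment> \<open>Continuity of \<open>F\<close> at \<open>x\<close> removes the shift by
    \<open>d / 2\<close> on either side, which all previous bounds carry.\<close>
  have "weak_conv Fm F" unfolding weak_conv_def
  proof (intro allI impI LIMSEQ_I)
    fix x and r :: real assume cont: "isCont F x" and "r > 0"
    obtain d where d: "d > 0" "\<And>y. dist y x < d \<Longrightarrow> dist (F y) (F x) < r / 2"
      using cont \<open>r > 0\<close> unfolding continuous_at by (metis LIM_def dist_self half_gt_zero)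
    have "F (x + d / 2) < F x + r / 2" using d(2)[of "x + d / 2"] d(1) unfolding dist_real_def by (simp, linarith)
    moreover have "F x - r / 2 < F (x - d / 2)" using d(2)[of "x - d / 2"] d(1) unfolding dist_real_def by (simp, linarith)
    moreover have "\<forall>\<^sub>F m in sequentially. F (x - d / 2) - r / 4 \<le> Fm m x \<and> Fm m x \<le> F (x + d / 2) + r / 4"
      using d(1) \<open>r > 0\<close> by (intro eventually_conj lower upper) auto
    ultimately have "\<forall>\<^sub>F m in sequentially. norm (Fm m x - F x) < r"
      using \<open>r > 0\<close> by (auto elim!: eventually_mono)
    then show "\<exists>no. \<forall>m\<ge>no. norm (Fm m x - F x) < r" by (simp add: eventually_sequentially)
  qed
  with fin show ?thesis unfolding conv_in_distr_def Fm_def F_def by simp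
qed

section \<open>Skorokhod space\<close>

text \<open>The one-sided limits confine the values near any point to two unit balls, and a
  bisection argument makes this global. Boundedness is what gives the suprema in
  \<open>skorokhod_dist\<close> their meaning, since a real \<open>Sup\<close> of an unbounded set
  is an arbitrary value.\<close>

lemma cadlag_bounded:
  assumes "x \<in> cadlag T" "0 \<le> T"
  shows "bounded (x ` {0..T})"
proof -
  have "bounded (x ` ({0..T} \<inter> {0..T}))"
  proof (rule Bolzano[OF \<open>0 \<le> T\<close>, where P = "\<lambda>a b. bounded (x ` ({a..b} \<inter> {0..T}))"])
    fix a b c assume "bounded (x ` ({a..b} \<inter> {0..T}))" "bounded (x ` ({b..c} \<inter> {0..T}))"
    moreover have "{a..c} \<inter> {0..T} \<subseteq> ({a..b} \<inter> {0..T}) \<union> ({b..c} \<inter> {0..T})" by auto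
    then have "x ` ({a..c} \<inter> {0..T}) \<subseteq> x ` ({a..b} \<inter> {0..T}) \<union> x ` ({b..c} \<inter> {0..T})"
      by (metis image_mono image_Un)
    ultimately show "bounded (x ` ({a..c} \<inter> {0..T}))" by (meson bounded_Un bounded_subset)
  next
    fix t assume t: "0 \<le> t" "t \<le> T"
    have "\<exists>d>0. \<forall>s\<in>{0..T}. t < s \<and> s < t + d \<longrightarrow> dist (x s) (x t) < 1"
    proof (cases "t < T")
      case True
      then have "(x \<longlongrightarrow> x t) (at_right t)" using assms t by (auto simp: cadlag_def)
      then have "\<forall>\<^sub>F s in at_right t. dist (x s) (x t) < 1" by (intro tendstoD) auto
      then obtain c where "c > t" "\<And>s. t < s \<Longrightarrow> s < c \<Longrightarrow> dist (x s) (x t) < 1"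
        by (auto simp: eventually_at_right_field)
      then show ?thesis by (intro exI[of _ "c - t"]) auto
    qed (use t in \<open>auto intro!: exI[of _ 1]\<close>)
    then obtain d1 where d1: "d1 > 0" "\<And>s. s \<in> {0..T} \<Longrightarrow> t < s \<Longrightarrow> s < t + d1 \<Longrightarrow> dist (x s) (x t) < 1"
      by blast
    have "\<exists>d>0. \<exists>l. \<forall>s\<in>{0..T}. t - d < s \<and> s < t \<longrightarrow> dist (x s) l < 1"
    proof (cases "0 < t")
      case True
      with t have "t \<in> {0<..T}" by simp
      with assms(1) obtain l where "(x \<longlongrightarrow> l) (at_left t)" unfolding cadlag_def by blast
      then have "\<forall>\<^sub>F s in at_left t. dist (x s) l < 1" by (intro tendstoD) auto
      then obtain c where "c < t" "\<And>s. c < s \<Longrightarrow> s < t \<Longrightarrow> dist (x s) l < 1"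
        by (auto simp: eventually_at_left_field)
      then show ?thesis by (intro exI[of _ "t - c"] exI[of _ l] conjI) auto
    qed (use t in \<open>auto intro!: exI[of _ 1]\<close>)
    then obtain d2 l where d2: "d2 > 0" "\<And>s. s \<in> {0..T} \<Longrightarrow> t - d2 < s \<Longrightarrow> s < t \<Longrightarrow> dist (x s) l < 1"
      by blast
    show "\<exists>d>0. \<forall>a b. a \<le> t \<and> t \<le> b \<and> b - a < d \<longrightarrow> bounded (x ` ({a..b} \<inter> {0..T}))"
    proof (intro exI[of _ "min d1 d2"] conjI allI impI)
      fix a b assume ab: "a \<le> t \<and> t \<le> b \<and> b - a < min d1 d2"
      have "x s \<in> ball (x t) 1 \<union> ball l 1" if "s \<in> {a..b} \<inter> {0..T}" for s
        using that ab d1(2)[of s] d2(2)[of s] by (cases s t rule: linorder_cases) (auto simp: dist_commute)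
      then have "x ` ({a..b} \<inter> {0..T}) \<subseteq> ball (x t) 1 \<union> ball l 1" by blast
      then show "bounded (x ` ({a..b} \<inter> {0..T}))"
        by (meson bounded_Un bounded_ball bounded_subset)
    qed (use d1 d2 in auto)
  qed
  then show ?thesis by simp
qed

section \<open>The group of time changes\<close>

lemma time_changes_mem: "\<tau> \<in> time_changes T \<Longrightarrow> t \<in> {0..T} \<Longrightarrow> \<tau> t \<in> {0..T}"
  unfolding time_changes_def by blast

lemma time_changes_id: "(\<lambda>t. t) \<in> time_changes T"
  by (auto simp: time_changes_def strict_mono_on_def)

lemma time_changes_comp:
  assumes "\<sigma> \<in> time_changes T" "\<tau> \<in> time_changes T"
  shows "\<sigma> \<circ> \<tau> \<in> time_changes T"
proof -
  have "strict_mono_on {0..T} (\<sigma> \<circ> \<tau>)"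
  proof (rule strict_mono_onI)
    fix r s assume rs: "r \<in> {0..T}" "s \<in> {0..T}" "r < s"
    then have "\<tau> r < \<tau> s" using assms by (auto simp: time_changes_def strict_mono_on_def)
    then show "(\<sigma> \<circ> \<tau>) r < (\<sigma> \<circ> \<tau>) s"
      using assms(1) time_changes_mem[OF assms(2) rs(1)] time_changes_mem[OF assms(2) rs(2)]
      by (auto simp: time_changes_def intro: strict_mono_onD)
  qed
  moreover have "(\<sigma> \<circ> \<tau>) ` {0..T} = {0..T}"
    by (simp only: image_comp[symmetric]) (use assms in \<open>simp add: time_changes_def\<close>)
  ultimately show ?thesis by (simp add: time_changes_def)
qed

lemma time_changes_inv:
  assumes "\<tau> \<in> time_changes T"
  shows "inv_into {0..T} \<tau> \<in> time_changes T"
proof -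
  have inj: "inj_on \<tau> {0..T}" and im: "\<tau> ` {0..T} = {0..T}" and mono: "strict_mono_on {0..T} \<tau>"
    using assms by (auto simp: time_changes_def strict_mono_on_imp_inj_on)
  have "inv_into {0..T} \<tau> ` {0..T} = {0..T}"
    using inj im by (metis bij_betw_def bij_betw_inv_into)
  moreover have "strict_mono_on {0..T} (inv_into {0..T} \<tau>)"
  proof (rule strict_mono_onI)
    fix r s assume rs: "r \<in> {0..T}" "s \<in> {0..T}" "r < s"
    have *: "inv_into {0..T} \<tau> r \<in> {0..T}" "inv_into {0..T} \<tau> s \<in> {0..T}"
      "\<tau> (inv_into {0..T} \<tau> r) = r" "\<tau> (inv_into {0..T} \<tau> s) = s"
      using rs im by (metis inv_into_into, metis inv_into_into, metis f_inv_into_f, metis f_inv_into_f)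
    show "inv_into {0..T} \<tau> r < inv_into {0..T} \<tau> s"
    proof (rule ccontr)
      assume "\<not> ?thesis"
      then have le: "inv_into {0..T} \<tau> s \<le> inv_into {0..T} \<tau> r" by simp
      have "\<tau> (inv_into {0..T} \<tau> s) \<le> \<tau> (inv_into {0..T} \<tau> r)"
        using strict_mono_on_leD[OF mono *(2) *(1) le] .
      then have "s \<le> r" unfolding *(3,4) .
      with rs show False by simp
    qed
  qed
  ultimately show ?thesis by (simp add: time_changes_def)
qed

section \<open>The Skorokhod distance as a pseudometric on cadlag paths\<close>

lemma time_changes_dist_bdd:
  assumes "\<tau> \<in> time_changes T"
  shows "bdd_above ((\<lambda>t. \<bar>\<tau> t - t\<bar>) ` {0..T})"
  using time_changes_mem[OF assms] by (intro bdd_aboveI2[of _ _ T]) fastforce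

lemma cadlag_dist_bdd:
  assumes "x \<in> cadlag T" "y \<in> cadlag T" "0 \<le> T" "\<tau> \<in> time_changes T"
  shows "bdd_above ((\<lambda>t. dist (x (\<tau> t)) (y t)) ` {0..T})"
proof -
  have "bounded (x ` {0..T} \<union> y ` {0..T})" using assms by (simp add: cadlag_bounded)
  then obtain B where B: "\<And>u v. u \<in> x ` {0..T} \<union> y ` {0..T} \<Longrightarrow> v \<in> x ` {0..T} \<union> y ` {0..T} \<Longrightarrow> dist u v \<le> B"
    unfolding bounded_two_points by blast
  show ?thesis
    using B time_changes_mem[OF assms(4)] by (intro bdd_aboveI2[of _ _ B]) blast
qed

lemma skorokhod_cost_bdd_below:
  assumes "0 \<le> T"
  shows "bdd_below ((\<lambda>\<tau>. max (SUP t\<in>{0..T}. \<bar>\<tau> t - t\<bar>) (SUP t\<in>{0..T}. dist (x (\<tau> t)) (y t))) ` time_changes T)"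
proof (rule bdd_belowI2[of _ 0])
  fix \<tau> assume \<tau>: "\<tau> \<in> time_changes T"
  have "0 \<le> \<bar>\<tau> 0 - 0\<bar>" by simp
  also have "\<dots> \<le> (SUP t\<in>{0..T}. \<bar>\<tau> t - t\<bar>)"
    using assms by (intro cSUP_upper time_changes_dist_bdd \<tau>) auto
  finally show "0 \<le> max (SUP t\<in>{0..T}. \<bar>\<tau> t - t\<bar>) (SUP t\<in>{0..T}. dist (x (\<tau> t)) (y t))" by simp
qed

lemma skorokhod_dist_le:
  assumes "0 \<le> T" "\<tau> \<in> time_changes T"
    and "\<And>t. t \<in> {0..T} \<Longrightarrow> \<bar>\<tau> t - t\<bar> \<le> e" "\<And>t. t \<in> {0..T} \<Longrightarrow> dist (x (\<tau> t)) (y t) \<le> e"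
  shows "skorokhod_dist T x y \<le> e"
  unfolding skorokhod_dist_def
  using assms
  by (intro cINF_lower2[OF skorokhod_cost_bdd_below, of _ \<tau>]) (auto intro!: cSUP_least)

text \<open>Neither the infimum nor the suprema need be attained. The gap \<open>e' < e\<close> is
  uniform in \<open>t\<close>, so that the pointwise bounds can be turned back into bounds on a
  distance.\<close>

lemma skorokhod_dist_lessD:
  assumes "x \<in> cadlag T" "y \<in> cadlag T" "0 \<le> T" "skorokhod_dist T x y < e"
  shows "\<exists>\<tau>\<in>time_changes T. \<exists>e'<e. \<forall>t\<in>{0..T}. \<bar>\<tau> t - t\<bar> \<le> e' \<and> dist (x (\<tau> t)) (y t) \<le> e'"
proof -
  have "time_changes T \<noteq> {}" using time_changes_id by blast
  then obtain \<tau> where \<tau>: "\<tau> \<in> time_changes T"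
    "max (SUP t\<in>{0..T}. \<bar>\<tau> t - t\<bar>) (SUP t\<in>{0..T}. dist (x (\<tau> t)) (y t)) < e" (is "?m < e")
    using assms(4) unfolding skorokhod_dist_def
      cINF_less_iff[OF \<open>time_changes T \<noteq> {}\<close> skorokhod_cost_bdd_below[OF \<open>0 \<le> T\<close>]] by blast
  show ?thesis
  proof (intro bexI[OF _ \<tau>(1)] exI[of _ ?m] conjI ballI \<tau>(2))
    fix t assume t: "t \<in> {0..T}"
    have "\<bar>\<tau> t - t\<bar> \<le> (SUP t\<in>{0..T}. \<bar>\<tau> t - t\<bar>)"
      using t by (intro cSUP_upper time_changes_dist_bdd \<tau>)
    then show "\<bar>\<tau> t - t\<bar> \<le> ?m" by simp
    have "dist (x (\<tau> t)) (y t) \<le> (SUP t\<in>{0..T}. dist (x (\<tau> t)) (y t))"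
      using t assms by (intro cSUP_upper cadlag_dist_bdd \<tau>)
    then show "dist (x (\<tau> t)) (y t) \<le> ?m" by simp
  qed
qed

lemma skorokhod_dist_nonneg: "0 \<le> T \<Longrightarrow> 0 \<le> skorokhod_dist T x y"
proof -
  assume T: "0 \<le> T"
  have "time_changes T \<noteq> {}" using time_changes_id by blast
  then show ?thesis unfolding skorokhod_dist_def
  proof (rule cINF_greatest)
    fix \<tau> assume \<tau>: "\<tau> \<in> time_changes T"
    have "0 \<le> \<bar>\<tau> 0 - 0\<bar>" by simp
    also have "\<dots> \<le> (SUP t\<in>{0..T}. \<bar>\<tau> t - t\<bar>)"
      using T by (intro cSUP_upper time_changes_dist_bdd \<tau>) auto
    finally show "0 \<le> max (SUP t\<in>{0..T}. \<bar>\<tau> t - t\<bar>) (SUP t\<in>{0..T}. dist (x (\<tau> t)) (y t))" by simp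
  qed
qed

lemma skorokhod_dist_le_uniform:
  assumes "0 \<le> T" "\<And>t. t \<in> {0..T} \<Longrightarrow> dist (x t) (y t) \<le> e"
  shows "skorokhod_dist T x y \<le> e"
proof -
  have "0 \<le> e" using assms(2)[of 0] \<open>0 \<le> T\<close> zero_le_dist order_trans by (metis atLeastAtMost_iff order_refl)
  then show ?thesis using assms by (intro skorokhod_dist_le[OF _ time_changes_id]) auto
qed

lemma skorokhod_dist_commute_le:
  assumes "x \<in> cadlag T" "y \<in> cadlag T" "0 \<le> T"
  shows "skorokhod_dist T y x \<le> skorokhod_dist T x y"
proof (rule dense_ge)
  fix e assume "skorokhod_dist T x y < e"
  then obtain \<tau> e' where \<tau>': "\<tau> \<in> time_changes T" "e' < e"
    "\<forall>t\<in>{0..T}. \<bar>\<tau> t - t\<bar> \<le> e' \<and> dist (x (\<tau> t)) (y t) \<le> e'"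
    using skorokhod_dist_lessD[OF assms \<open>skorokhod_dist T x y < e\<close>] by blast
    note \<tau> = \<tau>'(1,2) bspec[OF \<tau>'(3), THEN conjunct1] bspec[OF \<tau>'(3), THEN conjunct2]
  let ?\<sigma> = "inv_into {0..T} \<tau>"
  have *: "?\<sigma> t \<in> {0..T}" "\<tau> (?\<sigma> t) = t" if "t \<in> {0..T}" for t
  proof -
    show "?\<sigma> t \<in> {0..T}" by (rule time_changes_mem[OF time_changes_inv[OF \<tau>(1)] that])
    have "t \<in> \<tau> ` {0..T}" using that \<tau>(1) by (simp add: time_changes_def)
    then show "\<tau> (?\<sigma> t) = t" by (rule f_inv_into_f)
  qed
  show "skorokhod_dist T y x \<le> e"
  proof (rule skorokhod_dist_le[OF \<open>0 \<le> T\<close> time_changes_inv[OF \<tau>(1)]])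
    fix t assume t: "t \<in> {0..T}"
    show "\<bar>?\<sigma> t - t\<bar> \<le> e" using \<tau>(3)[OF *(1)[OF t]] *(2)[OF t] \<tau>(2) by simp
    show "dist (y (?\<sigma> t)) (x t) \<le> e" using \<tau>(4)[OF *(1)[OF t]] *(2)[OF t] \<tau>(2) by (simp add: dist_commute)
  qed
qed

lemma skorokhod_dist_triangle:
  assumes "x \<in> cadlag T" "y \<in> cadlag T" "z \<in> cadlag T" "0 \<le> T"
  shows "skorokhod_dist T x z \<le> skorokhod_dist T x y + skorokhod_dist T y z"
proof (rule field_le_epsilon)
  fix e :: real assume "e > 0"
  obtain \<tau> e1 where \<tau>': "\<tau> \<in> time_changes T" "e1 < skorokhod_dist T x y + e / 2"
    "\<forall>t\<in>{0..T}. \<bar>\<tau> t - t\<bar> \<le> e1 \<and> dist (x (\<tau> t)) (y t) \<le> e1"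
    using skorokhod_dist_lessD[OF assms(1,2,4) less_add_same_cancel1[THEN iffD2, OF half_gt_zero[OF \<open>e > 0\<close>]]] by blast
    note \<tau> = \<tau>'(1,2) bspec[OF \<tau>'(3), THEN conjunct1] bspec[OF \<tau>'(3), THEN conjunct2]
  obtain \<sigma> e2 where \<sigma>': "\<sigma> \<in> time_changes T" "e2 < skorokhod_dist T y z + e / 2"
    "\<forall>t\<in>{0..T}. \<bar>\<sigma> t - t\<bar> \<le> e2 \<and> dist (y (\<sigma> t)) (z t) \<le> e2"
    using skorokhod_dist_lessD[OF assms(2,3,4) less_add_same_cancel1[THEN iffD2, OF half_gt_zero[OF \<open>e > 0\<close>]]] by blast
    note \<sigma> = \<sigma>'(1,2) bspec[OF \<sigma>'(3), THEN conjunct1] bspec[OF \<sigma>'(3), THEN conjunct2]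
  have "skorokhod_dist T x z \<le> e1 + e2"
  proof (rule skorokhod_dist_le[OF \<open>0 \<le> T\<close> time_changes_comp[OF \<tau>(1) \<sigma>(1)]])
    fix t assume t: "t \<in> {0..T}"
    note s = time_changes_mem[OF \<sigma>(1) t]
    show "\<bar>(\<tau> \<circ> \<sigma>) t - t\<bar> \<le> e1 + e2" using \<tau>(3)[OF s] \<sigma>(3)[OF t] by simp
    have "dist (x (\<tau> (\<sigma> t))) (z t) \<le> dist (x (\<tau> (\<sigma> t))) (y (\<sigma> t)) + dist (y (\<sigma> t)) (z t)"
      by (rule dist_triangle)
    then show "dist (x ((\<tau> \<circ> \<sigma>) t)) (z t) \<le> e1 + e2" using \<tau>(4)[OF s] \<sigma>(4)[OF t] by simp
  qed
  then show "skorokhod_dist T x z \<le> skorokhod_dist T x y + skorokhod_dist T y z + e"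
    using \<tau>(2) \<sigma>(2) by simp
qed

text \<open>Uniform continuity of \<open>x\<close> absorbs the time change, so at a continuous path
  Skorokhod closeness is uniform closeness. As Wiener paths are continuous, functionals will only
  have to be controlled under uniform perturbations.\<close>

lemma skorokhod_dist_continuous:
  assumes "x \<in> cadlag T" "continuous_on {0..T} x" "0 \<le> T" "e > 0"
  shows "\<exists>d>0. \<forall>y\<in>cadlag T. skorokhod_dist T y x < d \<longrightarrow> (\<forall>t\<in>{0..T}. dist (y t) (x t) < e)"
proof -
  have "uniformly_continuous_on {0..T} x" using assms by (intro compact_uniformly_continuous) auto
  then obtain d where d: "d > 0" "\<And>s t. s \<in> {0..T} \<Longrightarrow> t \<in> {0..T} \<Longrightarrow> dist t s < d \<Longrightarrow> dist (x t) (x s) < e / 2"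
    using \<open>e > 0\<close> unfolding uniformly_continuous_on_def by (meson half_gt_zero)
  show ?thesis
  proof (intro exI[of _ "min d (e / 2)"] conjI ballI impI)
    fix y t assume y: "y \<in> cadlag T" and l: "skorokhod_dist T y x < min d (e / 2)" and t: "t \<in> {0..T}"
    have "skorokhod_dist T x y < min d (e / 2)"
      using skorokhod_dist_commute_le[OF y assms(1,3)] l by simp
    then obtain \<tau> e' where \<tau>': "\<tau> \<in> time_changes T" "e' < min d (e / 2)"
      "\<forall>t\<in>{0..T}. \<bar>\<tau> t - t\<bar> \<le> e' \<and> dist (x (\<tau> t)) (y t) \<le> e'"
      using skorokhod_dist_lessD[OF assms(1) y assms(3) \<open>skorokhod_dist T x y < min d (e / 2)\<close>] by blast
      note \<tau> = \<tau>'(1,2) bspec[OF \<tau>'(3), THEN conjunct1] bspec[OF \<tau>'(3), THEN conjunct2]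
    have "dist (x (\<tau> t)) (x t) < e / 2"
      using \<tau>(2) \<tau>(3)[OF t] time_changes_mem[OF \<tau>(1) t] t by (intro d(2)) (auto simp: dist_real_def)
    moreover have "dist (y t) (x t) \<le> dist (x (\<tau> t)) (y t) + dist (x (\<tau> t)) (x t)"
      by (rule dist_triangle3)
    ultimately show "dist (y t) (x t) < e" using \<tau>(4)[OF t] \<tau>(2) by linarith
  qed (use d \<open>e > 0\<close> in auto)
qed

section \<open>Cadlag paths and measurability of Skorokhod continuous functionals\<close>

lemma continuous_cadlag:
  assumes "continuous_on {0..T} x"
  shows "x \<in> cadlag T"
proof -
  have c: "(x \<longlongrightarrow> x t) (at t within {0..T})" if "t \<in> {0..T}" for t
    using assms that by (simp add: continuous_on_def)
  have "(x \<longlongrightarrow> x t) (at_right t)" if "t \<in> {0..<T}" for t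
  proof -
    have "at t within {t..T} \<le> at t within {0..T}" using that by (intro at_le) auto
    moreover have "at t within {t..T} = at_right t" using that by (simp add: at_within_Icc_at_right)
    ultimately show ?thesis using c[of t] that by (auto intro: tendsto_mono)
  qed
  moreover have "(x \<longlongrightarrow> x t) (at_left t)" if "t \<in> {0<..T}" for t
  proof -
    have "at t within {0..t} \<le> at t within {0..T}" using that by (intro at_le) auto
    moreover have "at t within {0..t} = at_left t" using that by (simp add: at_within_Icc_at_left)
    ultimately show ?thesis using c[of t] that by (auto intro: tendsto_mono)
  qed
  ultimately show ?thesis unfolding cadlag_def by blast
qed

lemma step_cadlag: "(\<lambda>t. v (nat \<lfloor>real n * t\<rfloor>)) \<in> cadlag T"
proof (cases "n = 0")
  case True
  then show ?thesis by (auto simp: cadlag_def)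
next
  case False
  then have n: "0 < real n" by simp
  have "((\<lambda>t. v (nat \<lfloor>real n * t\<rfloor>)) \<longlongrightarrow> v (nat \<lfloor>real n * t\<rfloor>)) (at_right t)" for t
  proof (rule tendsto_eventually)
    define c where "c = (of_int \<lfloor>real n * t\<rfloor> + 1) / real n"
    have "t < c" using n unfolding c_def by (simp add: field_simps) linarith
    moreover have "\<lfloor>real n * s\<rfloor> = \<lfloor>real n * t\<rfloor>" if "t < s" "s < c" for s
    proof (rule floor_unique)
      have "real n * t \<le> real n * s" using that n by simp
      then show "of_int \<lfloor>real n * t\<rfloor> \<le> real n * s" by linarith
      show "real n * s < of_int \<lfloor>real n * t\<rfloor> + 1" using that n unfolding c_def by (simp add: field_simps)
    qed
    ultimately show "\<forall>\<^sub>F s in at_right t. v (nat \<lfloor>real n * s\<rfloor>) = v (nat \<lfloor>real n * t\<rfloor>)"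
      unfolding eventually_at_right_field by (intro exI[of _ c]) auto
  qed
  \<comment> \<open>The left limit takes the previous index at a jump:
    \<open>\<lceil>real n * t\<rceil> - 1\<close> is the floor away from the grid and one less than
    the floor on it.\<close>
  moreover have "((\<lambda>t. v (nat \<lfloor>real n * t\<rfloor>)) \<longlongrightarrow> v (nat (\<lceil>real n * t\<rceil> - 1))) (at_left t)" for t
  proof (rule tendsto_eventually)
    define c where "c = (of_int \<lceil>real n * t\<rceil> - 1) / real n"
    have "c < t" using n unfolding c_def by (simp add: field_simps) linarith
    moreover have "\<lfloor>real n * s\<rfloor> = \<lceil>real n * t\<rceil> - 1" if "c < s" "s < t" for s
    proof (rule floor_unique)
      show "of_int (\<lceil>real n * t\<rceil> - 1) \<le> real n * s" using that n unfolding c_def by (simp add: field_simps)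
      have "real n * s < real n * t" using that n by simp
      then show "real n * s < of_int (\<lceil>real n * t\<rceil> - 1) + 1" by linarith
    qed
    ultimately show "\<forall>\<^sub>F s in at_left t. v (nat \<lfloor>real n * s\<rfloor>) = v (nat (\<lceil>real n * t\<rceil> - 1))"
      unfolding eventually_at_left_field by (intro exI[of _ c]) auto
  qed
  ultimately show ?thesis unfolding cadlag_def by blast
qed

text \<open>No sigma-algebra on the path space is used. A step path is a function of the sequence of
  its values, only finitely many of which matter on \<open>[0, T]\<close>; hence \<open>g\<close>
  becomes a continuous function on the product space of sequences.\<close>

lemma measurable_skorokhod_step:
  fixes V :: "nat \<Rightarrow> 'a \<Rightarrow> 'v::{second_countable_topology, metric_space}"
  assumes g: "skorokhod_continuous T g" and "0 \<le> T"
    and [measurable]: "\<And>i. V i \<in> borel_measurable M"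
  shows "(\<lambda>\<omega>. g (\<lambda>t. V (nat \<lfloor>real n * t\<rfloor>) \<omega>)) \<in> borel_measurable M"
proof -
  define \<Phi> where "\<Phi> = (\<lambda>v::nat \<Rightarrow> 'v. g (\<lambda>t. v (nat \<lfloor>real n * t\<rfloor>)))"
  have "continuous_on UNIV \<Phi>"
    unfolding continuous_on_def
  proof
    fix v :: "nat \<Rightarrow> 'v"
    show "(\<Phi> \<longlongrightarrow> \<Phi> v) (at v)"
    proof (rule tendstoI)
      fix e :: real assume "e > 0"
      have "\<exists>\<delta>>0. \<forall>y\<in>cadlag T. skorokhod_dist T (\<lambda>t. v (nat \<lfloor>real n * t\<rfloor>)) y < \<delta> \<longrightarrow>
          \<bar>g (\<lambda>t. v (nat \<lfloor>real n * t\<rfloor>)) - g y\<bar> < e"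
        using g \<open>e > 0\<close> step_cadlag[where v = v and n = n and T = T] unfolding skorokhod_continuous_def by blast
      then obtain d where d: "d > 0" "\<And>y. y \<in> cadlag T \<Longrightarrow>
          skorokhod_dist T (\<lambda>t. v (nat \<lfloor>real n * t\<rfloor>)) y < d \<Longrightarrow> \<bar>\<Phi> v - g y\<bar> < e"
        unfolding \<Phi>_def by blast
      have "((\<lambda>v'. v' i) \<longlongrightarrow> v i) (at v)" for i :: nat
      proof -
        have "continuous_on UNIV (\<lambda>v::nat \<Rightarrow> 'v. v i)" by (rule continuous_on_product_coordinates)
        then show ?thesis by (simp add: continuous_on_def)
      qed
      then have "\<forall>\<^sub>F v' in at v. dist (v' i) (v i) < d / 2" for i using \<open>d > 0\<close> by (intro tendstoD) auto
      then have "\<forall>\<^sub>F v' in at v. \<forall>i\<in>{..nat \<lfloor>real n * T\<rfloor>}. dist (v' i) (v i) < d / 2"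
        by (intro eventually_ball_finite) auto
      then show "\<forall>\<^sub>F v' in at v. dist (\<Phi> v') (\<Phi> v) < e"
      proof eventually_elim
        case (elim v')
        have "skorokhod_dist T (\<lambda>t. v (nat \<lfloor>real n * t\<rfloor>)) (\<lambda>t. v' (nat \<lfloor>real n * t\<rfloor>)) \<le> d / 2"
        proof (rule skorokhod_dist_le_uniform[OF \<open>0 \<le> T\<close>])
          fix t assume "t \<in> {0..T}"
          then have "nat \<lfloor>real n * t\<rfloor> \<in> {..nat \<lfloor>real n * T\<rfloor>}"
            by (auto intro!: nat_mono floor_mono mult_left_mono)
          with elim show "dist (v (nat \<lfloor>real n * t\<rfloor>)) (v' (nat \<lfloor>real n * t\<rfloor>)) \<le> d / 2"
            by (metis dist_commute less_imp_le)
        qed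
        then show ?case
          using d(2)[OF step_cadlag, of v' n] \<open>d > 0\<close> by (simp add: \<Phi>_def dist_real_def abs_minus_commute)
      qed
    qed
  qed
  then have "\<Phi> \<in> borel_measurable borel" by (rule borel_measurable_continuous_onI)
  moreover have "(\<lambda>\<omega> i. V i \<omega>) \<in> borel_measurable M"
    by (rule measurable_coordinatewise_then_product) measurable
  ultimately have "(\<lambda>\<omega>. \<Phi> (\<lambda>i. V i \<omega>)) \<in> borel_measurable M" by (rule measurable_compose[rotated])
  then show ?thesis by (simp add: \<Phi>_def)
qed

text \<open>Step paths through the samples at multiples of \<open>1 / (n + 1)\<close> converge
  uniformly to a continuous path, so the functional is a pointwise limit of measurable ones.\<close>

lemma measurable_skorokhod_continuous_path:
  fixes Z :: "real \<Rightarrow> 'a \<Rightarrow> 'v::{second_countable_topology, metric_space}"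
  assumes g: "skorokhod_continuous T g" and "0 \<le> T"
    and [measurable]: "\<And>t. 0 \<le> t \<Longrightarrow> Z t \<in> borel_measurable M"
    and cont: "\<And>\<omega>. \<omega> \<in> space M \<Longrightarrow> continuous_on {0..T} (\<lambda>t. Z t \<omega>)"
  shows "(\<lambda>\<omega>. g (\<lambda>t. Z t \<omega>)) \<in> borel_measurable M"
proof (rule borel_measurable_LIMSEQ_real)
  define V where "V = (\<lambda>n i. Z (real i / real (Suc n)))"
  show "(\<lambda>\<omega>. g (\<lambda>t. V n (nat \<lfloor>real (Suc n) * t\<rfloor>) \<omega>)) \<in> borel_measurable M" for n
    unfolding V_def by (rule measurable_skorokhod_step[OF g \<open>0 \<le> T\<close>]) simp
  fix \<omega> assume \<omega>: "\<omega> \<in> space M"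
  show "(\<lambda>n. g (\<lambda>t. V n (nat \<lfloor>real (Suc n) * t\<rfloor>) \<omega>)) \<longlonglongrightarrow> g (\<lambda>t. Z t \<omega>)"
  proof (rule LIMSEQ_I)
    fix e :: real assume "e > 0"
    then obtain d where d: "d > 0" "\<And>y. y \<in> cadlag T \<Longrightarrow>
        skorokhod_dist T (\<lambda>t. Z t \<omega>) y < d \<Longrightarrow> \<bar>g (\<lambda>t. Z t \<omega>) - g y\<bar> < e"
      using g continuous_cadlag[OF cont[OF \<omega>]] unfolding skorokhod_continuous_def by blast
    have "uniformly_continuous_on {0..T} (\<lambda>t. Z t \<omega>)"
      using cont[OF \<omega>] by (intro compact_uniformly_continuous) auto
    then obtain k where k: "k > 0" "\<And>s t. s \<in> {0..T} \<Longrightarrow> t \<in> {0..T} \<Longrightarrow> dist t s < k \<Longrightarrow> dist (Z t \<omega>) (Z s \<omega>) < d / 2"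
      using \<open>d > 0\<close> unfolding uniformly_continuous_on_def by (meson half_gt_zero)
    obtain n0 where n0: "inverse (real (Suc n0)) < k" using reals_Archimedean[OF \<open>k > 0\<close>] by blast
    show "\<exists>no. \<forall>n\<ge>no. norm (g (\<lambda>t. V n (nat \<lfloor>real (Suc n) * t\<rfloor>) \<omega>) - g (\<lambda>t. Z t \<omega>)) < e"
    proof (intro exI[of _ n0] allI impI)
      fix n assume "n0 \<le> n"
      then have n: "inverse (real (Suc n)) < k" using n0
        by (metis Suc_le_mono le_imp_inverse_le le_less_trans of_nat_0_less_iff of_nat_mono zero_less_Suc)
      have "skorokhod_dist T (\<lambda>t. Z t \<omega>) (\<lambda>t. V n (nat \<lfloor>real (Suc n) * t\<rfloor>) \<omega>) \<le> d / 2"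
      proof (rule skorokhod_dist_le_uniform[OF \<open>0 \<le> T\<close>])
        fix t assume t: "t \<in> {0..T}"
        define s where "s = real (nat \<lfloor>real (Suc n) * t\<rfloor>) / real (Suc n)"
        have r: "real (nat \<lfloor>real (Suc n) * t\<rfloor>) = of_int \<lfloor>real (Suc n) * t\<rfloor>"
          using t by (intro of_nat_nat) auto
        have "s \<le> t" unfolding s_def r by (simp add: divide_le_eq mult.commute del: of_nat_Suc)
        moreover have "0 \<le> s" by (simp add: s_def)
        moreover have "t < s + inverse (real (Suc n))"
        proof -
          have "real (Suc n) * t < of_int \<lfloor>real (Suc n) * t\<rfloor> + 1" by linarith
          then have "t < (of_int \<lfloor>real (Suc n) * t\<rfloor> + 1) / real (Suc n)"
            by (simp add: less_divide_eq mult.commute del: of_nat_Suc)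
          then show ?thesis unfolding s_def r by (simp add: add_divide_distrib inverse_eq_divide del: of_nat_Suc)
        qed
        ultimately have "dist (Z t \<omega>) (Z s \<omega>) < d / 2"
          using t n by (intro k(2)) (auto simp: dist_real_def)
        then show "dist (Z t \<omega>) (V n (nat \<lfloor>real (Suc n) * t\<rfloor>) \<omega>) \<le> d / 2"
          by (simp add: V_def s_def)
      qed
      then show "norm (g (\<lambda>t. V n (nat \<lfloor>real (Suc n) * t\<rfloor>) \<omega>) - g (\<lambda>t. Z t \<omega>)) < e"
        using d(2)[OF step_cadlag, of "\<lambda>i. V n i \<omega>" "Suc n"] \<open>d > 0\<close> by (simp add: abs_minus_commute)
    qed
  qed
qed

section \<open>Mapping theorem for functionals that vary with the sample size\<close>

text \<open>The Lipschitz lower envelopes \<open>INF m\<ge>j, y. F m y + j * d(y, x)\<close> are admissible test functions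
  in the definition of weak convergence on the Skorokhod space.\<close>

lemma skorokhod_mapping_lower:
  fixes F :: "nat \<Rightarrow> (real \<Rightarrow> 'v::metric_space) \<Rightarrow> real" and X :: "nat \<Rightarrow> real \<Rightarrow> 'a \<Rightarrow> 'v"
  assumes "prob_space M" "prob_space P" and T: "0 \<le> T" and conv: "conv_in_distr_D T M X P Z"
    and cad: "\<And>m \<omega>. (\<lambda>t. X m t \<omega>) \<in> cadlag T"
    and cont: "\<And>\<omega>. \<omega> \<in> space P \<Longrightarrow> continuous_on {0..T} (\<lambda>t. Z t \<omega>)"
    and measX: "\<And>g m. skorokhod_continuous T g \<Longrightarrow> (\<lambda>\<omega>. g (\<lambda>t. X m t \<omega>)) \<in> borel_measurable M"
    and measZ: "\<And>g. skorokhod_continuous T g \<Longrightarrow> (\<lambda>\<omega>. g (\<lambda>t. Z t \<omega>)) \<in> borel_measurable P"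
    and measF: "\<And>m. (\<lambda>\<omega>. F m (\<lambda>t. X m t \<omega>)) \<in> borel_measurable M"
    and bnd: "\<And>m x. \<bar>F m x\<bar> \<le> B"
    and lim: "\<And>x e. continuous_on {0..T} x \<Longrightarrow> e > 0 \<Longrightarrow> \<exists>d>0. \<exists>J. \<forall>m\<ge>J. \<forall>y\<in>cadlag T.
        (\<forall>t\<in>{0..T}. dist (y t) (x t) < d) \<longrightarrow> \<bar>F m y - F0 x\<bar> < e"
    and "\<epsilon> > 0"
  shows "\<forall>\<^sub>F m in sequentially. (LINT \<omega>|P. F0 (\<lambda>t. Z t \<omega>)) - \<epsilon> \<le> (LINT \<omega>|M. F m (\<lambda>t. X m t \<omega>))"
proof -
  interpret M: prob_space M by fact
  interpret P: prob_space P by fact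
  define g where "g = (\<lambda>j x. INF p\<in>{j::nat..} \<times> cadlag T. F (fst p) (snd p) + real j * skorokhod_dist T (snd p) x)"
  have nn: "0 \<le> real j * skorokhod_dist T x y" for j and x y :: "real \<Rightarrow> 'v"
    using skorokhod_dist_nonneg[OF T] by (intro mult_nonneg_nonneg) auto
  have bdd: "bdd_below ((\<lambda>p. F (fst p) (snd p) + real j * skorokhod_dist T (snd p) x) ` ({j..} \<times> cadlag T))" for j x
  proof (rule bdd_belowI2[of _ "- B"])
    fix p :: "nat \<times> (real \<Rightarrow> 'v)"
    have "0 \<le> real j * skorokhod_dist T (snd p) x" by (rule nn)
    moreover have "- B \<le> F (fst p) (snd p)" using bnd[of "fst p" "snd p"] by linarith
    ultimately show "- B \<le> F (fst p) (snd p) + real j * skorokhod_dist T (snd p) x" by linarith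
  qed
  have ne: "{j..} \<times> cadlag T \<noteq> ({} :: (nat \<times> (real \<Rightarrow> 'v)) set)" for j :: nat
  proof -
    have "cadlag T \<noteq> ({} :: (real \<Rightarrow> 'v) set)" using cad[of 0 undefined] by (metis empty_iff)
    then show ?thesis by simp
  qed
  have g_le: "g j x \<le> F m y + real j * skorokhod_dist T y x" if "m \<ge> j" "y \<in> cadlag T" for j m x y
    unfolding g_def using that by (intro cINF_lower2[OF bdd, of "(m, y)"]) auto
  have dxx: "skorokhod_dist T x x \<le> 0" for x :: "real \<Rightarrow> 'v"
    by (rule skorokhod_dist_le_uniform[OF T]) simp
  have g_le_F: "g j x \<le> F m x" if "m \<ge> j" "x \<in> cadlag T" for j m x
  proof -
    have "g j x \<le> F m x + real j * skorokhod_dist T x x" using g_le that by blast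
    moreover have "real j * skorokhod_dist T x x \<le> 0" using dxx by (simp add: mult_nonneg_nonpos)
    ultimately show ?thesis by linarith
  qed
  have g_ge: "c \<le> g j x" if "\<And>m y. m \<ge> j \<Longrightarrow> y \<in> cadlag T \<Longrightarrow> c \<le> F m y + real j * skorokhod_dist T y x" for c j x
    unfolding g_def using that ne by (intro cINF_greatest) auto
  have g_bnd: "\<bar>g j x\<bar> \<le> B" if "x \<in> cadlag T" for j x
  proof -
    have "- B \<le> g j x"
    proof (rule g_ge)
      fix m and y :: "real \<Rightarrow> 'v"
      have "0 \<le> real j * skorokhod_dist T y x" by (rule nn)
      moreover have "- B \<le> F m y" using bnd[of m y] by linarith
      ultimately show "- B \<le> F m y + real j * skorokhod_dist T y x" by linarith
    qed
    moreover have "g j x \<le> B" using g_le_F[OF order_refl that, of j] bnd[of j x] by linarith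
    ultimately show ?thesis by simp
  qed
  have g_lip: "g j y \<le> g j x + real j * skorokhod_dist T x y" if "x \<in> cadlag T" "y \<in> cadlag T" for j x y
  proof -
    have "g j y - real j * skorokhod_dist T x y \<le> g j x"
    proof (rule g_ge)
      fix m and z :: "real \<Rightarrow> 'v" assume "m \<ge> j" "z \<in> cadlag T"
      then have "g j y \<le> F m z + real j * skorokhod_dist T z y" by (rule g_le)
      also have "real j * skorokhod_dist T z y \<le> real j * (skorokhod_dist T z x + skorokhod_dist T x y)"
        using skorokhod_dist_triangle[OF \<open>z \<in> cadlag T\<close> that T] by (intro mult_left_mono) auto
      finally show "g j y - real j * skorokhod_dist T x y \<le> F m z + real j * skorokhod_dist T z x"
        by (simp add: algebra_simps)
    qed
    then show ?thesis by simp
  qed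
  have g_cont: "skorokhod_continuous T (g j)" for j
    unfolding skorokhod_continuous_def
  proof (intro ballI allI impI)
    fix x :: "real \<Rightarrow> 'v" and e :: real assume x: "x \<in> cadlag T" and "e > 0"
    show "\<exists>\<delta>>0. \<forall>y\<in>cadlag T. skorokhod_dist T x y < \<delta> \<longrightarrow> \<bar>g j x - g j y\<bar> < e"
    proof (intro exI[of _ "e / (real j + 1)"] conjI ballI impI)
      fix y :: "real \<Rightarrow> 'v" assume y: "y \<in> cadlag T" and l: "skorokhod_dist T x y < e / (real j + 1)"
      have "g j y - g j x \<le> real j * skorokhod_dist T x y" using g_lip[OF x y] by (simp add: algebra_simps)
      moreover have "g j x - g j y \<le> real j * skorokhod_dist T y x" using g_lip[OF y x] by (simp add: algebra_simps)
      moreover have "real j * skorokhod_dist T y x \<le> real j * skorokhod_dist T x y"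
        using skorokhod_dist_commute_le[OF x y T] by (intro mult_left_mono) auto
      moreover have "real j * skorokhod_dist T x y < e"
      proof -
        have "real j * skorokhod_dist T x y \<le> (real j + 1) * skorokhod_dist T x y"
          using skorokhod_dist_nonneg[OF T] by (intro mult_right_mono) auto
        also have "\<dots> < e" using l by (simp add: less_divide_eq mult.commute)
        finally show ?thesis .
      qed
      ultimately show "\<bar>g j x - g j y\<bar> < e" by linarith
    qed (use \<open>e > 0\<close> in auto)
  qed
  have B: "0 \<le> B" using bnd[of 0 undefined] by linarith
  \<comment> \<open>A path \<open>y\<close> at Skorokhod distance at least \<open>d'\<close> from
    \<open>x\<close> pays the penalty \<open>j * d'\<close>, which for \<open>j \<ge> K\<close>
    outweighs the possible gain \<open>2 * B\<close> in \<open>F\<close>. A closer path is uniformly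
    close, where \<open>lim\<close> keeps \<open>F m y\<close> near \<open>F0 x\<close>.\<close>
  have g_lim: "(\<lambda>j. g j x) \<longlonglongrightarrow> F0 x" if c: "continuous_on {0..T} x" for x
  proof (rule LIMSEQ_I)
    fix r :: real assume "r > 0"
    have x: "x \<in> cadlag T" using c by (rule continuous_cadlag)
    obtain d J where d: "d > 0" "\<And>m y. m \<ge> J \<Longrightarrow> y \<in> cadlag T \<Longrightarrow>
        (\<forall>t\<in>{0..T}. dist (y t) (x t) < d) \<Longrightarrow> \<bar>F m y - F0 x\<bar> < r / 2"
      using lim[OF c half_gt_zero[OF \<open>r > 0\<close>]] by blast
    obtain d' where d': "d' > 0" "\<And>y. y \<in> cadlag T \<Longrightarrow> skorokhod_dist T y x < d' \<Longrightarrow> \<forall>t\<in>{0..T}. dist (y t) (x t) < d"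
      using skorokhod_dist_continuous[OF x c T \<open>d > 0\<close>] by blast
    obtain K :: nat where K: "(2 * B + r) / d' \<le> real K" using real_arch_simple by blast
    have Fx: "\<bar>F m x - F0 x\<bar> < r / 2" if "m \<ge> J" for m using d(2)[OF that x] d(1) by simp
    show "\<exists>no. \<forall>j\<ge>no. norm (g j x - F0 x) < r"
    proof (intro exI[of _ "max J K"] allI impI)
      fix j assume j: "max J K \<le> j"
      have "F0 x - r / 2 \<le> g j x"
      proof (rule g_ge)
        fix m and y :: "real \<Rightarrow> 'v" assume my: "m \<ge> j" "y \<in> cadlag T"
        show "F0 x - r / 2 \<le> F m y + real j * skorokhod_dist T y x"
        proof (cases "skorokhod_dist T y x < d'")
          case True
          have "\<bar>F m y - F0 x\<bar> < r / 2" using d(2)[of m y] d'(2)[OF my(2) True] my j by simp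
          moreover have "0 \<le> real j * skorokhod_dist T y x" by (rule nn)
          ultimately show ?thesis by linarith
        next
          case False
          have "2 * B + r \<le> real K * d'" using K d' by (simp add: divide_le_eq)
          also have "\<dots> \<le> real j * d'" using j d' by (intro mult_right_mono) auto
          also have "\<dots> \<le> real j * skorokhod_dist T y x" using False by (intro mult_left_mono) auto
          finally have "2 * B + r \<le> real j * skorokhod_dist T y x" .
          moreover have "F0 x \<le> B + r / 2" using Fx[of J] bnd[of J x] by linarith
          ultimately show ?thesis using bnd[of m y] \<open>r > 0\<close> by linarith
        qed
      qed
      moreover have "g j x < F0 x + r / 2" 
      proof -
        have "J \<le> j" using j by simp
        then show ?thesis using g_le_F[OF order_refl x, of j] Fx[of j] by linarith
      qed
      ultimately show "norm (g j x - F0 x) < r" using \<open>r > 0\<close> by simp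
    qed
  qed
  have "(\<lambda>j. LINT \<omega>|P. g j (\<lambda>t. Z t \<omega>)) \<longlonglongrightarrow> (LINT \<omega>|P. F0 (\<lambda>t. Z t \<omega>))"
  proof (rule integral_dominated_convergence[where w = "\<lambda>_. B"])
    show "(\<lambda>\<omega>. F0 (\<lambda>t. Z t \<omega>)) \<in> borel_measurable P"
      by (rule borel_measurable_LIMSEQ_real[OF g_lim measZ[OF g_cont]]) (rule cont)
    show "(\<lambda>\<omega>. g j (\<lambda>t. Z t \<omega>)) \<in> borel_measurable P" for j by (rule measZ[OF g_cont])
    show "AE \<omega> in P. (\<lambda>j. g j (\<lambda>t. Z t \<omega>)) \<longlonglongrightarrow> F0 (\<lambda>t. Z t \<omega>)"
      using g_lim cont by auto
    show "AE \<omega> in P. norm (g j (\<lambda>t. Z t \<omega>)) \<le> B" for j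
      using g_bnd[OF continuous_cadlag[OF cont]] by auto
  qed simp
  then have "\<forall>\<^sub>F j in sequentially. (LINT \<omega>|P. F0 (\<lambda>t. Z t \<omega>)) - \<epsilon> / 2 < (LINT \<omega>|P. g j (\<lambda>t. Z t \<omega>))"
    using \<open>\<epsilon> > 0\<close> by (intro order_tendstoD) auto
  \<comment> \<open>One \<open>j\<close> is fixed before \<open>m\<close> grows, since
    \<open>conv_in_distr_D\<close> speaks about one test function at a time. The comparison
    \<open>g j \<le> F m\<close> then holds for all \<open>m \<ge> j\<close>.\<close>
  then obtain j where j: "(LINT \<omega>|P. F0 (\<lambda>t. Z t \<omega>)) - \<epsilon> / 2 < (LINT \<omega>|P. g j (\<lambda>t. Z t \<omega>))"
    by (auto simp: eventually_sequentially)
  have "bounded (g j ` cadlag T)"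
    using g_bnd by (intro boundedI[of _ B]) auto
  then have "(\<lambda>m. LINT \<omega>|M. g j (\<lambda>t. X m t \<omega>)) \<longlonglongrightarrow> (LINT \<omega>|P. g j (\<lambda>t. Z t \<omega>))"
    using conv g_cont unfolding conv_in_distr_D_def by blast
  then have "\<forall>\<^sub>F m in sequentially. (LINT \<omega>|P. g j (\<lambda>t. Z t \<omega>)) - \<epsilon> / 2 < (LINT \<omega>|M. g j (\<lambda>t. X m t \<omega>))"
    using \<open>\<epsilon> > 0\<close> by (intro order_tendstoD) auto
  moreover have "\<forall>\<^sub>F m in sequentially. (LINT \<omega>|M. g j (\<lambda>t. X m t \<omega>)) \<le> (LINT \<omega>|M. F m (\<lambda>t. X m t \<omega>))"
    using eventually_ge_at_top[of j]
  proof eventually_elim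
    case (elim m)
    show ?case
    proof (rule integral_mono)
      show "integrable M (\<lambda>\<omega>. g j (\<lambda>t. X m t \<omega>))"
        using g_bnd[OF cad] by (intro M.integrable_const_bound[where B = B] measX g_cont) auto
      show "integrable M (\<lambda>\<omega>. F m (\<lambda>t. X m t \<omega>))"
        using bnd by (intro M.integrable_const_bound[where B = B] measF) auto
    qed (use g_le_F[OF elim cad] in auto)
  qed
  ultimately show ?thesis by eventually_elim (use j in linarith)
qed

text \<open>The ramp \<open>\<phi>\<close>, falling from 1 to 0 between \<open>a\<close> and
  \<open>a + e\<close>, lies between the indicators of the two half lines and is Lipschitz with
  constant \<open>1 / e\<close>. Applying the one-sided integral bound to \<open>\<phi>\<close> and
  to \<open>- \<phi>\<close> gives both directions. Measurability of \<open>G m\<close> along the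
  paths is a separate assumption because \<open>G m\<close> need not be Skorokhod
  continuous.\<close>

lemma skorokhod_mapping_prob:
  fixes G :: "nat \<Rightarrow> (real \<Rightarrow> 'v::metric_space) \<Rightarrow> real" and X :: "nat \<Rightarrow> real \<Rightarrow> 'a \<Rightarrow> 'v"
  assumes "prob_space M" "prob_space P" and T: "0 \<le> T" and conv: "conv_in_distr_D T M X P Z"
    and cad: "\<And>m \<omega>. (\<lambda>t. X m t \<omega>) \<in> cadlag T"
    and cont: "\<And>\<omega>. \<omega> \<in> space P \<Longrightarrow> continuous_on {0..T} (\<lambda>t. Z t \<omega>)"
    and measX: "\<And>g m. skorokhod_continuous T g \<Longrightarrow> (\<lambda>\<omega>. g (\<lambda>t. X m t \<omega>)) \<in> borel_measurable M"
    and measZ: "\<And>g. skorokhod_continuous T g \<Longrightarrow> (\<lambda>\<omega>. g (\<lambda>t. Z t \<omega>)) \<in> borel_measurable P"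
    and measG[measurable]: "\<And>m. (\<lambda>\<omega>. G m (\<lambda>t. X m t \<omega>)) \<in> borel_measurable M"
    and measG0[measurable]: "(\<lambda>\<omega>. G0 (\<lambda>t. Z t \<omega>)) \<in> borel_measurable P"
    and lim: "\<And>x e. continuous_on {0..T} x \<Longrightarrow> e > 0 \<Longrightarrow> \<exists>d>0. \<exists>J. \<forall>m\<ge>J. \<forall>y\<in>cadlag T.
        (\<forall>t\<in>{0..T}. dist (y t) (x t) < d) \<longrightarrow> \<bar>G m y - G0 x\<bar> < e"
    and "e > 0" "\<epsilon> > 0"
  shows "\<forall>\<^sub>F m in sequentially. measure M {\<omega>\<in>space M. G m (\<lambda>t. X m t \<omega>) \<le> a}
           \<le> measure P {\<omega>\<in>space P. G0 (\<lambda>t. Z t \<omega>) \<le> a + e} + \<epsilon>" (is ?up)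
    and "\<forall>\<^sub>F m in sequentially. measure P {\<omega>\<in>space P. G0 (\<lambda>t. Z t \<omega>) \<le> a}
           \<le> measure M {\<omega>\<in>space M. G m (\<lambda>t. X m t \<omega>) \<le> a + e} + \<epsilon>" (is ?low)
proof -
  interpret M: prob_space M by fact
  interpret P: prob_space P by fact
  define \<phi> where "\<phi> = (\<lambda>r. max 0 (min 1 ((a + e - r) / e)))"
  have [measurable]: "\<phi> \<in> borel_measurable borel" unfolding \<phi>_def by measurable
  have \<phi>01: "0 \<le> \<phi> r" "\<phi> r \<le> 1" for r by (auto simp: \<phi>_def)
  have \<phi>_lip: "\<bar>\<phi> r - \<phi> s\<bar> \<le> \<bar>r - s\<bar> / e" for r s
  proof -
    have "\<bar>\<phi> r - \<phi> s\<bar> \<le> \<bar>(a + e - r) / e - (a + e - s) / e\<bar>" unfolding \<phi>_def by linarith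
    also have "\<dots> = \<bar>r - s\<bar> / e" using \<open>e > 0\<close>
      by (simp add: diff_divide_distrib[symmetric] abs_divide abs_minus_commute)
    finally show ?thesis .
  qed
  have ind: "measure Q {\<omega>\<in>space Q. f \<omega> \<le> a} \<le> (LINT \<omega>|Q. \<phi> (f \<omega>))"
       "(LINT \<omega>|Q. \<phi> (f \<omega>)) \<le> measure Q {\<omega>\<in>space Q. f \<omega> \<le> a + e}"
    if "prob_space Q" and [measurable]: "f \<in> borel_measurable Q" for Q :: "'z measure" and f
  proof -
    interpret Q: prob_space Q by fact
    have i: "integrable Q (\<lambda>\<omega>. \<phi> (f \<omega>))"
      by (rule Q.integrable_const_bound[where B = 1]) (use \<phi>01 in auto)
    have "measure Q {\<omega>\<in>space Q. f \<omega> \<le> a} = (LINT \<omega>|Q. indicator {\<omega>\<in>space Q. f \<omega> \<le> a} \<omega>)" by simp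
    also have "\<dots> \<le> (LINT \<omega>|Q. \<phi> (f \<omega>))"
    proof (rule integral_mono[OF _ i])
      fix \<omega> show "indicator {\<omega>\<in>space Q. f \<omega> \<le> a} \<omega> \<le> \<phi> (f \<omega>)"
        using \<open>e > 0\<close> \<phi>01 by (auto simp: indicator_def \<phi>_def)
    qed (rule Q.integrable_const_bound[where B = 1], auto)
    finally show "measure Q {\<omega>\<in>space Q. f \<omega> \<le> a} \<le> (LINT \<omega>|Q. \<phi> (f \<omega>))" .
    have "(LINT \<omega>|Q. \<phi> (f \<omega>)) \<le> (LINT \<omega>|Q. indicator {\<omega>\<in>space Q. f \<omega> \<le> a + e} \<omega>)"
    proof (rule integral_mono[OF i])
      fix \<omega> assume "\<omega> \<in> space Q"
      show "\<phi> (f \<omega>) \<le> indicator {\<omega>\<in>space Q. f \<omega> \<le> a + e} \<omega>"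
      proof (cases "f \<omega> \<le> a + e")
        case False
        then have "(a + e - f \<omega>) / e \<le> 0" using \<open>e > 0\<close> by (simp add: divide_le_0_iff)
        then show ?thesis by (simp add: \<phi>_def)
      qed (use \<phi>01 \<open>\<omega> \<in> space Q\<close> in auto)
    qed (rule Q.integrable_const_bound[where B = 1], auto)
    then show "(LINT \<omega>|Q. \<phi> (f \<omega>)) \<le> measure Q {\<omega>\<in>space Q. f \<omega> \<le> a + e}" by simp
  qed
  have lim': "\<exists>d>0. \<exists>J. \<forall>m\<ge>J. \<forall>y\<in>cadlag T.
        (\<forall>t\<in>{0..T}. dist (y t) (x t) < d) \<longrightarrow> \<bar>\<phi> (G m y) - \<phi> (G0 x)\<bar> < e'"
    if cx: "continuous_on {0..T} x" and e': "e' > 0" for x e'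
  proof -
    obtain d J where "d > 0" and *: "\<And>m y. m \<ge> J \<Longrightarrow> y \<in> cadlag T \<Longrightarrow>
        (\<forall>t\<in>{0..T}. dist (y t) (x t) < d) \<Longrightarrow> \<bar>G m y - G0 x\<bar> < e' * e"
      using lim[OF cx, of "e' * e"] e' \<open>e > 0\<close> by (metis mult_pos_pos)
    moreover have "\<bar>\<phi> (G m y) - \<phi> (G0 x)\<bar> < e'" if "\<bar>G m y - G0 x\<bar> < e' * e" for m y
    proof -
      have "\<bar>\<phi> (G m y) - \<phi> (G0 x)\<bar> \<le> \<bar>G m y - G0 x\<bar> / e" by (rule \<phi>_lip)
      also have "\<dots> < e'" using that \<open>e > 0\<close> by (simp add: divide_less_eq)
      finally show ?thesis .
    qed
    ultimately show ?thesis by blast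
  qed
  have m1: "(\<lambda>\<omega>. \<phi> (G m (\<lambda>t. X m t \<omega>))) \<in> borel_measurable M" for m by measurable
  have m2: "(\<lambda>\<omega>. - \<phi> (G m (\<lambda>t. X m t \<omega>))) \<in> borel_measurable M" for m by measurable
  have b1: "\<bar>\<phi> (G m x)\<bar> \<le> 1" "\<bar>- \<phi> (G m x)\<bar> \<le> 1" for m x using \<phi>01[of "G m x"] by auto
  note main = skorokhod_mapping_lower[OF assms(1,2) T conv cad cont measX measZ]
  have "\<forall>\<^sub>F m in sequentially. (LINT \<omega>|P. \<phi> (G0 (\<lambda>t. Z t \<omega>))) - \<epsilon> \<le> (LINT \<omega>|M. \<phi> (G m (\<lambda>t. X m t \<omega>)))"
    by (rule main[where F = "\<lambda>m x. \<phi> (G m x)" and ?F0.0 = "\<lambda>x. \<phi> (G0 x)", OF _ _ _ m1 b1(1) lim' \<open>\<epsilon> > 0\<close>])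
  then show ?low
  proof eventually_elim
    case (elim m)
    then show ?case
      using ind(1)[OF \<open>prob_space P\<close> measG0] ind(2)[OF \<open>prob_space M\<close> measG, of m] by linarith
  qed
  have "\<forall>\<^sub>F m in sequentially. (LINT \<omega>|P. - \<phi> (G0 (\<lambda>t. Z t \<omega>))) - \<epsilon> \<le> (LINT \<omega>|M. - \<phi> (G m (\<lambda>t. X m t \<omega>)))"
  proof (rule main[where F = "\<lambda>m x. - \<phi> (G m x)" and ?F0.0 = "\<lambda>x. - \<phi> (G0 x)", OF _ _ _ m2 b1(2) _ \<open>\<epsilon> > 0\<close>])
    show "\<exists>d>0. \<exists>J. \<forall>m\<ge>J. \<forall>y\<in>cadlag T.
        (\<forall>t\<in>{0..T}. dist (y t) (x t) < d) \<longrightarrow> \<bar>- \<phi> (G m y) - - \<phi> (G0 x)\<bar> < e'"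
      if "continuous_on {0..T} x" "e' > 0" for x e'
      using lim'[OF that] by (simp add: abs_minus_commute)
  qed
  then show ?up
  proof eventually_elim
    case (elim m)
    then have "(LINT \<omega>|M. \<phi> (G m (\<lambda>t. X m t \<omega>))) \<le> (LINT \<omega>|P. \<phi> (G0 (\<lambda>t. Z t \<omega>))) + \<epsilon>" by simp
    then show ?case
      using ind(2)[OF \<open>prob_space P\<close> measG0] ind(1)[OF \<open>prob_space M\<close> measG, of m] by linarith
  qed
qed

section \<open>Weighted suprema of increments\<close>

text \<open>The rounding is applied to \<open>k * u\<close>, so that one set \<open>U\<close>
  describes both the indices compared with \<open>k\<close>, for every \<open>k\<close>, and the
  times \<open>t * u\<close> compared with \<open>t\<close> in the limit.\<close>

definition floor_multiples :: "real set \<Rightarrow> nat \<Rightarrow> nat set" where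
  "floor_multiples U k = (\<lambda>u. nat \<lfloor>real k * u\<rfloor>) ` U"

text \<open>The inserted 0, here and in \<open>path_sup\<close>, keeps the supremum meaningful when
  nothing lies in the window, for instance at \<open>m = 0\<close>, where every \<open>k / m\<close>
  is 0. Only grid values of \<open>D\<close> enter, so finitely many increments determine the
  result.\<close>

definition grid_sup :: "(real \<Rightarrow> real) \<Rightarrow> real set \<Rightarrow> real \<Rightarrow> real \<Rightarrow> nat \<Rightarrow> (real \<Rightarrow> real) \<Rightarrow> real" where
  "grid_sup \<rho> U a T m D = Sup (insert 0 {\<rho> (real k / real m) * \<bar>D (real k / real m) - D (real l / real m)\<bar> | k l.
     a \<le> real k / real m \<and> real k / real m \<le> T \<and> l \<in> floor_multiples U k})"

definition path_sup :: "(real \<Rightarrow> real) \<Rightarrow> real set \<Rightarrow> real \<Rightarrow> real \<Rightarrow> (real \<Rightarrow> real) \<Rightarrow> real" where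
  "path_sup \<rho> U a T D = Sup (insert 0 {\<rho> t * \<bar>D t - D (t * u)\<bar> | t u. a \<le> t \<and> t \<le> T \<and> u \<in> U})"

lemma floor_multiples_le:
  assumes "U \<subseteq> {0..1}" "l \<in> floor_multiples U k"
  shows "l \<le> k"
proof -
  obtain u where u: "u \<in> U" "l = nat \<lfloor>real k * u\<rfloor>" using assms by (auto simp: floor_multiples_def)
  have "real k * u \<le> real k" using assms(1) u(1) by (intro mult_left_le) auto
  then show ?thesis unfolding u by linarith
qed

text \<open>Finitely many pairs \<open>(k, l)\<close> lie in the window, so the real supremum is
  bounded. Describing it by its upper bounds yields measurability and Lipschitz dependence on
  \<open>D\<close> without touching \<open>Sup\<close> again.\<close>

lemma grid_sup_le_iff:
  assumes "U \<subseteq> {0..1}" "0 < a"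
  shows "grid_sup \<rho> U a T m D \<le> c \<longleftrightarrow> 0 \<le> c \<and> (\<forall>k l. a \<le> real k / real m \<and> real k / real m \<le> T \<and>
     l \<in> floor_multiples U k \<longrightarrow> \<rho> (real k / real m) * \<bar>D (real k / real m) - D (real l / real m)\<bar> \<le> c)"
proof -
  let ?S = "{\<rho> (real k / real m) * \<bar>D (real k / real m) - D (real l / real m)\<bar> | k l.
     a \<le> real k / real m \<and> real k / real m \<le> T \<and> l \<in> floor_multiples U k}"
  have "?S \<subseteq> (\<lambda>(k, l). \<rho> (real k / real m) * \<bar>D (real k / real m) - D (real l / real m)\<bar>) `
      ({..nat \<lfloor>T * real m\<rfloor>} \<times> {..nat \<lfloor>T * real m\<rfloor>})"
  proof
    fix x assume "x \<in> ?S"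
    then obtain k l where *: "a \<le> real k / real m" "real k / real m \<le> T" "l \<in> floor_multiples U k"
      "x = \<rho> (real k / real m) * \<bar>D (real k / real m) - D (real l / real m)\<bar>" by blast
    have "m \<noteq> 0" using * \<open>0 < a\<close> by (cases "m = 0") auto
    then have "real k \<le> T * real m" using * by (simp add: divide_le_eq)
    then have "k \<le> nat \<lfloor>T * real m\<rfloor>" by linarith
    moreover have "l \<le> k" using floor_multiples_le[OF assms(1) *(3)] .
    ultimately show "x \<in> (\<lambda>(k, l). \<rho> (real k / real m) * \<bar>D (real k / real m) - D (real l / real m)\<bar>) `
      ({..nat \<lfloor>T * real m\<rfloor>} \<times> {..nat \<lfloor>T * real m\<rfloor>})" using *(4) by force
  qed
  then have "finite ?S" by (rule finite_subset) simp
  then have "bdd_above (insert 0 ?S)" by simp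
  then have "Sup (insert 0 ?S) \<le> c \<longleftrightarrow> (\<forall>x\<in>insert 0 ?S. x \<le> c)" by (intro cSup_le_iff) auto
  then show ?thesis unfolding grid_sup_def by (simp, blast)
qed

lemma grid_sup_nonneg: "U \<subseteq> {0..1} \<Longrightarrow> 0 < a \<Longrightarrow> 0 \<le> grid_sup \<rho> U a T m D"
  using grid_sup_le_iff[of U a \<rho> T m D "grid_sup \<rho> U a T m D"] by simp

lemma grid_sup_upper:
  assumes "U \<subseteq> {0..1}" "0 < a" "a \<le> real k / real m" "real k / real m \<le> T" "l \<in> floor_multiples U k"
  shows "\<rho> (real k / real m) * \<bar>D (real k / real m) - D (real l / real m)\<bar> \<le> grid_sup \<rho> U a T m D"
  using grid_sup_le_iff[of U a \<rho> T m D "grid_sup \<rho> U a T m D"] assms by blast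

lemma measurable_grid_sup:
  assumes "U \<subseteq> {0..1}" "0 < a" and [measurable]: "\<And>k. (\<lambda>\<omega>. D \<omega> (real k / real m)) \<in> borel_measurable M"
  shows "(\<lambda>\<omega>. grid_sup \<rho> U a T m (D \<omega>)) \<in> borel_measurable M"
  unfolding borel_measurable_iff_le grid_sup_le_iff[OF assms(1,2)] by measurable

lemma grid_sup_lipschitz:
  assumes U: "U \<subseteq> {0..1}" "0 < a" and C: "\<And>t. a \<le> t \<Longrightarrow> t \<le> T \<Longrightarrow> \<bar>\<rho> t\<bar> \<le> C" "0 \<le> C"
    and e: "\<And>k. real k / real m \<le> T \<Longrightarrow> \<bar>D (real k / real m) - E (real k / real m)\<bar> \<le> e" "0 \<le> e"
  shows "\<bar>grid_sup \<rho> U a T m D - grid_sup \<rho> U a T m E\<bar> \<le> 2 * C * e"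
proof -
  have *: "grid_sup \<rho> U a T m D \<le> grid_sup \<rho> U a T m E + 2 * C * e"
    if e: "\<And>k. real k / real m \<le> T \<Longrightarrow> \<bar>D (real k / real m) - E (real k / real m)\<bar> \<le> e" for D E
    unfolding grid_sup_le_iff[OF U]
  proof (intro conjI allI impI)
    show "0 \<le> grid_sup \<rho> U a T m E + 2 * C * e" using grid_sup_nonneg[OF U] C \<open>0 \<le> e\<close> by simp
    fix k l assume kl: "a \<le> real k / real m \<and> real k / real m \<le> T \<and> l \<in> floor_multiples U k"
    have "real l / real m \<le> real k / real m"
      using floor_multiples_le[OF U(1)] kl by (intro divide_right_mono) auto
    then have "\<bar>D (real l / real m) - E (real l / real m)\<bar> \<le> e" using kl by (intro e) linarith
    moreover have "\<bar>D (real k / real m) - E (real k / real m)\<bar> \<le> e" using kl by (intro e) linarith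
    ultimately have d: "\<bar>\<bar>D (real k / real m) - D (real l / real m)\<bar> - \<bar>E (real k / real m) - E (real l / real m)\<bar>\<bar> \<le> 2 * e"
      by linarith
    have "\<rho> (real k / real m) * (\<bar>D (real k / real m) - D (real l / real m)\<bar> - \<bar>E (real k / real m) - E (real l / real m)\<bar>)
        \<le> \<bar>\<rho> (real k / real m)\<bar> * \<bar>\<bar>D (real k / real m) - D (real l / real m)\<bar> - \<bar>E (real k / real m) - E (real l / real m)\<bar>\<bar>"
      by (metis abs_ge_self abs_mult)
    also have "\<dots> \<le> C * (2 * e)" using C kl by (intro mult_mono d) auto
    finally show "\<rho> (real k / real m) * \<bar>D (real k / real m) - D (real l / real m)\<bar> \<le> grid_sup \<rho> U a T m E + 2 * C * e"
      using grid_sup_upper[OF U, of k m T l \<rho> E] kl by (simp add: algebra_simps)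
  qed
  have "\<And>k. real k / real m \<le> T \<Longrightarrow> \<bar>E (real k / real m) - D (real k / real m)\<bar> \<le> e"
    using e(1) by (simp add: abs_minus_commute)
  from *[of D E, OF e(1)] *[of E D, OF this] show ?thesis by linarith
qed

lemma path_sup_bdd:
  fixes \<rho> :: "real \<Rightarrow> real"
  assumes U: "U \<subseteq> {0..1}" and a: "0 < a" and \<rho>: "continuous_on {0<..} \<rho>" and D: "continuous_on {0..T} D"
  shows "bdd_above (insert 0 {\<rho> t * \<bar>D t - D (t * u)\<bar> | t u. a \<le> t \<and> t \<le> T \<and> u \<in> U})"
proof -
  have "bounded (\<rho> ` {a..T})"
    using \<rho> a by (intro compact_imp_bounded compact_continuous_image) (auto intro: continuous_on_subset)
  then obtain C where "\<forall>x\<in>\<rho> ` {a..T}. \<bar>x\<bar> \<le> C" unfolding bounded_real by blast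
  then have C: "\<And>t. a \<le> t \<Longrightarrow> t \<le> T \<Longrightarrow> \<bar>\<rho> t\<bar> \<le> C" by auto
  have "bounded (D ` {0..T})" using D by (intro compact_imp_bounded compact_continuous_image) auto
  then obtain K where "\<forall>x\<in>D ` {0..T}. \<bar>x\<bar> \<le> K" unfolding bounded_real by blast
  then have K: "\<And>t. 0 \<le> t \<Longrightarrow> t \<le> T \<Longrightarrow> \<bar>D t\<bar> \<le> K" by auto
  have "\<rho> t * \<bar>D t - D (t * u)\<bar> \<le> C * (2 * K)" if "a \<le> t" "t \<le> T" "u \<in> U" for t u
  proof -
    have "0 \<le> t * u" "t * u \<le> t * 1" using that U a by (auto intro!: mult_left_mono simp: subset_eq)
    then have "\<bar>D t - D (t * u)\<bar> \<le> 2 * K" using K[of t] K[of "t * u"] that a by linarith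
    moreover have "\<rho> t \<le> C" "0 \<le> C" using C[OF that(1,2)] by linarith+
    ultimately show ?thesis by (intro mult_mono) auto
  qed
  then show ?thesis by (auto intro!: bdd_aboveI[of _ "C * (2 * K)"])
qed

lemma path_sup_le_iff:
  assumes "U \<subseteq> {0..1}" "0 < a" "continuous_on {0<..} \<rho>" "continuous_on {0..T} D"
  shows "path_sup \<rho> U a T D \<le> c \<longleftrightarrow> 0 \<le> c \<and> (\<forall>t u. a \<le> t \<and> t \<le> T \<and> u \<in> U \<longrightarrow> \<rho> t * \<bar>D t - D (t * u)\<bar> \<le> c)"
proof -
  let ?S = "{\<rho> t * \<bar>D t - D (t * u)\<bar> | t u. a \<le> t \<and> t \<le> T \<and> u \<in> U}"
  have "Sup (insert 0 ?S) \<le> c \<longleftrightarrow> (\<forall>x\<in>insert 0 ?S. x \<le> c)"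
    using path_sup_bdd[OF assms] by (intro cSup_le_iff) auto
  then show ?thesis unfolding path_sup_def by (simp, blast)
qed

lemma path_sup_upper:
  assumes "U \<subseteq> {0..1}" "0 < a" "continuous_on {0<..} \<rho>" "continuous_on {0..T} D"
    and "a \<le> t" "t \<le> T" "u \<in> U"
  shows "\<rho> t * \<bar>D t - D (t * u)\<bar> \<le> path_sup \<rho> U a T D"
  using path_sup_le_iff[OF assms(1-4), of "path_sup \<rho> U a T D"] assms(5-) by blast

lemma path_sup_nonneg:
  assumes "U \<subseteq> {0..1}" "0 < a" "continuous_on {0<..} \<rho>" "continuous_on {0..T} D"
  shows "0 \<le> path_sup \<rho> U a T D"
  using path_sup_le_iff[OF assms, of "path_sup \<rho> U a T D"] by simp

text \<open>The weighted increment is uniformly continuous in the pair of times on the compact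
  window, and rounding both times to the grid moves them by multiples of \<open>1 / m\<close>: at
  most one for the first, two for the second, where the rounding of \<open>k * u\<close> comes on
  top of that of \<open>t\<close>.\<close>

lemma grid_sup_tendsto_path_sup:
  assumes U: "U \<subseteq> {0..1}" and a: "0 < a" "a < T"
    and \<rho>: "continuous_on {0<..} \<rho>" and D: "continuous_on {0..T} D"
  shows "(\<lambda>m. grid_sup \<rho> U a T m D) \<longlonglongrightarrow> path_sup \<rho> U a T D"
proof (rule LIMSEQ_I)
  fix e :: real assume "e > 0"
  define q where "q = (\<lambda>p. \<rho> (fst p) * \<bar>D (fst p) - D (snd p)\<bar>)"
  have "continuous_on ({a..T} \<times> {0..T}) q"
    unfolding q_def
    using a by (intro continuous_intros continuous_on_compose2[OF \<rho>] continuous_on_compose2[OF D]) auto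
  then have "uniformly_continuous_on ({a..T} \<times> {0..T}) q"
    by (intro compact_uniformly_continuous compact_Times) auto
  then obtain d where d: "d > 0" "\<And>p p'. p \<in> {a..T} \<times> {0..T} \<Longrightarrow> p' \<in> {a..T} \<times> {0..T} \<Longrightarrow>
      dist p' p < d \<Longrightarrow> dist (q p') (q p) < e / 2"
    using \<open>e > 0\<close> unfolding uniformly_continuous_on_def by (meson half_gt_zero)
  \<comment> \<open>\<open>4 / d\<close> makes the total displacement \<open>3 / m\<close> smaller
    than \<open>d\<close>; \<open>2 / (T - a)\<close> guarantees a grid point of the window within
    \<open>1 / m\<close> of any of its times.\<close>
  obtain J :: nat where J: "max (4 / d) (2 / (T - a)) < real J" using reals_Archimedean2 by blast
  have close: "q (t, s) \<le> q (t', s') + e / 2"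
    if "\<bar>t - t'\<bar> \<le> 1 / real m" "\<bar>s - s'\<bar> \<le> 2 / real m" "J \<le> m" "t \<in> {a..T}" "t' \<in> {a..T}" "s \<in> {0..T}" "s' \<in> {0..T}"
    for t t' s s' m
  proof -
    have m: "4 / d < real m" using J that(3) by linarith
    have m0: "0 < real m" using m d(1) by (meson divide_pos_pos less_trans zero_less_numeral)
    have "dist (t, s) (t', s') \<le> \<bar>t - t'\<bar> + \<bar>s - s'\<bar>"
      using sqrt_sum_squares_le_sum_abs[of "t - t'" "s - s'"] by (simp add: dist_Pair_Pair dist_real_def)
    also have "\<dots> \<le> 1 / real m + 2 / real m" using that by linarith
    also have "\<dots> = 3 / real m" by (simp add: add_divide_distrib[symmetric])
    also have "\<dots> < d" using m m0 d(1) by (simp add: field_simps)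
    finally have "dist (q (t, s)) (q (t', s')) < e / 2" using that by (intro d(2)) auto
    then show ?thesis unfolding dist_real_def by linarith
  qed
  show "\<exists>no. \<forall>m\<ge>no. norm (grid_sup \<rho> U a T m D - path_sup \<rho> U a T D) < e"
  proof (intro exI[of _ J] allI impI)
    fix m assume m: "J \<le> m"
    have mT: "2 / (T - a) < real m" using J m by linarith
    have m0: "0 < real m" using mT a by (meson diff_gt_0_iff_gt divide_pos_pos less_trans zero_less_numeral)
    have fl: "\<bar>real (nat \<lfloor>real k * u\<rfloor>) / real m - real k * u / real m\<bar> \<le> 1 / real m"
         "real (nat \<lfloor>real k * u\<rfloor>) / real m \<le> real k / real m" if "u \<in> U" for k u
    proof -
      have "real (nat \<lfloor>real k * u\<rfloor>) = of_int \<lfloor>real k * u\<rfloor>"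
        using that U by (intro of_nat_nat) (auto simp: subset_eq)
      then have "\<bar>real (nat \<lfloor>real k * u\<rfloor>) - real k * u\<bar> \<le> 1" by linarith
      then have "\<bar>real (nat \<lfloor>real k * u\<rfloor>) - real k * u\<bar> / real m \<le> 1 / real m" by (intro divide_right_mono) auto
      then show "\<bar>real (nat \<lfloor>real k * u\<rfloor>) / real m - real k * u / real m\<bar> \<le> 1 / real m"
        using m0 by (simp add: diff_divide_distrib[symmetric] abs_divide)
      have "nat \<lfloor>real k * u\<rfloor> \<le> k" using floor_multiples_le[OF U, of _ k] that by (auto simp: floor_multiples_def)
      then show "real (nat \<lfloor>real k * u\<rfloor>) / real m \<le> real k / real m" by (intro divide_right_mono) auto
    qed
    have "grid_sup \<rho> U a T m D \<le> path_sup \<rho> U a T D + e / 2"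
      unfolding grid_sup_le_iff[OF U a(1)]
    proof (intro conjI allI impI)
      show "0 \<le> path_sup \<rho> U a T D + e / 2" using path_sup_nonneg[OF U a(1) \<rho> D] \<open>e > 0\<close> by simp
      fix k l assume kl: "a \<le> real k / real m \<and> real k / real m \<le> T \<and> l \<in> floor_multiples U k"
      then obtain u where u: "u \<in> U" "l = nat \<lfloor>real k * u\<rfloor>" by (auto simp: floor_multiples_def)
      have u01: "0 \<le> u" "u \<le> 1" using u U by auto
      have tu: "real k / real m * u \<le> real k / real m" using u01 by (intro mult_left_le) auto
      have "q (real k / real m, real l / real m) \<le> q (real k / real m, real k / real m * u) + e / 2"
      proof (rule close[OF _ _ m])
        have "1 / real m \<le> 2 / real m" using m0 by (intro divide_right_mono) auto
        then show "\<bar>real l / real m - real k / real m * u\<bar> \<le> 2 / real m"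
          using fl(1)[OF u(1), of k] u(2) by simp
        show "real l / real m \<in> {0..T}" using fl(2)[OF u(1), of k] kl u(2) by auto
        show "real k / real m * u \<in> {0..T}" using tu kl u01 by auto
      qed (use kl in auto)
      also have "q (real k / real m, real k / real m * u) \<le> path_sup \<rho> U a T D"
        unfolding q_def fst_conv snd_conv using kl u by (intro path_sup_upper[OF U a(1) \<rho> D]) auto
      finally show "\<rho> (real k / real m) * \<bar>D (real k / real m) - D (real l / real m)\<bar> \<le> path_sup \<rho> U a T D + e / 2"
        by (simp add: q_def)
    qed
    moreover have "path_sup \<rho> U a T D \<le> grid_sup \<rho> U a T m D + e / 2"
      unfolding path_sup_le_iff[OF U a(1) \<rho> D]
    proof (intro conjI allI impI)
      show "0 \<le> grid_sup \<rho> U a T m D + e / 2" using grid_sup_nonneg[OF U a(1)] \<open>e > 0\<close> by simp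
      fix t u assume tu: "a \<le> t \<and> t \<le> T \<and> u \<in> U"
      have "\<exists>k. a \<le> real k / real m \<and> real k / real m \<le> T \<and> \<bar>t - real k / real m\<bar> \<le> 1 / real m"
      \<comment> \<open>Rounding \<open>t\<close> down is the default. If this falls below
        \<open>a\<close>, then \<open>t\<close> is within \<open>1 / m\<close> of \<open>a\<close>,
        and rounding up stays below \<open>T\<close> because \<open>m * (T - a) > 2\<close>.\<close>
      proof (cases "a * real m \<le> of_int \<lfloor>real m * t\<rfloor>")
        case True
        have r: "real (nat \<lfloor>real m * t\<rfloor>) = of_int \<lfloor>real m * t\<rfloor>" using tu a by (intro of_nat_nat) auto
        have "a \<le> real (nat \<lfloor>real m * t\<rfloor>) / real m" unfolding r using True m0 by (simp add: le_divide_eq)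
        moreover have "real (nat \<lfloor>real m * t\<rfloor>) / real m \<le> t" unfolding r using m0 by (simp add: divide_le_eq mult.commute)
        moreover have "t - real (nat \<lfloor>real m * t\<rfloor>) / real m \<le> 1 / real m"
        proof -
          have "t - of_int \<lfloor>real m * t\<rfloor> / real m = (real m * t - of_int \<lfloor>real m * t\<rfloor>) / real m"
            using m0 by (simp add: diff_divide_distrib)
          also have "\<dots> \<le> 1 / real m" by (intro divide_right_mono) (linarith, simp)
          finally show ?thesis unfolding r .
        qed
        ultimately show ?thesis using tu by (intro exI[of _ "nat \<lfloor>real m * t\<rfloor>"]) auto
      next
        case False
        have r: "real (nat \<lceil>real m * t\<rceil>) = of_int \<lceil>real m * t\<rceil>"
        proof (rule of_nat_nat)
          have "0 \<le> real m * t" using tu a by simp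
          then show "0 \<le> \<lceil>real m * t\<rceil>" by linarith
        qed
        have c1: "real m * t \<le> of_int \<lceil>real m * t\<rceil>" "of_int \<lceil>real m * t\<rceil> < real m * t + 1" by linarith+
        have c2: "real m * t < a * real m + 1" using False by linarith
        have "2 < real m * (T - a)" using mT a by (simp add: divide_less_eq)
        then have c3: "of_int \<lceil>real m * t\<rceil> \<le> T * real m" using c1 c2 by (simp add: algebra_simps)
        have "t \<le> real (nat \<lceil>real m * t\<rceil>) / real m" unfolding r using c1 m0 by (simp add: le_divide_eq mult.commute)
        moreover have "real (nat \<lceil>real m * t\<rceil>) / real m \<le> T" unfolding r using c3 m0 by (simp add: divide_le_eq)
        moreover have "real (nat \<lceil>real m * t\<rceil>) / real m - t \<le> 1 / real m"
        proof -
          have "of_int \<lceil>real m * t\<rceil> / real m - t = (of_int \<lceil>real m * t\<rceil> - real m * t) / real m"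
            using m0 by (simp add: diff_divide_distrib)
          also have "\<dots> \<le> 1 / real m" using c1 by (intro divide_right_mono) auto
          finally show ?thesis unfolding r .
        qed
        ultimately show ?thesis using tu by (intro exI[of _ "nat \<lceil>real m * t\<rceil>"]) auto
      qed
      then obtain k where k: "a \<le> real k / real m" "real k / real m \<le> T" "\<bar>t - real k / real m\<bar> \<le> 1 / real m" by blast
      have u01: "0 \<le> u" "u \<le> 1" using tu U by auto
      let ?l = "nat \<lfloor>real k * u\<rfloor>"
      have "q (t, t * u) \<le> q (real k / real m, real ?l / real m) + e / 2"
      proof (rule close[OF k(3) _ m])
        have "t * u - real k * u / real m = (t - real k / real m) * u" by (simp add: left_diff_distrib)
        then have "\<bar>t * u - real k * u / real m\<bar> = \<bar>t - real k / real m\<bar> * u"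
          using u01 by (simp add: abs_mult)
        also have "\<dots> \<le> 1 / real m * 1" using k u01 by (intro mult_mono) auto
        finally show "\<bar>t * u - real ?l / real m\<bar> \<le> 2 / real m"
          using fl(1)[of u k] tu by (simp add: add_divide_distrib[symmetric] abs_le_iff)
        show "real ?l / real m \<in> {0..T}" using fl(2)[of u k] tu k by auto
        have "t * u \<le> t * 1" using u01 tu a by (intro mult_left_mono) auto
        then have "t * u \<le> T" using tu by linarith
        then show "t * u \<in> {0..T}" using u01 tu a by simp
      qed (use tu k in auto)
      also have "q (real k / real m, real ?l / real m) \<le> grid_sup \<rho> U a T m D"
        unfolding q_def fst_conv snd_conv using k tu
        by (intro grid_sup_upper[OF U a(1)]) (auto simp: floor_multiples_def)
      finally show "\<rho> t * \<bar>D t - D (t * u)\<bar> \<le> grid_sup \<rho> U a T m D + e / 2" by (simp add: q_def)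
    qed
    ultimately have "\<bar>grid_sup \<rho> U a T m D - path_sup \<rho> U a T D\<bar> \<le> e / 2" by linarith
    then show "norm (grid_sup \<rho> U a T m D - path_sup \<rho> U a T D) < e" using \<open>e > 0\<close> by simp
  qed
qed

section \<open>The path of the monitoring period as a functional\<close>

text \<open>Historic data occupy the rescaled times \<open>[0, 1]\<close>, so monitoring time
  \<open>s\<close> is path time \<open>1 + s\<close>. At the partial sum path this is the linear
  part of the Hoeffding decomposition of the scaled statistic; the historic sum enters through its
  final value, as a random slope.\<close>

definition monitor_path :: "(real \<Rightarrow> real \<times> real) \<Rightarrow> real \<Rightarrow> real" where
  "monitor_path y s = snd (y (1 + s)) - snd (y 1) + s * fst (y 1)"

lemma monitor_path_lipschitz:
  assumes "\<And>t. t \<in> {0..1 + T} \<Longrightarrow> dist (y t) (x t) \<le> d" "0 \<le> s" "s \<le> T"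
  shows "\<bar>monitor_path y s - monitor_path x s\<bar> \<le> (2 + T) * d"
proof -
  have *: "\<bar>snd (y t) - snd (x t)\<bar> \<le> d" "\<bar>fst (y t) - fst (x t)\<bar> \<le> d" if "t \<in> {0..1 + T}" for t
    using assms(1)[OF that] dist_snd_le[of "y t" "x t"] dist_fst_le[of "y t" "x t"] by (auto simp: dist_real_def)
  have "s * \<bar>fst (y 1) - fst (x 1)\<bar> \<le> T * d" using *[of 1] assms(2,3) by (intro mult_mono) auto
  moreover have "s * \<bar>fst (y 1) - fst (x 1)\<bar> = \<bar>s * fst (y 1) - s * fst (x 1)\<bar>"
    using assms(2) by (simp add: abs_mult right_diff_distrib[symmetric])
  ultimately show ?thesis
    using *(1)[of "1 + s"] *(1)[of 1] assms(2,3) unfolding monitor_path_def by (simp add: algebra_simps)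
qed

lemma monitor_path_continuous:
  assumes "continuous_on {0..1 + T} x"
  shows "continuous_on {0..T} (monitor_path x)"
  unfolding monitor_path_def
  by (intro continuous_intros continuous_on_compose2[OF assms]) auto

text \<open>Two effects are separated: the passage from \<open>y\<close> to \<open>x\<close> is
  Lipschitz uniformly in \<open>m\<close>, and for the fixed continuous \<open>x\<close> the grid
  becomes dense. In \<open>d\<close>, the factor \<open>2 * C\<close> comes from
  \<open>grid_sup_lipschitz\<close> and \<open>2 + T\<close> from
  \<open>monitor_path_lipschitz\<close>; together they leave \<open>e / 2\<close> for the first
  effect.\<close>

lemma grid_sup_continuous_mapping:
  assumes U: "U \<subseteq> {0..1}" and a: "0 < a" "a < T" and \<rho>: "continuous_on {0<..} \<rho>"
    and x: "continuous_on {0..1 + T} x" and "e > 0"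
  shows "\<exists>d>0. \<exists>J. \<forall>m\<ge>J. \<forall>y\<in>cadlag (1 + T). (\<forall>t\<in>{0..1 + T}. dist (y t) (x t) < d) \<longrightarrow>
     \<bar>grid_sup \<rho> U a T m (monitor_path y) - path_sup \<rho> U a T (monitor_path x)\<bar> < e"
proof -
  have "bounded (\<rho> ` {a..T})"
    using \<rho> a by (intro compact_imp_bounded compact_continuous_image) (auto intro: continuous_on_subset)
  then obtain C0 where "\<forall>x\<in>\<rho> ` {a..T}. \<bar>x\<bar> \<le> C0" unfolding bounded_real by blast
  then have C0: "\<And>t. a \<le> t \<Longrightarrow> t \<le> T \<Longrightarrow> \<bar>\<rho> t\<bar> \<le> C0" by auto
  define C where "C = max 1 C0"
  have C: "\<And>t. a \<le> t \<Longrightarrow> t \<le> T \<Longrightarrow> \<bar>\<rho> t\<bar> \<le> C" "0 < C" using C0 by (auto simp: C_def le_max_iff_disj)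
  define d where "d = e / (4 * C * (2 + T))"
  have "0 < T" using a by simp
  then have d: "d > 0" "2 * C * ((2 + T) * d) = e / 2" using \<open>e > 0\<close> C by (auto simp: d_def)
  have "\<forall>\<^sub>F m in sequentially. dist (grid_sup \<rho> U a T m (monitor_path x)) (path_sup \<rho> U a T (monitor_path x)) < e / 2"
    using \<open>e > 0\<close> by (intro tendstoD grid_sup_tendsto_path_sup[OF U a \<rho>] monitor_path_continuous x) auto
  then obtain J where J: "\<And>m. m \<ge> J \<Longrightarrow>
      \<bar>grid_sup \<rho> U a T m (monitor_path x) - path_sup \<rho> U a T (monitor_path x)\<bar> < e / 2"
    by (auto simp: eventually_sequentially dist_real_def)
  show ?thesis
  proof (intro exI[of _ d] exI[of _ J] conjI ballI allI impI d(1))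
    fix m y assume "J \<le> m" and y: "\<forall>t\<in>{0..1 + T}. dist (y t) (x t) < d"
    have "\<bar>grid_sup \<rho> U a T m (monitor_path y) - grid_sup \<rho> U a T m (monitor_path x)\<bar> \<le> 2 * C * ((2 + T) * d)"
    proof (rule grid_sup_lipschitz[OF U a(1) C(1)])
      show "\<bar>monitor_path y (real k / real m) - monitor_path x (real k / real m)\<bar> \<le> (2 + T) * d"
        if "real k / real m \<le> T" for k
        using y that by (intro monitor_path_lipschitz) (auto simp: less_imp_le)
    qed (use C d \<open>0 < T\<close> in auto)
    then show "\<bar>grid_sup \<rho> U a T m (monitor_path y) - path_sup \<rho> U a T (monitor_path x)\<bar> < e"
      using J[OF \<open>J \<le> m\<close>] d(2) by linarith
  qed
qed

section \<open>Wiener processes\<close>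

lemma wiener_processD:
  assumes "wiener_process P C Z"
  shows "prob_space P" "\<And>t. 0 \<le> t \<Longrightarrow> Z t \<in> borel_measurable P"
    "\<And>\<omega>. \<omega> \<in> space P \<Longrightarrow> Z 0 \<omega> = 0" "\<And>\<omega>. \<omega> \<in> space P \<Longrightarrow> continuous_on {0..} (\<lambda>t. Z t \<omega>)"
    "\<And>n t. 0 \<le> t 0 \<Longrightarrow> (\<And>i. i < n \<Longrightarrow> t i < t (Suc i)) \<Longrightarrow>
        prob_space.indep_vars P (\<lambda>_. borel) (\<lambda>i \<omega>. Z (t (Suc i)) \<omega> - Z (t i) \<omega>) {..<n}"
    "\<And>s t u. 0 \<le> s \<Longrightarrow> s < t \<Longrightarrow> (CLINT \<omega>|P. iexp (u \<bullet> (Z t \<omega> - Z s \<omega>))) =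
          complex_of_real (exp (- (t - s) * (u \<bullet> C u) / 2))"
  using assms unfolding wiener_process_def by blast+

lemma distr_eq_of_char:
  assumes "prob_space P" "prob_space N"
    and [measurable]: "\<xi> \<in> borel_measurable P" "\<eta> \<in> borel_measurable N"
    and eq: "\<And>v. (CLINT \<omega>|P. iexp (v * \<xi> \<omega>)) = (CLINT \<omega>|N. iexp (v * \<eta> \<omega>))"
  shows "distr P borel \<xi> = distr N borel \<eta>"
proof -
  have rd: "real_distribution (distr P borel \<xi>)" "real_distribution (distr N borel \<eta>)"
    using assms by (auto intro!: prob_space.real_distribution_distr)
  have "char (distr P borel \<xi>) v = char (distr N borel \<eta>) v" for v
  proof -
    have "char (distr P borel \<xi>) v = (CLINT \<omega>|P. iexp (v * \<xi> \<omega>))" by (simp add: char_def integral_distr)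
    also have "\<dots> = char (distr N borel \<eta>) v" unfolding eq by (simp add: char_def integral_distr)
    finally show ?thesis .
  qed
  then have "char (distr P borel \<xi>) = char (distr N borel \<eta>)" by (rule ext)
  then show ?thesis by (rule Levy_uniqueness[OF rd])
qed

text \<open>Rectangles generate the product sigma-algebra, so factorisation and equal marginals
  suffice. Independence is required as a product formula because the vector on \<open>N\<close> will
  be assembled from two independent processes and the increments of one of them.\<close>

lemma distr_vector_eq_of_product:
  fixes \<xi> :: "nat \<Rightarrow> 'p \<Rightarrow> real" and \<eta> :: "nat \<Rightarrow> 'b \<Rightarrow> real"
  assumes "prob_space P" "prob_space N"
    and [measurable]: "\<And>i. i < n \<Longrightarrow> \<xi> i \<in> borel_measurable P" "\<And>i. i < n \<Longrightarrow> \<eta> i \<in> borel_measurable N"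
    and P: "\<And>A. (\<And>i. i < n \<Longrightarrow> A i \<in> sets borel) \<Longrightarrow>
        measure P {\<omega>\<in>space P. \<forall>i<n. \<xi> i \<omega> \<in> A i} = (\<Prod>i<n. measure P {\<omega>\<in>space P. \<xi> i \<omega> \<in> A i})"
    and N: "\<And>A. (\<And>i. i < n \<Longrightarrow> A i \<in> sets borel) \<Longrightarrow>
        measure N {\<omega>\<in>space N. \<forall>i<n. \<eta> i \<omega> \<in> A i} = (\<Prod>i<n. measure N {\<omega>\<in>space N. \<eta> i \<omega> \<in> A i})"
    and eq: "\<And>i. i < n \<Longrightarrow> distr P borel (\<xi> i) = distr N borel (\<eta> i)"
  shows "distr P (Pi\<^sub>M {..<n} (\<lambda>_. borel)) (\<lambda>\<omega>. \<lambda>i\<in>{..<n}. \<xi> i \<omega>) =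
         distr N (Pi\<^sub>M {..<n} (\<lambda>_. borel)) (\<lambda>\<omega>. \<lambda>i\<in>{..<n}. \<eta> i \<omega>)"
proof -
  interpret P: prob_space P by fact
  interpret N: prob_space N by fact
  have mP[measurable]: "(\<lambda>\<omega>. \<lambda>i\<in>{..<n}. \<xi> i \<omega>) \<in> P \<rightarrow>\<^sub>M Pi\<^sub>M {..<n} (\<lambda>_. borel)"
    by (intro measurable_restrict) auto
  have mN[measurable]: "(\<lambda>\<omega>. \<lambda>i\<in>{..<n}. \<eta> i \<omega>) \<in> N \<rightarrow>\<^sub>M Pi\<^sub>M {..<n} (\<lambda>_. borel)"
    by (intro measurable_restrict) auto
  show ?thesis
  proof (rule measure_eqI_PiM_finite[where I = "{..<n}" and M = "\<lambda>_. borel" and A = "\<lambda>_. \<Pi>\<^sub>E i\<in>{..<n}. UNIV"])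
    show "emeasure (distr P (Pi\<^sub>M {..<n} (\<lambda>_. borel)) (\<lambda>\<omega>. \<lambda>i\<in>{..<n}. \<xi> i \<omega>)) (Pi\<^sub>E {..<n} A) =
          emeasure (distr N (Pi\<^sub>M {..<n} (\<lambda>_. borel)) (\<lambda>\<omega>. \<lambda>i\<in>{..<n}. \<eta> i \<omega>)) (Pi\<^sub>E {..<n} A)"
      if A: "\<And>i. i \<in> {..<n} \<Longrightarrow> A i \<in> sets borel" for A
    proof -
      have m: "Pi\<^sub>E {..<n} A \<in> sets (Pi\<^sub>M {..<n} (\<lambda>_. borel))" using A by (intro sets_PiM_I_finite) auto
      have "(\<lambda>\<omega>. \<lambda>i\<in>{..<n}. \<xi> i \<omega>) -` Pi\<^sub>E {..<n} A \<inter> space P = {\<omega>\<in>space P. \<forall>i<n. \<xi> i \<omega> \<in> A i}"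
        by (simp add: set_eq_iff restrict_PiE_iff) blast
      then have e1: "emeasure (distr P (Pi\<^sub>M {..<n} (\<lambda>_. borel)) (\<lambda>\<omega>. \<lambda>i\<in>{..<n}. \<xi> i \<omega>)) (Pi\<^sub>E {..<n} A)
          = ennreal (\<Prod>i<n. measure P {\<omega>\<in>space P. \<xi> i \<omega> \<in> A i})"
        using P[of A] A by (subst emeasure_distr[OF mP m]) (simp add: P.emeasure_eq_measure)
      have "(\<lambda>\<omega>. \<lambda>i\<in>{..<n}. \<eta> i \<omega>) -` Pi\<^sub>E {..<n} A \<inter> space N = {\<omega>\<in>space N. \<forall>i<n. \<eta> i \<omega> \<in> A i}"
        by (simp add: set_eq_iff restrict_PiE_iff) blast
      then have e2: "emeasure (distr N (Pi\<^sub>M {..<n} (\<lambda>_. borel)) (\<lambda>\<omega>. \<lambda>i\<in>{..<n}. \<eta> i \<omega>)) (Pi\<^sub>E {..<n} A)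
          = ennreal (\<Prod>i<n. measure N {\<omega>\<in>space N. \<eta> i \<omega> \<in> A i})"
        using N[of A] A by (subst emeasure_distr[OF mN m]) (simp add: N.emeasure_eq_measure)
      have "measure P {\<omega>\<in>space P. \<xi> i \<omega> \<in> A i} = measure N {\<omega>\<in>space N. \<eta> i \<omega> \<in> A i}" if "i < n" for i
      proof -
        have "measure (distr P borel (\<xi> i)) (A i) = measure (distr N borel (\<eta> i)) (A i)" using eq[OF that] by simp
        then show ?thesis using A that by (simp add: measure_distr vimage_def Int_def conj_commute)
      qed
      then show ?thesis unfolding e1 e2 by simp
    qed
    show "emeasure (distr P (Pi\<^sub>M {..<n} (\<lambda>_. borel)) (\<lambda>\<omega>. \<lambda>i\<in>{..<n}. \<xi> i \<omega>)) (\<Pi>\<^sub>E i\<in>{..<n}. UNIV) \<noteq> \<infinity>" for i :: nat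
      by (subst emeasure_distr) (auto simp: P.emeasure_eq_measure intro!: sets_PiM_I_finite)
  qed (auto simp: prod_algebra_eq_finite space_PiM intro!: image_eqI)
qed

lemma (in prob_space) indep_vars_prob_product:
  assumes "indep_vars (\<lambda>_. borel) \<xi> {..<n::nat}" "\<And>i. i < n \<Longrightarrow> A i \<in> sets borel"
  shows "prob {\<omega>\<in>space M. \<forall>i<n. \<xi> i \<omega> \<in> A i} = (\<Prod>i<n. prob {\<omega>\<in>space M. \<xi> i \<omega> \<in> A i})"
proof (cases "n = 0")
  case False
  then have ne: "{..<n} \<noteq> {}" by auto
  have "prob (\<Inter>i\<in>{..<n}. \<xi> i -` A i \<inter> space M) = (\<Prod>i<n. prob (\<xi> i -` A i \<inter> space M))"
    using assms ne by (intro indep_varsD_finite[where M' = "\<lambda>_. borel"]) auto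
  moreover have "(\<Inter>i\<in>{..<n}. \<xi> i -` A i \<inter> space M) = {\<omega>\<in>space M. \<forall>i<n. \<xi> i \<omega> \<in> A i}" using ne by auto
  moreover have "\<xi> i -` A i \<inter> space M = {\<omega>\<in>space M. \<xi> i \<omega> \<in> A i}" for i by auto
  ultimately show ?thesis by simp
qed (simp add: prob_space)

lemma grid_sup_cong:
  assumes "U \<subseteq> {0..1}" "\<And>k. real k / real m \<le> T \<Longrightarrow> D (real k / real m) = E (real k / real m)"
  shows "grid_sup \<rho> U a T m D = grid_sup \<rho> U a T m E"
proof -
  have "D (real l / real m) = E (real l / real m)" if "real k / real m \<le> T" "l \<in> floor_multiples U k" for k l
  proof (rule assms(2))
    have "real l / real m \<le> real k / real m"
      using floor_multiples_le[OF assms(1) that(2)] by (intro divide_right_mono) auto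
    with that(1) show "real l / real m \<le> T" by linarith
  qed
  then have "{\<rho> (real k / real m) * \<bar>D (real k / real m) - D (real l / real m)\<bar> | k l.
     a \<le> real k / real m \<and> real k / real m \<le> T \<and> l \<in> floor_multiples U k} =
    {\<rho> (real k / real m) * \<bar>E (real k / real m) - E (real l / real m)\<bar> | k l.
     a \<le> real k / real m \<and> real k / real m \<le> T \<and> l \<in> floor_multiples U k}"
    using assms(2) by (intro Collect_cong iff_exI) auto
  then show ?thesis unfolding grid_sup_def by simp
qed

text \<open>Pointwise convergence implies convergence in probability, by dominated convergence for
  the indicators of \<open>B m\<close>; the shift by \<open>e\<close> then replaces a choice of
  continuity points.\<close>

lemma (in prob_space) prob_le_of_tendsto:
  fixes f :: "nat \<Rightarrow> 'a \<Rightarrow> real"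
  assumes [measurable]: "\<And>m. f m \<in> borel_measurable M" "g \<in> borel_measurable M"
    and lim: "\<And>\<omega>. \<omega> \<in> space M \<Longrightarrow> (\<lambda>m. f m \<omega>) \<longlonglongrightarrow> g \<omega>" and "e > 0" "\<epsilon> > 0"
  shows "\<forall>\<^sub>F m in sequentially. prob {\<omega>\<in>space M. g \<omega> \<le> a} \<le> prob {\<omega>\<in>space M. f m \<omega> \<le> a + e} + \<epsilon>"
    and "\<forall>\<^sub>F m in sequentially. prob {\<omega>\<in>space M. f m \<omega> \<le> a} \<le> prob {\<omega>\<in>space M. g \<omega> \<le> a + e} + \<epsilon>"
proof -
  define B where "B = (\<lambda>m. {\<omega>\<in>space M. e < \<bar>f m \<omega> - g \<omega>\<bar>})"
  have [measurable]: "B m \<in> sets M" for m unfolding B_def by measurable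
  have "(\<lambda>m. LINT \<omega>|M. indicator (B m) \<omega> :: real) \<longlonglongrightarrow> (LINT \<omega>|M. 0)"
  proof (rule integral_dominated_convergence[where w = "\<lambda>_. 1"])
    show "AE \<omega> in M. (\<lambda>m. indicator (B m) \<omega> :: real) \<longlonglongrightarrow> 0"
    proof (rule AE_I2)
      fix \<omega> assume "\<omega> \<in> space M"
      then have "\<forall>\<^sub>F m in sequentially. dist (f m \<omega>) (g \<omega>) < e" using \<open>e > 0\<close> by (intro tendstoD lim)
      then have "\<forall>\<^sub>F m in sequentially. indicator (B m) \<omega> = (0::real)"
        by eventually_elim (auto simp: B_def dist_real_def indicator_def)
      then show "(\<lambda>m. indicator (B m) \<omega> :: real) \<longlonglongrightarrow> 0" by (rule tendsto_eventually)
    qed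
  qed (auto simp: indicator_def)
  then have "(\<lambda>m. prob (B m)) \<longlonglongrightarrow> 0" by simp
  then have small: "\<forall>\<^sub>F m in sequentially. prob (B m) < \<epsilon>" using \<open>\<epsilon> > 0\<close> by (intro order_tendstoD)
  have 1: "prob {\<omega>\<in>space M. g \<omega> \<le> a} \<le> prob {\<omega>\<in>space M. f m \<omega> \<le> a + e} + prob (B m)" for m
  proof -
    have "prob {\<omega>\<in>space M. g \<omega> \<le> a} \<le> prob ({\<omega>\<in>space M. f m \<omega> \<le> a + e} \<union> B m)"
      unfolding B_def by (intro finite_measure_mono) auto
    also have "\<dots> \<le> prob {\<omega>\<in>space M. f m \<omega> \<le> a + e} + prob (B m)" by (intro measure_Un_le) auto
    finally show ?thesis .
  qed
  have 2: "prob {\<omega>\<in>space M. f m \<omega> \<le> a} \<le> prob {\<omega>\<in>space M. g \<omega> \<le> a + e} + prob (B m)" for m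
  proof -
    have "prob {\<omega>\<in>space M. f m \<omega> \<le> a} \<le> prob ({\<omega>\<in>space M. g \<omega> \<le> a + e} \<union> B m)"
      unfolding B_def by (intro finite_measure_mono) auto
    also have "\<dots> \<le> prob {\<omega>\<in>space M. g \<omega> \<le> a + e} + prob (B m)" by (intro measure_Un_le) auto
    finally show ?thesis .
  qed
  show "\<forall>\<^sub>F m in sequentially. prob {\<omega>\<in>space M. g \<omega> \<le> a} \<le> prob {\<omega>\<in>space M. f m \<omega> \<le> a + e} + \<epsilon>"
    using small by eventually_elim (use 1 in \<open>smt (verit)\<close>)
  show "\<forall>\<^sub>F m in sequentially. prob {\<omega>\<in>space M. f m \<omega> \<le> a} \<le> prob {\<omega>\<in>space M. g \<omega> \<le> a + e} + \<epsilon>"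
    using small by eventually_elim (use 2 in \<open>smt (verit)\<close>)
qed

section \<open>Equality in law of the two descriptions of the limit\<close>

locale wiener_limits =
  fixes P :: "'p measure" and Z :: "real \<Rightarrow> 'p \<Rightarrow> real \<times> real" and c \<sigma>1 \<sigma>2 :: real
    and N :: "'b measure" and W1 W2 :: "real \<Rightarrow> 'b \<Rightarrow> real"
  assumes Z: "wiener_process P (\<lambda>(a, b). (\<sigma>1\<^sup>2 * a + c * b, c * a + \<sigma>2\<^sup>2 * b)) Z"
    and W1: "standard_wiener_process N W1" and W2: "standard_wiener_process N W2"
    and indep: "indep_processes N W1 W2"
begin

definition limit_path :: "'b \<Rightarrow> real \<Rightarrow> real" where
  "limit_path \<omega> t = \<sigma>2 * W2 t \<omega> + t * \<sigma>1 * W1 1 \<omega>"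

sublocale P: prob_space P using wiener_processD(1)[OF Z] .
sublocale N: prob_space N using wiener_processD(1)[OF W1] .

lemma measurable_Z [measurable (raw)]: "0 \<le> t \<Longrightarrow> Z t \<in> borel_measurable P"
  using wiener_processD(2)[OF Z] .

lemma measurable_W [measurable (raw)]:
  "0 \<le> t \<Longrightarrow> W1 t \<in> borel_measurable N" "0 \<le> t \<Longrightarrow> W2 t \<in> borel_measurable N"
  using wiener_processD(2)[OF W1] wiener_processD(2)[OF W2] by auto

lemma measurable_fst_snd_Z [measurable (raw)]:
  assumes "0 \<le> t"
  shows "(\<lambda>\<omega>. fst (Z t \<omega>)) \<in> borel_measurable P" "(\<lambda>\<omega>. snd (Z t \<omega>)) \<in> borel_measurable P"
  by (intro borel_measurable_continuous_on[OF _ measurable_Z[OF assms]] continuous_intros)+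

lemma continuous_Z: "\<omega> \<in> space P \<Longrightarrow> continuous_on {0..T} (\<lambda>t. Z t \<omega>)"
  by (rule continuous_on_subset[OF wiener_processD(4)[OF Z]]) auto

lemma continuous_limit_path: "\<omega> \<in> space N \<Longrightarrow> continuous_on {0..} (limit_path \<omega>)"
  unfolding limit_path_def using wiener_processD(4)[OF W2] by (intro continuous_intros) auto

lemma measurable_limit_path [measurable]: "0 \<le> t \<Longrightarrow> (\<lambda>\<omega>. limit_path \<omega> t) \<in> borel_measurable N"
  unfolding limit_path_def by measurable

lemma measurable_monitor_path: "0 \<le> t \<Longrightarrow> (\<lambda>\<omega>. monitor_path (\<lambda>t. Z t \<omega>) t) \<in> borel_measurable P"
  unfolding monitor_path_def by measurable

text \<open>On a grid both sides are the same function of finitely many independent centred Gaussian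
  variables. From \<open>Z\<close> one takes the first coordinate of the increment over
  \<open>[0, 1]\<close> and the second coordinate of the increments after time 1. Each time interval
  contributes a single coordinate, so the covariance \<open>c\<close> drops out.\<close>

lemma grid_sup_law:
  assumes U: "U \<subseteq> {0..1}" "0 < a" and "0 < m"
  shows "measure P {\<omega>\<in>space P. grid_sup \<rho> U a T m (monitor_path (\<lambda>t. Z t \<omega>)) \<le> x} =
         measure N {\<omega>\<in>space N. grid_sup \<rho> U a T m (limit_path \<omega>) \<le> x}"
proof -
  define n where "n = nat \<lfloor>T * real m\<rfloor>"
  \<comment> \<open>The times are 0, 1, 1 + 1/m, 1 + 2/m and so on. The first interval is the whole
    historic period: index 0 of \<open>\<xi>\<close> and \<open>\<eta>\<close> carries the slope,
    index \<open>i \<ge> 1\<close> the \<open>i\<close>-th monitoring increment.\<close>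
  define t where "t = (\<lambda>i. if i = 0 then 0 else 1 + (real i - 1) / real m)"
  define s where "s = (\<lambda>i. real i / real m)"
  have t_Suc: "t (Suc i) = 1 + s i" for i by (simp add: t_def s_def)
  have s_less: "s i < s (Suc i)" for i unfolding s_def using \<open>0 < m\<close> by (intro divide_strict_right_mono) auto
  have s_diff: "s (Suc i) - s i = 1 / real m" for i by (simp add: s_def add_divide_distrib)
  have s0: "0 \<le> s i" for i by (simp add: s_def)
  have t0: "0 \<le> t i" for i using s0 by (cases i) (auto simp: t_Suc, simp add: t_def)
  have t_less: "t i < t (Suc i)" for i
    by (cases i) (use s_less in \<open>auto simp: t_Suc\<close>, simp add: t_def s_def)
  define pr where "pr = (\<lambda>i::nat. if i = 0 then fst else snd :: real \<times> real \<Rightarrow> real)"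
  define \<xi> where "\<xi> = (\<lambda>i \<omega>. pr i (Z (t (Suc i)) \<omega> - Z (t i) \<omega>))"
  define \<eta> where "\<eta> = (\<lambda>i \<omega>. if i = 0 then \<sigma>1 * W1 1 \<omega> else \<sigma>2 * (W2 (s i) \<omega> - W2 (s (i - 1)) \<omega>))"
  have pr[measurable]: "pr i \<in> borel_measurable borel" for i
    unfolding pr_def by (auto intro!: borel_measurable_continuous_onI continuous_intros)
  have [measurable]: "Z (t i) \<in> borel_measurable P" for i by (rule measurable_Z[OF t0])
  have [measurable]: "W2 (s i) \<in> borel_measurable N" for i by (rule measurable_W(2)[OF s0])
  have [measurable]: "W1 1 \<in> borel_measurable N" by (rule measurable_W(1)) simp
  have [measurable]: "\<xi> i \<in> borel_measurable P" for i unfolding \<xi>_def by measurable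
  have [measurable]: "\<eta> i \<in> borel_measurable N" for i unfolding \<eta>_def by (cases "i = 0") auto
  have "P.indep_vars (\<lambda>_. borel) (\<lambda>i \<omega>. Z (t (Suc i)) \<omega> - Z (t i) \<omega>) {..<Suc n}"
    by (rule wiener_processD(5)[OF Z]) (auto simp: t0 t_less)
  then have "P.indep_vars (\<lambda>_. borel) \<xi> {..<Suc n}"
    unfolding \<xi>_def by (rule P.indep_vars_compose2) simp
  note P_prod = P.indep_vars_prob_product[OF this]
  have N_prod: "measure N {\<omega>\<in>space N. \<forall>i<Suc n. \<eta> i \<omega> \<in> A i} = (\<Prod>i<Suc n. measure N {\<omega>\<in>space N. \<eta> i \<omega> \<in> A i})"
    if A[measurable]: "\<And>i. i < Suc n \<Longrightarrow> A i \<in> sets borel" for A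
  proof -
    let ?\<Pi> = "Pi\<^sub>M {0::real..} (\<lambda>_. borel :: real measure)"
    have c: "(\<lambda>f. f r) \<in> borel_measurable ?\<Pi>" if "0 \<le> r" for r
      using that by (intro measurable_component_singleton) auto
    have [measurable]: "(\<lambda>f. f (s i)) \<in> borel_measurable ?\<Pi>" for i by (rule c[OF s0])
    have [measurable]: "(\<lambda>f. f 1) \<in> borel_measurable ?\<Pi>" by (rule c) simp
    have [measurable]: "A 0 \<in> sets borel" by (rule A) simp
    have [measurable]: "A (Suc i) \<in> sets borel" if "i \<in> {..<n}" for i using that by (intro A) simp
    \<comment> \<open>Independence of the processes concerns events in path space, so the conditions
      on the slope and on the increments are written as measurable sets depending on finitely many
      coordinates.\<close>
    define E where "E = {f\<in>space ?\<Pi>. \<sigma>1 * f 1 \<in> A 0}"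
    define F where "F = {f\<in>space ?\<Pi>. \<forall>i\<in>{..<n}. \<sigma>2 * (f (s (Suc i)) - f (s i)) \<in> A (Suc i)}"
    have E: "E \<in> sets ?\<Pi>" unfolding E_def by measurable
    have F: "F \<in> sets ?\<Pi>" unfolding F_def by measurable
    let ?V1 = "\<lambda>\<omega>. \<lambda>t\<in>{0::real..}. W1 t \<omega>" and ?V2 = "\<lambda>\<omega>. \<lambda>t\<in>{0::real..}. W2 t \<omega>"
    have sp: "?V1 \<omega> \<in> space ?\<Pi>" "?V2 \<omega> \<in> space ?\<Pi>" for \<omega> by (auto simp: space_PiM)
    have "N.prob ((\<lambda>\<omega>. (?V1 \<omega>, ?V2 \<omega>)) -` (E \<times> F) \<inter> space N) =
        N.prob (?V1 -` E \<inter> space N) * N.prob (?V2 -` F \<inter> space N)"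
      using indep unfolding indep_processes_def by (rule N.indep_varD[OF _ E F])
    also have "?V1 -` E \<inter> space N = {\<omega>\<in>space N. \<eta> 0 \<omega> \<in> A 0}"
      using sp by (auto simp: E_def \<eta>_def)
    also have VF: "?V2 -` F \<inter> space N = {\<omega>\<in>space N. \<forall>i<n. \<eta> (Suc i) \<omega> \<in> A (Suc i)}"
      using sp s0 by (auto simp: F_def \<eta>_def)
    also have "(\<lambda>\<omega>. (?V1 \<omega>, ?V2 \<omega>)) -` (E \<times> F) \<inter> space N = {\<omega>\<in>space N. \<forall>i<Suc n. \<eta> i \<omega> \<in> A i}"
      unfolding All_less_Suc2 using sp s0 by (auto simp: E_def F_def \<eta>_def)
    finally have 1: "N.prob {\<omega>\<in>space N. \<forall>i<Suc n. \<eta> i \<omega> \<in> A i} =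
       N.prob {\<omega>\<in>space N. \<eta> 0 \<omega> \<in> A 0} * N.prob {\<omega>\<in>space N. \<forall>i<n. \<eta> (Suc i) \<omega> \<in> A (Suc i)}" .
    have "N.indep_vars (\<lambda>_. borel) (\<lambda>i \<omega>. W2 (s (Suc i)) \<omega> - W2 (s i) \<omega>) {..<n}"
      by (rule wiener_processD(5)[OF W2]) (auto simp: s0 s_less)
    then have "N.indep_vars (\<lambda>_. borel) (\<lambda>i \<omega>. \<sigma>2 * (W2 (s (Suc i)) \<omega> - W2 (s i) \<omega>)) {..<n}"
      by (rule N.indep_vars_compose2) simp
    then have "N.indep_vars (\<lambda>_. borel) (\<lambda>i. \<eta> (Suc i)) {..<n}" by (simp add: \<eta>_def)
    then have 2: "N.prob {\<omega>\<in>space N. \<forall>i<n. \<eta> (Suc i) \<omega> \<in> A (Suc i)} =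
        (\<Prod>i<n. N.prob {\<omega>\<in>space N. \<eta> (Suc i) \<omega> \<in> A (Suc i)})"
      by (rule N.indep_vars_prob_product) (rule A, simp)
    show ?thesis unfolding 1 2 by (rule prod.lessThan_Suc_shift[symmetric])
  qed
  have marg: "distr P borel (\<xi> i) = distr N borel (\<eta> i)" for i
  proof (rule distr_eq_of_char)
    fix v :: real
    show "(CLINT \<omega>|P. iexp (v * \<xi> i \<omega>)) = (CLINT \<omega>|N. iexp (v * \<eta> i \<omega>))"
    proof (cases i)
      case 0
      \<comment> \<open>The test vectors \<open>(v, 0)\<close>, here, and \<open>(0, v)\<close>,
        below, read off the diagonal entries of the covariance matrix.\<close>
      have "(CLINT \<omega>|P. iexp (v * \<xi> i \<omega>)) = (CLINT \<omega>|P. iexp ((v, 0) \<bullet> (Z (t (Suc 0)) \<omega> - Z (t 0) \<omega>)))"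
        by (simp add: \<xi>_def pr_def 0 inner_prod_def)
      also have "\<dots> = complex_of_real (exp (- (v * \<sigma>1)\<^sup>2 / 2))"
        by (subst wiener_processD(6)[OF Z t0 t_less]) (simp add: t_def power2_eq_square mult_ac)
      also have "\<dots> = (CLINT \<omega>|N. iexp ((v * \<sigma>1) \<bullet> (W1 1 \<omega> - W1 0 \<omega>)))"
        by (subst wiener_processD(6)[OF W1]) (auto simp: power2_eq_square)
      also have "\<dots> = (CLINT \<omega>|N. iexp (v * \<eta> i \<omega>))"
        using wiener_processD(3)[OF W1] by (intro Bochner_Integration.integral_cong) (auto simp: \<eta>_def 0 mult.assoc)
      finally show ?thesis .
    next
      case (Suc j)
      have "(CLINT \<omega>|P. iexp (v * \<xi> i \<omega>)) = (CLINT \<omega>|P. iexp ((0, v) \<bullet> (Z (t (Suc i)) \<omega> - Z (t i) \<omega>)))"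
        by (simp add: \<xi>_def pr_def Suc inner_prod_def)
      also have "\<dots> = complex_of_real (exp (- (1 / real m) * (v * \<sigma>2)\<^sup>2 / 2))"
        by (subst wiener_processD(6)[OF Z t0 t_less])
           (simp add: Suc t_Suc power2_eq_square mult_ac s_def add_divide_distrib)
      also have "\<dots> = (CLINT \<omega>|N. iexp ((v * \<sigma>2) \<bullet> (W2 (s i) \<omega> - W2 (s j) \<omega>)))"
        by (subst wiener_processD(6)[OF W2 s0]) (auto simp: Suc s_less s_diff power2_eq_square)
      also have "\<dots> = (CLINT \<omega>|N. iexp (v * \<eta> i \<omega>))"
        by (intro Bochner_Integration.integral_cong) (auto simp: \<eta>_def Suc mult.assoc)
      finally show ?thesis .
    qed
  qed (auto intro: P.prob_space_axioms N.prob_space_axioms)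
  let ?I = "{..<Suc n}" and ?PI = "Pi\<^sub>M {..<Suc n} (\<lambda>_. borel :: real measure)"
  have law: "distr P ?PI (\<lambda>\<omega>. \<lambda>i\<in>?I. \<xi> i \<omega>) = distr N ?PI (\<lambda>\<omega>. \<lambda>i\<in>?I. \<eta> i \<omega>)"
    by (rule distr_vector_eq_of_product[OF P.prob_space_axioms N.prob_space_axioms _ _ P_prod N_prod marg]) auto
  \<comment> \<open>\<open>R\<close> rebuilds the path at grid points from the vector of increments.
    The minimum with \<open>n\<close> keeps all indices inside the finite product for every
    \<open>r\<close>; inside the window \<open>k \<le> n\<close>, so nothing is cut off
    there.\<close>
  define R where "R = (\<lambda>(f :: nat \<Rightarrow> real) r. (\<Sum>i=1..min n (nat \<lfloor>real m * r\<rfloor>). f i) + r * f 0)"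
  have R_meas: "(\<lambda>f. R f r) \<in> borel_measurable ?PI" for r
    unfolding R_def by (intro borel_measurable_add borel_measurable_sum borel_measurable_times
        borel_measurable_const measurable_component_singleton) auto
  have E[measurable]: "{f\<in>space ?PI. grid_sup \<rho> U a T m (R f) \<le> x} \<in> sets ?PI"
    using measurable_grid_sup[OF U, of R m ?PI \<rho> T] R_meas by (simp add: borel_measurable_iff_le)
  have k_le: "k \<le> n" if "real k / real m \<le> T" for k
  proof -
    have "real k \<le> T * real m" using that \<open>0 < m\<close> by (simp add: divide_le_eq)
    then show ?thesis unfolding n_def by linarith
  qed
  have fl: "nat \<lfloor>real m * (real k / real m)\<rfloor> = k" for k using \<open>0 < m\<close> by simp
  have R_k: "R (\<lambda>i\<in>?I. g i) (real k / real m) = (\<Sum>i=1..k. g i) + real k / real m * g 0"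
    if "real k / real m \<le> T" for k and g :: "nat \<Rightarrow> real"
    unfolding R_def fl using k_le[OF that] by (auto simp: min_absorb2 intro!: sum.cong)
  have tele1: "(\<Sum>i=1..k. \<xi> i \<omega>) = snd (Z (1 + s k) \<omega>) - snd (Z 1 \<omega>)" for k \<omega>
    by (induction k) (auto simp: \<xi>_def pr_def t_Suc s_def)
  have tele2: "(\<Sum>i=1..k. \<eta> i \<omega>) = \<sigma>2 * W2 (s k) \<omega>" if "\<omega> \<in> space N" for k \<omega>
    using wiener_processD(3)[OF W2 that] by (induction k) (auto simp: \<eta>_def s_def algebra_simps)
  have eqP: "grid_sup \<rho> U a T m (R (\<lambda>i\<in>?I. \<xi> i \<omega>)) = grid_sup \<rho> U a T m (monitor_path (\<lambda>t. Z t \<omega>))"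
    if "\<omega> \<in> space P" for \<omega>
  proof (rule grid_sup_cong[OF U(1)])
    fix k assume k: "real k / real m \<le> T"
    have "\<xi> 0 \<omega> = fst (Z 1 \<omega>)"
      using wiener_processD(3)[OF Z that] by (simp add: \<xi>_def pr_def t_def)
    then show "R (\<lambda>i\<in>?I. \<xi> i \<omega>) (real k / real m) = monitor_path (\<lambda>t. Z t \<omega>) (real k / real m)"
      unfolding R_k[OF k] tele1 monitor_path_def s_def by simp
  qed
  have eqN: "grid_sup \<rho> U a T m (R (\<lambda>i\<in>?I. \<eta> i \<omega>)) = grid_sup \<rho> U a T m (limit_path \<omega>)"
    if "\<omega> \<in> space N" for \<omega>
  proof (rule grid_sup_cong[OF U(1)])
    fix k assume k: "real k / real m \<le> T"
    show "R (\<lambda>i\<in>?I. \<eta> i \<omega>) (real k / real m) = limit_path \<omega> (real k / real m)"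
      unfolding R_k[OF k] tele2[OF that] limit_path_def s_def by (simp add: \<eta>_def)
  qed
  have "measure (distr P ?PI (\<lambda>\<omega>. \<lambda>i\<in>?I. \<xi> i \<omega>)) {f\<in>space ?PI. grid_sup \<rho> U a T m (R f) \<le> x} =
      measure P {\<omega>\<in>space P. grid_sup \<rho> U a T m (monitor_path (\<lambda>t. Z t \<omega>)) \<le> x}"
  proof (subst measure_distr[OF _ E])
    show "(\<lambda>\<omega>. \<lambda>i\<in>?I. \<xi> i \<omega>) \<in> P \<rightarrow>\<^sub>M ?PI" by (intro measurable_restrict) auto
    have "(\<lambda>\<omega>. \<lambda>i\<in>?I. \<xi> i \<omega>) -` {f \<in> space ?PI. grid_sup \<rho> U a T m (R f) \<le> x} \<inter> space P =
       {\<omega>\<in>space P. grid_sup \<rho> U a T m (monitor_path (\<lambda>t. Z t \<omega>)) \<le> x}"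
      using eqP by (auto simp: space_PiM)
    then show "P.prob ((\<lambda>\<omega>. \<lambda>i\<in>?I. \<xi> i \<omega>) -` {f \<in> space ?PI. grid_sup \<rho> U a T m (R f) \<le> x} \<inter> space P) =
       P.prob {\<omega>\<in>space P. grid_sup \<rho> U a T m (monitor_path (\<lambda>t. Z t \<omega>)) \<le> x}" by simp
  qed
  moreover have "measure (distr N ?PI (\<lambda>\<omega>. \<lambda>i\<in>?I. \<eta> i \<omega>)) {f\<in>space ?PI. grid_sup \<rho> U a T m (R f) \<le> x} =
      measure N {\<omega>\<in>space N. grid_sup \<rho> U a T m (limit_path \<omega>) \<le> x}"
  proof (subst measure_distr[OF _ E])
    show "(\<lambda>\<omega>. \<lambda>i\<in>?I. \<eta> i \<omega>) \<in> N \<rightarrow>\<^sub>M ?PI" by (intro measurable_restrict) auto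
    have "(\<lambda>\<omega>. \<lambda>i\<in>?I. \<eta> i \<omega>) -` {f \<in> space ?PI. grid_sup \<rho> U a T m (R f) \<le> x} \<inter> space N =
       {\<omega>\<in>space N. grid_sup \<rho> U a T m (limit_path \<omega>) \<le> x}"
      using eqN by (auto simp: space_PiM)
    then show "N.prob ((\<lambda>\<omega>. \<lambda>i\<in>?I. \<eta> i \<omega>) -` {f \<in> space ?PI. grid_sup \<rho> U a T m (R f) \<le> x} \<inter> space N) =
       N.prob {\<omega>\<in>space N. grid_sup \<rho> U a T m (limit_path \<omega>) \<le> x}" by simp
  qed
  ultimately show ?thesis using law by simp
qed

lemma measurable_grid_sup_Z:
  assumes "U \<subseteq> {0..1}" "0 < a"
  shows "(\<lambda>\<omega>. grid_sup \<rho> U a T m (monitor_path (\<lambda>t. Z t \<omega>))) \<in> borel_measurable P"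
  by (intro measurable_grid_sup[OF assms] measurable_monitor_path) simp

lemma measurable_grid_sup_limit:
  assumes "U \<subseteq> {0..1}" "0 < a"
  shows "(\<lambda>\<omega>. grid_sup \<rho> U a T m (limit_path \<omega>)) \<in> borel_measurable N"
  by (intro measurable_grid_sup[OF assms] measurable_limit_path) simp

context
  fixes \<rho> :: "real \<Rightarrow> real" and U :: "real set" and a T :: real
  assumes U: "U \<subseteq> {0..1}" and a: "0 < a" "a < T" and \<rho>: "continuous_on {0<..} \<rho>"
begin

lemma grid_sup_tendsto_Z:
  "\<omega> \<in> space P \<Longrightarrow> (\<lambda>m. grid_sup \<rho> U a T m (monitor_path (\<lambda>t. Z t \<omega>))) \<longlonglongrightarrow>
     path_sup \<rho> U a T (monitor_path (\<lambda>t. Z t \<omega>))"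
  by (intro grid_sup_tendsto_path_sup U a \<rho> monitor_path_continuous continuous_Z)

lemma grid_sup_tendsto_limit:
  "\<omega> \<in> space N \<Longrightarrow> (\<lambda>m. grid_sup \<rho> U a T m (limit_path \<omega>)) \<longlonglongrightarrow> path_sup \<rho> U a T (limit_path \<omega>)"
  by (intro grid_sup_tendsto_path_sup U a \<rho> continuous_on_subset[OF continuous_limit_path]) auto

lemma measurable_path_sup_Z:
  "(\<lambda>\<omega>. path_sup \<rho> U a T (monitor_path (\<lambda>t. Z t \<omega>))) \<in> borel_measurable P"
  by (rule borel_measurable_LIMSEQ_real[OF grid_sup_tendsto_Z measurable_grid_sup_Z[OF U a(1)]])

lemma measurable_path_sup_limit: "(\<lambda>\<omega>. path_sup \<rho> U a T (limit_path \<omega>)) \<in> borel_measurable N"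
  by (rule borel_measurable_LIMSEQ_real[OF grid_sup_tendsto_limit measurable_grid_sup_limit[OF U a(1)]])

text \<open>The grid functionals agree in law for every \<open>m > 0\<close>. Refining the grid on
  both probability spaces costs \<open>e / 2\<close> each time.\<close>

lemma path_sup_law_le:
  assumes "e > 0"
  shows "measure P {\<omega>\<in>space P. path_sup \<rho> U a T (monitor_path (\<lambda>t. Z t \<omega>)) \<le> x} \<le>
         measure N {\<omega>\<in>space N. path_sup \<rho> U a T (limit_path \<omega>) \<le> x + e}" (is "?P x \<le> ?N (x + e)")
    and "measure N {\<omega>\<in>space N. path_sup \<rho> U a T (limit_path \<omega>) \<le> x} \<le>
         measure P {\<omega>\<in>space P. path_sup \<rho> U a T (monitor_path (\<lambda>t. Z t \<omega>)) \<le> x + e}"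
proof -
  have e: "e / 2 > 0" "x + e / 2 + e / 2 = x + e" using assms by auto
  let ?GP = "\<lambda>m x. measure P {\<omega>\<in>space P. grid_sup \<rho> U a T m (monitor_path (\<lambda>t. Z t \<omega>)) \<le> x}"
  let ?GN = "\<lambda>m x. measure N {\<omega>\<in>space N. grid_sup \<rho> U a T m (limit_path \<omega>) \<le> x}"
  have law: "?GP m x = ?GN m x" if "0 < m" for m x using grid_sup_law[OF U a(1) that] .
  note P_rules = P.prob_le_of_tendsto[OF measurable_grid_sup_Z[OF U a(1)] measurable_path_sup_Z grid_sup_tendsto_Z e(1)]
  note N_rules = N.prob_le_of_tendsto[OF measurable_grid_sup_limit[OF U a(1)] measurable_path_sup_limit grid_sup_tendsto_limit e(1)]
  show "?P x \<le> ?N (x + e)"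
  proof (rule field_le_epsilon)
    fix \<epsilon> :: real assume "\<epsilon> > 0"
    then have \<epsilon>: "\<epsilon> / 2 > 0" by simp
    have "\<forall>\<^sub>F m in sequentially. ?P x \<le> ?GP m (x + e / 2) + \<epsilon> / 2" by (rule P_rules(1)[OF _ \<epsilon>])
    moreover have "\<forall>\<^sub>F m in sequentially. ?GN m (x + e / 2) \<le> ?N (x + e / 2 + e / 2) + \<epsilon> / 2"
      by (rule N_rules(2)[OF _ \<epsilon>])
    ultimately have "\<forall>\<^sub>F m in sequentially. ?P x \<le> ?N (x + e) + \<epsilon>"
      using eventually_gt_at_top[of 0] unfolding e(2)
    proof eventually_elim
      case (elim m)
      then show ?case using law[OF elim(3), of "x + e / 2"] by linarith
    qed
    then show "?P x \<le> ?N (x + e) + \<epsilon>" using eventually_happens by force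
  qed
  show "?N x \<le> ?P (x + e)"
  proof (rule field_le_epsilon)
    fix \<epsilon> :: real assume "\<epsilon> > 0"
    then have \<epsilon>: "\<epsilon> / 2 > 0" by simp
    have "\<forall>\<^sub>F m in sequentially. ?N x \<le> ?GN m (x + e / 2) + \<epsilon> / 2" by (rule N_rules(1)[OF _ \<epsilon>])
    moreover have "\<forall>\<^sub>F m in sequentially. ?GP m (x + e / 2) \<le> ?P (x + e / 2 + e / 2) + \<epsilon> / 2"
      by (rule P_rules(2)[OF _ \<epsilon>])
    ultimately have "\<forall>\<^sub>F m in sequentially. ?N x \<le> ?P (x + e) + \<epsilon>"
      using eventually_gt_at_top[of 0] unfolding e(2)
    proof eventually_elim
      case (elim m)
      then show ?case using law[OF elim(3), of "x + e / 2"] by linarith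
    qed
    then show "?N x \<le> ?P (x + e) + \<epsilon>" using eventually_happens by force
  qed
qed

end

end

section \<open>Limit behaviour of the partial sums\<close>

locale monitoring_data = wiener_limits P Z c \<sigma>1 \<sigma>2 N W1 W2
  for P :: "'p measure" and Z :: "real \<Rightarrow> 'p \<Rightarrow> real \<times> real" and c \<sigma>1 \<sigma>2 :: real
    and N :: "'b measure" and W1 W2 :: "real \<Rightarrow> 'b \<Rightarrow> real" +
  fixes M :: "'a measure" and Y :: "int \<Rightarrow> 'a \<Rightarrow> real" and h :: "real \<Rightarrow> real \<Rightarrow> real"
    and w :: "nat \<Rightarrow> nat \<Rightarrow> real" and \<rho> :: "real \<Rightarrow> real" and \<gamma> :: real
  assumes M: "prob_space M" and stationary: "stationary_series M Y"
    and h: "(\<lambda>(x, y). h x y) \<in> borel_measurable (borel \<Otimes>\<^sub>M borel)"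
    and weight: "weight_conditions w \<rho> \<gamma>"
    and remainder: "remainder_condition M Y h \<gamma>"
    and fclt: "fclt_condition M Y h \<sigma>1 \<sigma>2 c P Z"
    and early: "early_sum_condition M Y h"
    and late: "late_sum_condition M Y h"
begin

sublocale M: prob_space M by (rule M)

definition score1 :: "nat \<Rightarrow> 'a \<Rightarrow> real" where "score1 j \<omega> = hoeffding1 M Y h (Y (int j) \<omega>)"
definition score2 :: "nat \<Rightarrow> 'a \<Rightarrow> real" where "score2 j \<omega> = hoeffding2 M Y h (Y (int j) \<omega>)"

definition partial_path :: "nat \<Rightarrow> nat \<Rightarrow> 'a \<Rightarrow> real \<times> real" where
  "partial_path m k \<omega> = (1 / sqrt (real m)) *\<^sub>R (\<Sum>i=1..k. (score1 i \<omega>, score2 i \<omega>))"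

definition hist :: "nat \<Rightarrow> 'a \<Rightarrow> real" where
  "hist m \<omega> = 1 / sqrt (real m) * (\<Sum>i=1..m. score1 i \<omega>)"

definition monitored :: "nat \<Rightarrow> nat \<Rightarrow> 'a \<Rightarrow> real" where
  "monitored m k \<omega> = 1 / sqrt (real m) * (\<Sum>j=m+1..m+k. score2 j \<omega>)"

lemma measurable_Y [measurable]: "Y i \<in> borel_measurable M"
  using stationary by (simp add: stationary_series_def)

lemma measurable_hoeffding1 [measurable]: "hoeffding1 M Y h \<in> borel_measurable borel"
proof -
  have "(\<lambda>(x, \<omega>). (\<lambda>(x, y). h x y) (x, Y 1 \<omega>)) \<in> borel_measurable (borel \<Otimes>\<^sub>M M)"
    unfolding split_def by (rule measurable_compose[OF _ h[unfolded split_def]]) measurable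
  then have "(\<lambda>x. LINT \<omega>|M. h x (Y 1 \<omega>)) \<in> borel_measurable borel"
    by (intro M.borel_measurable_lebesgue_integral) simp
  then show ?thesis unfolding hoeffding1_def by measurable
qed

lemma measurable_hoeffding2 [measurable]: "hoeffding2 M Y h \<in> borel_measurable borel"
proof -
  have "(\<lambda>(x, \<omega>). (\<lambda>(x, y). h x y) (Y 1 \<omega>, x)) \<in> borel_measurable (borel \<Otimes>\<^sub>M M)"
    unfolding split_def by (rule measurable_compose[OF _ h[unfolded split_def]]) measurable
  then have "(\<lambda>x. LINT \<omega>|M. h (Y 1 \<omega>) x) \<in> borel_measurable borel"
    by (intro M.borel_measurable_lebesgue_integral) simp
  then show ?thesis unfolding hoeffding2_def by measurable
qed

lemma measurable_h [measurable]: "(\<lambda>\<omega>. h (Y i \<omega>) (Y j \<omega>)) \<in> borel_measurable M"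
  using measurable_compose[OF _ h, of "\<lambda>\<omega>. (Y i \<omega>, Y j \<omega>)" M] by simp

lemma measurable_scores [measurable]:
  "score1 j \<in> borel_measurable M" "score2 j \<in> borel_measurable M"
  unfolding score1_def score2_def by measurable

lemma measurable_hist [measurable]: "hist m \<in> borel_measurable M"
  unfolding hist_def by measurable

lemma measurable_monitored [measurable]: "monitored m k \<in> borel_measurable M"
  unfolding monitored_def by measurable

lemma partial_path_components:
  "fst (partial_path m k \<omega>) = 1 / sqrt (real m) * (\<Sum>i=1..k. score1 i \<omega>)"
  "snd (partial_path m k \<omega>) = 1 / sqrt (real m) * (\<Sum>i=1..k. score2 i \<omega>)"
  by (simp_all add: partial_path_def fst_sum snd_sum)

lemma measurable_partial_path [measurable]: "partial_path m k \<in> borel_measurable M"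
  unfolding partial_path_def by measurable

lemma monitor_path_partial_path:
  assumes "0 < m"
  shows "monitor_path (\<lambda>t. partial_path m (nat \<lfloor>real m * t\<rfloor>) \<omega>) (real k / real m) =
     monitored m k \<omega> + real k / real m * hist m \<omega>"
proof -
  have "real m * (1 + real k / real m) = real (m + k)" using assms by (simp add: field_simps)
  then have 1: "nat \<lfloor>real m * (1 + real k / real m)\<rfloor> = m + k" by simp
  have "(\<Sum>i=1..m+k. score2 i \<omega>) = (\<Sum>i=1..m. score2 i \<omega>) + (\<Sum>i=m+1..m+k. score2 i \<omega>)"
    by (rule sum.ub_add_nat) simp
  then show ?thesis
    unfolding monitor_path_def 1 partial_path_components monitored_def hist_def by (simp add: algebra_simps)
qed

lemma fclt_path:
  assumes "T > 0"
  shows "conv_in_distr_D T M (\<lambda>m t. partial_path m (nat \<lfloor>real m * t\<rfloor>)) P Z"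
  using fclt assms unfolding fclt_condition_def partial_path_def score1_def score2_def by simp

lemma fclt_mapping:
  fixes G :: "nat \<Rightarrow> (real \<Rightarrow> real \<times> real) \<Rightarrow> real"
  assumes "T > 0"
    and "\<And>m. (\<lambda>\<omega>. G m (\<lambda>t. partial_path m (nat \<lfloor>real m * t\<rfloor>) \<omega>)) \<in> borel_measurable M"
    and "(\<lambda>\<omega>. G0 (\<lambda>t. Z t \<omega>)) \<in> borel_measurable P"
    and "\<And>x e. continuous_on {0..T} x \<Longrightarrow> e > 0 \<Longrightarrow> \<exists>d>0. \<exists>J. \<forall>m\<ge>J. \<forall>y\<in>cadlag T.
        (\<forall>t\<in>{0..T}. dist (y t) (x t) < d) \<longrightarrow> \<bar>G m y - G0 x\<bar> < e"
    and "e > 0" "\<epsilon> > 0"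
  shows "\<forall>\<^sub>F m in sequentially. measure M {\<omega>\<in>space M. G m (\<lambda>t. partial_path m (nat \<lfloor>real m * t\<rfloor>) \<omega>) \<le> a}
           \<le> measure P {\<omega>\<in>space P. G0 (\<lambda>t. Z t \<omega>) \<le> a + e} + \<epsilon>"
    and "\<forall>\<^sub>F m in sequentially. measure P {\<omega>\<in>space P. G0 (\<lambda>t. Z t \<omega>) \<le> a}
           \<le> measure M {\<omega>\<in>space M. G m (\<lambda>t. partial_path m (nat \<lfloor>real m * t\<rfloor>) \<omega>) \<le> a + e} + \<epsilon>"
proof -
  have T: "0 \<le> T" using assms(1) by simp
  have cad: "(\<lambda>t. partial_path m (nat \<lfloor>real m * t\<rfloor>) \<omega>) \<in> cadlag T" for m \<omega>
    by (rule step_cadlag[where v = "\<lambda>k. partial_path m k \<omega>"])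
  have measX: "(\<lambda>\<omega>. g (\<lambda>t. partial_path m (nat \<lfloor>real m * t\<rfloor>) \<omega>)) \<in> borel_measurable M"
    if "skorokhod_continuous T g" for g m
    by (rule measurable_skorokhod_step[OF that T measurable_partial_path])
  have measZ: "(\<lambda>\<omega>. g (\<lambda>t. Z t \<omega>)) \<in> borel_measurable P" if "skorokhod_continuous T g" for g
    by (rule measurable_skorokhod_continuous_path[OF that T measurable_Z continuous_Z])
  note main = skorokhod_mapping_prob[OF M P.prob_space_axioms T fclt_path[OF assms(1)] cad continuous_Z measX measZ assms(2-6)]
  show "\<forall>\<^sub>F m in sequentially. measure M {\<omega>\<in>space M. G m (\<lambda>t. partial_path m (nat \<lfloor>real m * t\<rfloor>) \<omega>) \<le> a}
           \<le> measure P {\<omega>\<in>space P. G0 (\<lambda>t. Z t \<omega>) \<le> a + e} + \<epsilon>" by (rule main(1))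
  show "\<forall>\<^sub>F m in sequentially. measure P {\<omega>\<in>space P. G0 (\<lambda>t. Z t \<omega>) \<le> a}
           \<le> measure M {\<omega>\<in>space M. G m (\<lambda>t. partial_path m (nat \<lfloor>real m * t\<rfloor>) \<omega>) \<le> a + e} + \<epsilon>" by (rule main(2))
qed

lemma continuous_\<rho>: "continuous_on {0<..} \<rho>"
  using weight by (simp add: weight_conditions_def)

definition grid_stat :: "real set \<Rightarrow> real \<Rightarrow> real \<Rightarrow> nat \<Rightarrow> 'a \<Rightarrow> real" where
  "grid_stat U a T m \<omega> = grid_sup \<rho> U a T m (monitor_path (\<lambda>t. partial_path m (nat \<lfloor>real m * t\<rfloor>) \<omega>))"

lemma measurable_grid_stat:
  assumes "U \<subseteq> {0..1}" "0 < a"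
  shows "grid_stat U a T m \<in> borel_measurable M"
proof -
  have "(\<lambda>\<omega>. monitor_path (\<lambda>t. partial_path m (nat \<lfloor>real m * t\<rfloor>) \<omega>) s) \<in> borel_measurable M" for s
    unfolding monitor_path_def partial_path_components by measurable
  then show ?thesis unfolding grid_stat_def by (rule measurable_grid_sup[OF assms])
qed

lemma grid_stat_limit:
  assumes U: "U \<subseteq> {0..1}" and a: "0 < a" "a < T" and "e > 0" "\<epsilon> > 0"
  shows "\<forall>\<^sub>F m in sequentially. measure M {\<omega>\<in>space M. grid_stat U a T m \<omega> \<le> x} \<le>
       measure N {\<omega>\<in>space N. path_sup \<rho> U a T (limit_path \<omega>) \<le> x + e} + \<epsilon>"
    and "\<forall>\<^sub>F m in sequentially. measure N {\<omega>\<in>space N. path_sup \<rho> U a T (limit_path \<omega>) \<le> x} \<le>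
       measure M {\<omega>\<in>space M. grid_stat U a T m \<omega> \<le> x + e} + \<epsilon>"
proof -
  have T: "0 < 1 + T" using a by simp
  have e: "e / 2 > 0" "x + e / 2 + e / 2 = x + e" using \<open>e > 0\<close> by auto
  note main = fclt_mapping[where G = "\<lambda>m y. grid_sup \<rho> U a T m (monitor_path y)"
      and ?G0.0 = "\<lambda>y. path_sup \<rho> U a T (monitor_path y)",
      OF T measurable_grid_stat[OF U a(1), unfolded grid_stat_def]
      measurable_path_sup_Z[OF U a continuous_\<rho>]
      grid_sup_continuous_mapping[OF U a continuous_\<rho>] e(1) \<open>\<epsilon> > 0\<close>, folded grid_stat_def]
  note law = path_sup_law_le[OF U a continuous_\<rho> e(1)]
  show "\<forall>\<^sub>F m in sequentially. measure M {\<omega>\<in>space M. grid_stat U a T m \<omega> \<le> x} \<le>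
       measure N {\<omega>\<in>space N. path_sup \<rho> U a T (limit_path \<omega>) \<le> x + e} + \<epsilon>"
    using main(1)[of x] law(1)[of "x + e / 2"] unfolding e(2) by (auto elim: eventually_mono)
  show "\<forall>\<^sub>F m in sequentially. measure N {\<omega>\<in>space N. path_sup \<rho> U a T (limit_path \<omega>) \<le> x} \<le>
       measure M {\<omega>\<in>space M. grid_stat U a T m \<omega> \<le> x + e} + \<epsilon>"
    using main(2)[of "x + e / 2"] law(2)[of x] unfolding e(2) by (auto elim: eventually_mono)
qed

section \<open>Tightness of the historic sum and bounds for the monitored sums\<close>

text \<open>The mapping theorem is applied to \<open>\<bar>fst (y 1)\<bar>\<close> on
  \<open>[0, 1]\<close>. Its limit is real-valued, hence below some \<open>i\<close> with high
  probability; the additional 1 is the shift in the comparison of laws.\<close>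

lemma hist_tight:
  assumes "\<epsilon> > 0"
  shows "\<exists>K>0. \<forall>\<^sub>F m in sequentially. measure M {\<omega>\<in>space M. K < \<bar>hist m \<omega>\<bar>} \<le> \<epsilon>"
proof -
  have \<epsilon>: "\<epsilon> / 2 > 0" using assms by simp
  have [measurable]: "(\<lambda>\<omega>. fst (Z 1 \<omega>)) \<in> borel_measurable P" by (rule measurable_fst_snd_Z) simp
  have "(\<lambda>i. measure P {\<omega>\<in>space P. \<bar>fst (Z 1 \<omega>)\<bar> \<le> real i}) \<longlonglongrightarrow>
      measure P (\<Union>i. {\<omega>\<in>space P. \<bar>fst (Z 1 \<omega>)\<bar> \<le> real i})"
    by (intro P.finite_Lim_measure_incseq) (auto simp: incseq_def)
  also have "(\<Union>i. {\<omega>\<in>space P. \<bar>fst (Z 1 \<omega>)\<bar> \<le> real i}) = space P" using real_arch_simple by auto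
  finally have "(\<lambda>i. measure P {\<omega>\<in>space P. \<bar>fst (Z 1 \<omega>)\<bar> \<le> real i}) \<longlonglongrightarrow> 1" by (simp add: P.prob_space)
  then have "\<forall>\<^sub>F i in sequentially. 1 - \<epsilon> / 2 < measure P {\<omega>\<in>space P. \<bar>fst (Z 1 \<omega>)\<bar> \<le> real i}"
    using \<epsilon> by (intro order_tendstoD) auto
  then obtain i where i: "1 - \<epsilon> / 2 < measure P {\<omega>\<in>space P. \<bar>fst (Z 1 \<omega>)\<bar> \<le> real i}"
    by (auto simp: eventually_sequentially)
  have "\<forall>\<^sub>F m in sequentially. measure P {\<omega>\<in>space P. \<bar>fst (Z 1 \<omega>)\<bar> \<le> real i} \<le>
      measure M {\<omega>\<in>space M. \<bar>fst (partial_path m (nat \<lfloor>real m * 1\<rfloor>) \<omega>)\<bar> \<le> real i + 1} + \<epsilon> / 2"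
  proof (rule fclt_mapping(2)[where T = 1 and G = "\<lambda>m y. \<bar>fst (y 1)\<bar>" and ?G0.0 = "\<lambda>y. \<bar>fst (y 1)\<bar>"])
    show "\<exists>d>0. \<exists>J. \<forall>m\<ge>J. \<forall>y\<in>cadlag 1. (\<forall>t\<in>{0..1}. dist (y t) (x t) < d) \<longrightarrow> \<bar>\<bar>fst (y 1)\<bar> - \<bar>fst (x 1)\<bar>\<bar> < e"
      if "e > 0" for x :: "real \<Rightarrow> real \<times> real" and e
    proof -
      have "\<bar>\<bar>fst (y 1)\<bar> - \<bar>fst (x 1)\<bar>\<bar> < e" if "\<forall>t\<in>{0..1}. dist (y t) (x t) < e"
        for y :: "real \<Rightarrow> real \<times> real"
      proof -
        have "dist (y 1) (x 1) < e" using that by simp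
        then have "\<bar>fst (y 1) - fst (x 1)\<bar> < e"
          using dist_fst_le[of "y 1" "x 1"] by (simp add: dist_real_def)
        then show ?thesis by linarith
      qed
      then show ?thesis using \<open>e > 0\<close> by blast
    qed
  qed (use \<epsilon> in \<open>auto simp: partial_path_components\<close>)
  then have "\<forall>\<^sub>F m in sequentially. measure M {\<omega>\<in>space M. real i + 1 < \<bar>hist m \<omega>\<bar>} \<le> \<epsilon>"
  proof eventually_elim
    case (elim m)
    have "fst (partial_path m (nat \<lfloor>real m * 1\<rfloor>) \<omega>) = hist m \<omega>" for \<omega>
      by (simp add: partial_path_components hist_def)
    with elim i have "1 - \<epsilon> \<le> measure M {\<omega>\<in>space M. \<bar>hist m \<omega>\<bar> \<le> real i + 1}" by simp
    also have "\<dots> = 1 - measure M {\<omega>\<in>space M. \<not> \<bar>hist m \<omega>\<bar> \<le> real i + 1}"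
      by (subst M.prob_neg) auto
    finally show ?case by (simp add: not_le)
  qed
  then show ?thesis by (intro exI[of _ "real i + 1"]) auto
qed

text \<open>Stationarity moves the sums that start at \<open>m + 1\<close> to sums that start at 1,
  about which the early and late sum conditions speak. The joint law of all partial sums is needed,
  since the events of interest involve all lengths \<open>l\<close> at once.\<close>

lemma monitored_shift:
  assumes E: "E \<in> sets (Pi\<^sub>M UNIV (\<lambda>_::nat. borel :: real measure))"
  shows "measure M {\<omega>\<in>space M. (\<lambda>l. \<Sum>j=m+1..m+l. score2 j \<omega>) \<in> E} =
         measure M {\<omega>\<in>space M. (\<lambda>l. \<Sum>j=1..l. score2 j \<omega>) \<in> E}"
proof -
  let ?I = "Pi\<^sub>M UNIV (\<lambda>_::int. borel :: real measure)"
  define \<phi> where "\<phi> = (\<lambda>(y::int \<Rightarrow> real) l. \<Sum>j=1..l. hoeffding2 M Y h (y (int j)))"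
  have c[measurable]: "(\<lambda>y. y i) \<in> borel_measurable ?I" for i by (rule measurable_component_singleton) simp
  have "\<phi> \<in> ?I \<rightarrow>\<^sub>M Pi\<^sub>M UNIV (\<lambda>_::nat. borel)"
    unfolding \<phi>_def by (rule measurable_abs_UNIV) measurable
  then have E': "\<phi> -` E \<inter> space ?I \<in> sets ?I" using E by (rule measurable_sets)
  have Ym: "(\<lambda>\<omega> i. Y (i + s) \<omega>) \<in> M \<rightarrow>\<^sub>M ?I" for s by (rule measurable_abs_UNIV) simp
  have eq: "measure M {\<omega>\<in>space M. \<phi> (\<lambda>i. Y (i + s) \<omega>) \<in> E} =
      measure (distr M ?I (\<lambda>\<omega> i. Y (i + s) \<omega>)) (\<phi> -` E \<inter> space ?I)" for s
    by (subst measure_distr[OF Ym E']) (auto simp: space_PiM intro!: arg_cong[where f = "measure M"])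
  have s: "\<phi> (\<lambda>i. Y (i + int m) \<omega>) = (\<lambda>l. \<Sum>j=m+1..m+l. score2 j \<omega>)" for \<omega>
  proof
    fix l
    have "(\<Sum>j=m+1..m+l. score2 j \<omega>) = (\<Sum>j=1+m..l+m. score2 j \<omega>)" by (simp add: add.commute)
    also have "\<dots> = (\<Sum>j=1..l. score2 (j + m) \<omega>)" by (rule sum.shift_bounds_cl_nat_ivl)
    finally show "\<phi> (\<lambda>i. Y (i + int m) \<omega>) l = (\<Sum>j=m+1..m+l. score2 j \<omega>)"
      by (simp add: \<phi>_def score2_def)
  qed
  have s0: "\<phi> (\<lambda>i. Y (i + 0) \<omega>) = (\<lambda>l. \<Sum>j=1..l. score2 j \<omega>)" for \<omega>
    by (simp add: \<phi>_def score2_def)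
  have "distr M ?I (\<lambda>\<omega> i. Y (i + int m) \<omega>) = distr M ?I (\<lambda>\<omega> i. Y (i + 0) \<omega>)"
    using stationary by (simp add: stationary_series_def)
  then show ?thesis using eq[of "int m"] eq[of 0] unfolding s s0 by simp
qed

text \<open>Dividing by \<open>m powr (1 / 2 - \<alpha>) * l powr \<alpha>\<close> is the same as
  dividing by \<open>sqrt m * (l / m) powr \<alpha>\<close>. The early sum condition thus becomes a
  power envelope in \<open>l / m\<close>, valid for all \<open>l \<le> m\<close> simultaneously;
  with \<open>\<alpha> > \<gamma>\<close> it will beat the weight near 0.\<close>

lemma monitored_early:
  assumes "0 \<le> \<alpha>" "\<alpha> < 1 / 2" "\<epsilon> > 0"
  shows "\<exists>K>0. \<forall>\<^sub>F m in sequentially. measure M {\<omega>\<in>space M. \<exists>l\<in>{1..m}.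
     K * (real l / real m) powr \<alpha> < 1 / sqrt (real m) * \<bar>\<Sum>j=1..l. score2 j \<omega>\<bar>} \<le> \<epsilon>"
proof -
  have "bigO_prob M (\<lambda>m \<omega>. SUP k\<in>{1..m}. ereal (1 / (real m powr (1 / 2 - \<alpha>) * real k powr \<alpha>) *
             \<bar>\<Sum>j=1..k. score2 j \<omega>\<bar>)) (\<lambda>_. 1)"
    using early assms unfolding early_sum_condition_def score2_def by blast
  then obtain C where C: "\<forall>\<^sub>F m in sequentially. measure M {\<omega>\<in>space M. ereal (C * 1) <
     (SUP k\<in>{1..m}. ereal (1 / (real m powr (1 / 2 - \<alpha>) * real k powr \<alpha>) * \<bar>\<Sum>j=1..k. score2 j \<omega>\<bar>))} \<le> \<epsilon>"
    using assms(3) unfolding bigO_prob_def by blast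
  show ?thesis
  proof (intro exI[of _ "max 1 C"] conjI)
    show "\<forall>\<^sub>F m in sequentially. measure M {\<omega>\<in>space M. \<exists>l\<in>{1..m}.
     max 1 C * (real l / real m) powr \<alpha> < 1 / sqrt (real m) * \<bar>\<Sum>j=1..l. score2 j \<omega>\<bar>} \<le> \<epsilon>"
      using C eventually_gt_at_top[of 0]
    proof eventually_elim
      case (elim m)
      have "measure M {\<omega>\<in>space M. \<exists>l\<in>{1..m}.
          max 1 C * (real l / real m) powr \<alpha> < 1 / sqrt (real m) * \<bar>\<Sum>j=1..l. score2 j \<omega>\<bar>} \<le>
        measure M {\<omega>\<in>space M. ereal (C * 1) <
          (SUP k\<in>{1..m}. ereal (1 / (real m powr (1 / 2 - \<alpha>) * real k powr \<alpha>) * \<bar>\<Sum>j=1..k. score2 j \<omega>\<bar>))}"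
      proof (intro M.finite_measure_mono subsetI)
        fix \<omega> assume "\<omega> \<in> {\<omega>\<in>space M. \<exists>l\<in>{1..m}.
          max 1 C * (real l / real m) powr \<alpha> < 1 / sqrt (real m) * \<bar>\<Sum>j=1..l. score2 j \<omega>\<bar>}"
        then obtain l where l: "\<omega> \<in> space M" "1 \<le> l" "l \<le> m"
          "max 1 C * (real l / real m) powr \<alpha> < 1 / sqrt (real m) * \<bar>\<Sum>j=1..l. score2 j \<omega>\<bar>" by auto
        define s where "s = \<bar>\<Sum>j=1..l. score2 j \<omega>\<bar>"
        have p: "0 < real m powr \<alpha>" "0 < real l powr \<alpha>" "0 < sqrt (real m)" using l by auto
        have "real m powr (1 / 2 - \<alpha>) = sqrt (real m) / real m powr \<alpha>"
          using l by (simp add: powr_diff powr_half_sqrt)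
        then have e: "1 / (real m powr (1 / 2 - \<alpha>) * real l powr \<alpha>) * s =
            1 / sqrt (real m) * s / (real l / real m) powr \<alpha>"
          using p by (simp add: powr_divide)
        have "0 < (real l / real m) powr \<alpha>" using p l by (simp add: powr_divide)
        then have "max 1 C < 1 / sqrt (real m) * s / (real l / real m) powr \<alpha>"
          using l(4) unfolding s_def[symmetric] by (simp only: pos_less_divide_eq)
        then have "ereal (C * 1) < ereal (1 / (real m powr (1 / 2 - \<alpha>) * real l powr \<alpha>) * s)"
          unfolding e by simp
        also have "\<dots> \<le> (SUP k\<in>{1..m}. ereal (1 / (real m powr (1 / 2 - \<alpha>) * real k powr \<alpha>) * \<bar>\<Sum>j=1..k. score2 j \<omega>\<bar>))"
          unfolding s_def by (rule SUP_upper) (use l in auto)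
        finally show "\<omega> \<in> {\<omega>\<in>space M. ereal (C * 1) <
          (SUP k\<in>{1..m}. ereal (1 / (real m powr (1 / 2 - \<alpha>) * real k powr \<alpha>) * \<bar>\<Sum>j=1..k. score2 j \<omega>\<bar>))}"
          using l(1) by blast
      qed measurable
      then show ?case using elim(1) by linarith
    qed
  qed simp
qed

text \<open>Applying the late sum condition to a sequence of worst cases makes its constant independent
  of the sequence.\<close>

lemma late_uniform:
  assumes "\<epsilon> > 0"
  shows "\<exists>K>0. \<exists>Q. \<forall>\<kappa>\<ge>Q. \<kappa> > 0 \<longrightarrow> measure M {\<omega>\<in>space M. \<exists>k. \<kappa> \<le> real k \<and>
     K / sqrt \<kappa> < 1 / real k * \<bar>\<Sum>j=1..k. score2 j \<omega>\<bar>} \<le> \<epsilon>"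
proof (rule ccontr)
  define p where "p = (\<lambda>\<kappa> K. measure M {\<omega>\<in>space M. \<exists>k. \<kappa> \<le> real k \<and>
     K / sqrt \<kappa> < 1 / real k * \<bar>\<Sum>j=1..k. score2 j \<omega>\<bar>})"
  assume "\<not> ?thesis"
  then have "\<forall>K>0. \<forall>Q. \<exists>\<kappa>\<ge>Q. \<kappa> > 0 \<and> \<epsilon> < p \<kappa> K" unfolding p_def by (auto simp: not_le)
  then have "\<forall>n::nat. \<exists>\<kappa>. \<kappa> \<ge> real n \<and> \<kappa> > 0 \<and> \<epsilon> < p \<kappa> (real n + 1)"
    by (metis of_nat_0_le_iff add_nonneg_pos zero_less_one)
  then obtain \<kappa> where \<kappa>: "\<And>n::nat. \<kappa> n \<ge> real n" "\<And>n. \<kappa> n > 0" "\<And>n. \<epsilon> < p (\<kappa> n) (real n + 1)" by metis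
  have "filterlim \<kappa> at_top sequentially"
    by (rule filterlim_at_top_mono[OF filterlim_real_sequentially]) (simp add: \<kappa>)
  then have "bigO_prob M (\<lambda>m \<omega>. SUP k\<in>{k. \<kappa> m \<le> real k}. ereal (1 / real k * \<bar>\<Sum>j=1..k. score2 j \<omega>\<bar>))
      (\<lambda>m. 1 / sqrt (\<kappa> m))"
    using late \<kappa>(2) unfolding late_sum_condition_def score2_def by blast
  then obtain C where C: "\<forall>\<^sub>F m in sequentially. measure M {\<omega>\<in>space M. ereal (C * (1 / sqrt (\<kappa> m))) <
     (SUP k\<in>{k. \<kappa> m \<le> real k}. ereal (1 / real k * \<bar>\<Sum>j=1..k. score2 j \<omega>\<bar>))} \<le> \<epsilon>"
    using assms unfolding bigO_prob_def by blast
  have "\<forall>\<^sub>F m in sequentially. C \<le> real m"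
    using filterlim_real_sequentially by (simp add: filterlim_at_top)
  with C have "\<forall>\<^sub>F m in sequentially. False"
  proof eventually_elim
    case (elim m)
    have "p (\<kappa> m) (real m + 1) \<le> measure M {\<omega>\<in>space M. ereal (C * (1 / sqrt (\<kappa> m))) <
     (SUP k\<in>{k. \<kappa> m \<le> real k}. ereal (1 / real k * \<bar>\<Sum>j=1..k. score2 j \<omega>\<bar>))}"
      unfolding p_def
    proof (intro M.finite_measure_mono subsetI)
      fix \<omega> assume "\<omega> \<in> {\<omega>\<in>space M. \<exists>k. \<kappa> m \<le> real k \<and>
        (real m + 1) / sqrt (\<kappa> m) < 1 / real k * \<bar>\<Sum>j=1..k. score2 j \<omega>\<bar>}"
      then obtain k where k: "\<omega> \<in> space M" "\<kappa> m \<le> real k"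
        "(real m + 1) / sqrt (\<kappa> m) < 1 / real k * \<bar>\<Sum>j=1..k. score2 j \<omega>\<bar>" by auto
      have "C * (1 / sqrt (\<kappa> m)) \<le> (real m + 1) / sqrt (\<kappa> m)"
        using elim(2) \<kappa>(2)[of m] by (simp add: divide_right_mono)
      with k(3) have "ereal (C * (1 / sqrt (\<kappa> m))) < ereal (1 / real k * \<bar>\<Sum>j=1..k. score2 j \<omega>\<bar>)"
        unfolding less_ereal.simps by (rule le_less_trans[rotated])
      also have "\<dots> \<le> (SUP k\<in>{k. \<kappa> m \<le> real k}. ereal (1 / real k * \<bar>\<Sum>j=1..k. score2 j \<omega>\<bar>))"
        by (rule SUP_upper) (use k in auto)
      finally show "\<omega> \<in> {\<omega>\<in>space M. ereal (C * (1 / sqrt (\<kappa> m))) <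
     (SUP k\<in>{k. \<kappa> m \<le> real k}. ereal (1 / real k * \<bar>\<Sum>j=1..k. score2 j \<omega>\<bar>))}"
        using k(1) by blast
    qed measurable
    then show False using elim(1) \<kappa>(3)[of m] by linarith
  qed
  then show False by simp
qed

text \<open>The index \<open>l\<close> is split at \<open>s * m\<close>. Up to there the early sum
  condition with exponent 0, at sample size \<open>s * m\<close>, bounds the scaled sum by
  \<open>K1 * sqrt s\<close>, which is covered since \<open>k / m \<ge> s\<close>. Beyond,
  \<open>late_uniform\<close> at \<open>\<kappa> = s * m\<close> gives
  \<open>K2 * (l / m) / sqrt s\<close>. Because \<open>K\<close> precedes \<open>s\<close>, the
  factor \<open>1 / sqrt s\<close> can later be made small.\<close>

lemma monitored_late:
  assumes "\<epsilon> > 0"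
  shows "\<exists>K>0. \<forall>s\<ge>1. \<forall>\<^sub>F m in sequentially. measure M {\<omega>\<in>space M. \<exists>k. s\<^sup>2 * m \<le> k \<and> (\<exists>l\<le>k.
     K * (real k / real m) / sqrt (real s) < 1 / sqrt (real m) * \<bar>\<Sum>j=1..l. score2 j \<omega>\<bar>)} \<le> \<epsilon>"
proof -
  have \<epsilon>: "\<epsilon> / 2 > 0" using assms by simp
  obtain K1 where K1: "K1 > 0" "\<forall>\<^sub>F m in sequentially. measure M {\<omega>\<in>space M. \<exists>l\<in>{1..m}.
     K1 * (real l / real m) powr 0 < 1 / sqrt (real m) * \<bar>\<Sum>j=1..l. score2 j \<omega>\<bar>} \<le> \<epsilon> / 2"
    using monitored_early[of 0, OF _ _ \<epsilon>] by auto
  obtain K2 Q where K2: "K2 > 0" "\<And>\<kappa>. \<kappa> \<ge> Q \<Longrightarrow> \<kappa> > 0 \<Longrightarrow> measure M {\<omega>\<in>space M. \<exists>k. \<kappa> \<le> real k \<and>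
     K2 / sqrt \<kappa> < 1 / real k * \<bar>\<Sum>j=1..k. score2 j \<omega>\<bar>} \<le> \<epsilon> / 2"
    using late_uniform[OF \<epsilon>] by blast
  define K where "K = max K1 K2"
  show ?thesis
  proof (intro exI[of _ K] conjI allI impI)
    show "K > 0" using K1 by (simp add: K_def)
    fix s :: nat assume s: "1 \<le> s"
    have lim: "filterlim (\<lambda>m. s * m) at_top sequentially"
      using s by (intro filterlim_subseq) (auto simp: strict_mono_def)
    have ev1: "\<forall>\<^sub>F m in sequentially. measure M {\<omega>\<in>space M. \<exists>l\<in>{1..s * m}.
     K1 * (real l / real (s * m)) powr 0 < 1 / sqrt (real (s * m)) * \<bar>\<Sum>j=1..l. score2 j \<omega>\<bar>} \<le> \<epsilon> / 2"
      using eventually_compose_filterlim[OF K1(2) lim] .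
    have "filterlim (\<lambda>m. real (s * m)) at_top sequentially"
      by (rule filterlim_compose[OF filterlim_real_sequentially lim])
    then have ev2: "\<forall>\<^sub>F m in sequentially. Q \<le> real (s * m)" by (simp add: filterlim_at_top)
    show "\<forall>\<^sub>F m in sequentially. measure M {\<omega>\<in>space M. \<exists>k. s\<^sup>2 * m \<le> k \<and> (\<exists>l\<le>k.
     K * (real k / real m) / sqrt (real s) < 1 / sqrt (real m) * \<bar>\<Sum>j=1..l. score2 j \<omega>\<bar>)} \<le> \<epsilon>"
      using ev1 ev2 eventually_gt_at_top[of 0]
    proof eventually_elim
      case (elim m)
      have sm: "0 < real (s * m)" using elim(3) s by simp
      let ?A = "{\<omega>\<in>space M. \<exists>l\<in>{1..s * m}.
        K1 * (real l / real (s * m)) powr 0 < 1 / sqrt (real (s * m)) * \<bar>\<Sum>j=1..l. score2 j \<omega>\<bar>}"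
      let ?B = "{\<omega>\<in>space M. \<exists>k. real (s * m) \<le> real k \<and>
        K2 / sqrt (real (s * m)) < 1 / real k * \<bar>\<Sum>j=1..k. score2 j \<omega>\<bar>}"
      have "measure M {\<omega>\<in>space M. \<exists>k. s\<^sup>2 * m \<le> k \<and> (\<exists>l\<le>k.
        K * (real k / real m) / sqrt (real s) < 1 / sqrt (real m) * \<bar>\<Sum>j=1..l. score2 j \<omega>\<bar>)} \<le> measure M (?A \<union> ?B)"
      proof (intro M.finite_measure_mono subsetI)
        fix \<omega> assume "\<omega> \<in> {\<omega>\<in>space M. \<exists>k. s\<^sup>2 * m \<le> k \<and> (\<exists>l\<le>k.
          K * (real k / real m) / sqrt (real s) < 1 / sqrt (real m) * \<bar>\<Sum>j=1..l. score2 j \<omega>\<bar>)}"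
        then obtain k l where kl: "\<omega> \<in> space M" "s\<^sup>2 * m \<le> k" "l \<le> k"
          "K * (real k / real m) / sqrt (real s) < 1 / sqrt (real m) * \<bar>\<Sum>j=1..l. score2 j \<omega>\<bar>" by auto
        define S where "S = \<bar>\<Sum>j=1..l. score2 j \<omega>\<bar>"
        have pos: "0 < sqrt (real m)" "0 < sqrt (real s)" "0 < real m" "0 < real s" using elim(3) s by auto
        have K0: "0 < K" "K1 \<le> K" "K2 \<le> K" using K1 by (auto simp: K_def)
        have S: "K * (real k / real m) / sqrt (real s) < S / sqrt (real m)" using kl(4) by (simp add: S_def)
        have km: "(real s)\<^sup>2 \<le> real k / real m"
        proof -
          have "real (s\<^sup>2 * m) \<le> real k" using kl(2) by (rule of_nat_mono)
          then show ?thesis using pos by (simp add: le_divide_eq)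
        qed
        \<comment> \<open>Index 0 lies outside the range of the first event, and
          \<open>0 powr 0\<close> is 0, so that the factor with exponent 0 equals 1 only for
          positive \<open>l\<close>.\<close>
        have l0: "l \<noteq> 0"
        proof
          assume "l = 0"
          then have "K * (real k / real m) / sqrt (real s) < 0" using S by (simp add: S_def)
          moreover have "0 \<le> K * (real k / real m) / sqrt (real s)" using K0 by simp
          ultimately show False by simp
        qed
        show "\<omega> \<in> ?A \<union> ?B"
        proof (cases "l \<le> s * m")
          case True
          have "real s * 1 \<le> real s * real s" using s by (intro mult_left_mono) auto
          then have "real s \<le> real k / real m" using km by (simp add: power2_eq_square)
          then have "K1 * real s \<le> K * (real k / real m)" using K0 K1(1) by (intro mult_mono) auto
          then have "K1 * sqrt (real s) * sqrt (real s) \<le> K * (real k / real m)" by (simp add: mult.assoc)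
          then have "K1 * sqrt (real s) \<le> K * (real k / real m) / sqrt (real s)"
            by (simp only: pos_le_divide_eq[OF pos(2)])
          with S have "K1 * sqrt (real s) < S / sqrt (real m)" by linarith
          then have "K1 < S / sqrt (real m) / sqrt (real s)" by (simp only: pos_less_divide_eq[OF pos(2)])
          then have "K1 * (real l / real (s * m)) powr 0 < 1 / sqrt (real (s * m)) * S"
            using l0 pos by (simp add: real_sqrt_mult mult.commute)
          then show ?thesis using True l0 kl(1) unfolding S_def by auto
        next
          case False
          have "real l / real m \<le> real k / real m" using kl(3) by (intro divide_right_mono) auto
          then have "K2 * (real l / real m) \<le> K * (real k / real m)" using K0 K2(1) by (intro mult_mono) auto
          then have "K2 * (real l / real m) / sqrt (real s) \<le> K * (real k / real m) / sqrt (real s)"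
            by (intro divide_right_mono) auto
          with S have "K2 * (real l / real m) / sqrt (real s) < S / sqrt (real m)" by linarith
          then have "K2 * real l * sqrt (real m) < S * sqrt (real s) * real m"
            using pos by (simp add: field_simps)
          also have "\<dots> = S * sqrt (real s) * sqrt (real m) * sqrt (real m)" by simp
          finally have "K2 * real l < S * sqrt (real s) * sqrt (real m)"
            using pos by (simp add: mult_less_cancel_right)
          then have "K2 / sqrt (real (s * m)) < 1 / real l * S"
            using pos l0 by (simp add: real_sqrt_mult field_simps)
          moreover have "real (s * m) \<le> real l" using False by (intro of_nat_mono) simp
          ultimately show ?thesis using kl(1) unfolding S_def by blast
        qed
      qed measurable
      also have "\<dots> \<le> measure M ?A + measure M ?B" by (rule measure_Un_le) measurable
      also have "\<dots> \<le> \<epsilon> / 2 + \<epsilon> / 2" by (intro add_mono elim(1) K2(2) elim(2) sm)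
      finally show ?case by simp
    qed
  qed
qed

lemma prob_monitored_early:
  assumes "0 \<le> \<alpha>" "\<alpha> < 1 / 2" "\<epsilon> > 0"
  shows "\<exists>K>0. \<forall>\<^sub>F m in sequentially. measure M {\<omega>\<in>space M. \<exists>l\<in>{1..m}.
     K * (real l / real m) powr \<alpha> < \<bar>monitored m l \<omega>\<bar>} \<le> \<epsilon>"
proof -
  have "measure M {\<omega>\<in>space M. \<exists>l\<in>{1..m}. K * (real l / real m) powr \<alpha> < \<bar>monitored m l \<omega>\<bar>} =
     measure M {\<omega>\<in>space M. \<exists>l\<in>{1..m}. K * (real l / real m) powr \<alpha> < 1 / sqrt (real m) * \<bar>\<Sum>j=1..l. score2 j \<omega>\<bar>}"
    for K m
  proof -
    let ?E = "{f\<in>space (Pi\<^sub>M UNIV (\<lambda>_::nat. borel :: real measure)).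
        \<exists>l\<in>{1..m}. K * (real l / real m) powr \<alpha> < 1 / sqrt (real m) * \<bar>f l\<bar>}"
    have [measurable]: "(\<lambda>f. f i) \<in> borel_measurable (Pi\<^sub>M UNIV (\<lambda>_::nat. borel :: real measure))" for i
      by (rule measurable_component_singleton) simp
    have "?E \<in> sets (Pi\<^sub>M UNIV (\<lambda>_::nat. borel))" by measurable
    from monitored_shift[OF this, of m] show ?thesis
      by (simp add: space_PiM monitored_def abs_mult)
  qed
  then show ?thesis using monitored_early[OF assms] by simp
qed

lemma prob_monitored_late:
  assumes "\<epsilon> > 0"
  shows "\<exists>K>0. \<forall>s\<ge>1. \<forall>\<^sub>F m in sequentially. measure M {\<omega>\<in>space M. \<exists>k. s\<^sup>2 * m \<le> k \<and> (\<exists>l\<le>k.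
     K * (real k / real m) / sqrt (real s) < \<bar>monitored m l \<omega>\<bar>)} \<le> \<epsilon>"
proof -
  have "measure M {\<omega>\<in>space M. \<exists>k. s\<^sup>2 * m \<le> k \<and> (\<exists>l\<le>k. K * (real k / real m) / sqrt (real s) < \<bar>monitored m l \<omega>\<bar>)} =
     measure M {\<omega>\<in>space M. \<exists>k. s\<^sup>2 * m \<le> k \<and> (\<exists>l\<le>k.
       K * (real k / real m) / sqrt (real s) < 1 / sqrt (real m) * \<bar>\<Sum>j=1..l. score2 j \<omega>\<bar>)}"
    for K m and s :: nat
  proof -
    let ?E = "{f\<in>space (Pi\<^sub>M UNIV (\<lambda>_::nat. borel :: real measure)).
        \<exists>k. s\<^sup>2 * m \<le> k \<and> (\<exists>l\<le>k. K * (real k / real m) / sqrt (real s) < 1 / sqrt (real m) * \<bar>f l\<bar>)}"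
    have [measurable]: "(\<lambda>f. f i) \<in> borel_measurable (Pi\<^sub>M UNIV (\<lambda>_::nat. borel :: real measure))" for i
      by (rule measurable_component_singleton) simp
    have "?E \<in> sets (Pi\<^sub>M UNIV (\<lambda>_::nat. borel))" by measurable
    from monitored_shift[OF this, of m] show ?thesis
      by (simp add: space_PiM monitored_def abs_mult)
  qed
  then show ?thesis using monitored_late[OF assms] by simp
qed

end

section \<open>Convergence of the monitoring statistics\<close>

text \<open>The deterministic core, to be used on an event of high probability: \<open>A\<close> is
  the slope, \<open>B\<close> the monitored sum, \<open>H\<close> bounds the window. The four error
  terms come from times below \<open>1 / s\<close>, from the oscillation of
  \<open>t * \<rho> t\<close> beyond \<open>s\<^sup>2\<close>, from the rounding of
  \<open>l\<close>, and from the fluctuation of \<open>B\<close> beyond the window; all become small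
  for large \<open>s\<close>.\<close>

lemma weighted_increment_bound:
  fixes \<rho> :: "real \<Rightarrow> real" and B :: "nat \<Rightarrow> real" and A :: real and m s :: nat
  assumes m: "1 \<le> m" and s: "2 \<le> s" and U: "U \<subseteq> {0..1}"
    and u0: "0 \<le> u0" "\<And>u. u \<in> U \<Longrightarrow> u0 \<le> u" "\<And>k. 1 \<le> k \<Longrightarrow> nat \<lfloor>real k * u0\<rfloor> \<in> floor_multiples U k"
    and \<rho>: "\<And>t. 0 < t \<Longrightarrow> 0 < \<rho> t"
    and C: "C > 0" "\<And>t. 0 < t \<Longrightarrow> t \<le> 2 \<Longrightarrow> \<rho> t \<le> C * t powr (- \<gamma>)" "\<And>t. t \<ge> 1 \<Longrightarrow> \<rho> t \<le> C / t"
    and \<alpha>: "\<gamma> < \<alpha>" "\<alpha> < 1"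
    and A: "\<bar>A\<bar> \<le> K1" and B0: "B 0 = 0" and K2: "0 \<le> K2"
    and B1: "\<And>l. 1 \<le> l \<Longrightarrow> l \<le> m \<Longrightarrow> \<bar>B l\<bar> \<le> K2 * (real l / real m) powr \<alpha>" and "0 \<le> \<alpha>"
    and B2: "\<And>k l. s\<^sup>2 * m \<le> k \<Longrightarrow> l \<le> k \<Longrightarrow> \<bar>B l\<bar> \<le> K3 * (real k / real m) / sqrt (real s)" and K3: "0 \<le> K3"
    and osc: "\<And>t. (real s)\<^sup>2 \<le> t \<Longrightarrow> \<bar>t * \<rho> t - (real s)\<^sup>2 * \<rho> ((real s)\<^sup>2)\<bar> \<le> \<delta>"
    and H: "\<And>k l. 1 / real s \<le> real k / real m \<Longrightarrow> real k / real m \<le> (real s)\<^sup>2 \<Longrightarrow> l \<in> floor_multiples U k \<Longrightarrow>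
      \<rho> (real k / real m) * \<bar>(B k + real k / real m * A) - (B l + real l / real m * A)\<bar> \<le> H" and "0 \<le> H"
    and k: "1 \<le> k" and l: "l \<in> floor_multiples U k"
  shows "\<rho> (real k / real m) * \<bar>(B k + real k / real m * A) - (B l + real l / real m * A)\<bar> \<le>
    H + (C * (K1 + 2 * K2) * (1 / real s) powr (\<alpha> - \<gamma>) + \<delta> * K1 + C * K1 / real s + 8 * K3 * C / sqrt (real s))"
proof -
  have mp: "0 < real m" and sp: "0 < real s" "1 \<le> real s" using m s by auto
  have K1: "0 \<le> K1" using A by linarith
  have \<delta>: "0 \<le> \<delta>" using osc[of "(real s)\<^sup>2"] by simp
  define \<tau> where "\<tau> = real k / real m"
  have \<tau>: "0 < \<tau>" using k mp by (simp add: \<tau>_def)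
  have \<rho>\<tau>: "0 \<le> \<rho> \<tau>" using \<rho>[OF \<tau>] by simp
  have lk: "l \<le> k" using floor_multiples_le[OF U l] .
  have E1: "0 \<le> C * (K1 + 2 * K2) * (1 / real s) powr (\<alpha> - \<gamma>)" using C(1) K1 K2 by simp
  have E2: "0 \<le> \<delta> * K1" using \<delta> K1 by simp
  have E3: "0 \<le> C * K1 / real s" using C(1) K1 by simp
  have E4: "0 \<le> 8 * K3 * C / sqrt (real s)" using C(1) K3 by simp
  have diff: "(B k + real k / real m * A) - (B l + real l / real m * A) = B k - B l + (real k - real l) / real m * A"
    by (simp add: diff_divide_distrib algebra_simps)
  have incr: "\<bar>(real k - real l) / real m * A\<bar> = (real k - real l) / real m * \<bar>A\<bar>"
    using lk by (simp add: abs_mult abs_divide)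
  have upper: "\<bar>x - y + z\<bar> \<le> r + 2 * q" if "\<bar>x\<bar> \<le> q" "\<bar>y\<bar> \<le> q" "\<bar>z\<bar> \<le> r" for x y z q r :: real
    using that by linarith
  have lower: "r - 2 * q \<le> \<bar>x - y + z\<bar>" if "\<bar>x\<bar> \<le> q" "\<bar>y\<bar> \<le> q" "r \<le> \<bar>z\<bar>" for x y z q r :: real
    using that by linarith
  consider "\<tau> < 1 / real s" | "1 / real s \<le> \<tau>" "\<tau> \<le> (real s)\<^sup>2" | "(real s)\<^sup>2 < \<tau>" by linarith
  then show ?thesis
  proof cases
    case 1
    have "1 / real s \<le> 1" using sp by simp
    then have \<tau>1: "\<tau> < 1" using 1 by linarith
    then have km: "k \<le> m" using mp by (simp add: \<tau>_def divide_less_eq)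
    have Bj: "\<bar>B j\<bar> \<le> K2 * \<tau> powr \<alpha>" if "j \<le> k" for j
    proof (cases "j = 0")
      case False
      then have "\<bar>B j\<bar> \<le> K2 * (real j / real m) powr \<alpha>" using that km by (intro B1) auto
      also have "\<dots> \<le> K2 * \<tau> powr \<alpha>"
        unfolding \<tau>_def using that K2 \<open>0 \<le> \<alpha>\<close> mp by (intro mult_left_mono powr_mono2 divide_right_mono) auto
      finally show ?thesis .
    qed (use B0 K2 in simp)
    have "(real k - real l) / real m \<le> \<tau>" unfolding \<tau>_def by (intro divide_right_mono) auto
    then have "(real k - real l) / real m * \<bar>A\<bar> \<le> \<tau> * K1" using A \<tau> by (intro mult_mono) auto
    then have "\<bar>(B k + real k / real m * A) - (B l + real l / real m * A)\<bar> \<le> \<tau> * K1 + 2 * (K2 * \<tau> powr \<alpha>)"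
      unfolding diff incr[symmetric] by (rule upper[OF Bj[OF order_refl] Bj[OF lk]])
    then have "\<rho> \<tau> * \<bar>(B k + real k / real m * A) - (B l + real l / real m * A)\<bar> \<le>
        (C * \<tau> powr (- \<gamma>)) * (\<tau> * K1 + 2 * (K2 * \<tau> powr \<alpha>))"
      using C(2)[OF \<tau>] \<tau>1 C(1) by (intro mult_mono) auto
    also have "\<dots> = C * (K1 * \<tau> powr (1 - \<gamma>) + 2 * K2 * \<tau> powr (\<alpha> - \<gamma>))"
    proof -
      have "\<tau> powr (- \<gamma>) * \<tau> = \<tau> powr (1 - \<gamma>)" "\<tau> powr (- \<gamma>) * \<tau> powr \<alpha> = \<tau> powr (\<alpha> - \<gamma>)"
        using \<tau> by (simp_all add: powr_mult_base powr_add[symmetric] mult.commute)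
      then show ?thesis by (simp add: algebra_simps)
    qed
    \<comment> \<open>For \<open>\<tau> < 1\<close> the smaller exponent gives the larger power, so
      both terms are dominated by the positive exponent \<open>\<alpha> - \<gamma>\<close>.\<close>
    also have "\<dots> \<le> C * (K1 * (1 / real s) powr (\<alpha> - \<gamma>) + 2 * K2 * (1 / real s) powr (\<alpha> - \<gamma>))"
    proof -
      have "\<tau> powr (\<alpha> - \<gamma>) \<le> (1 / real s) powr (\<alpha> - \<gamma>)" using \<tau> 1 \<alpha> by (intro powr_mono2) auto
      moreover have "\<tau> powr (1 - \<gamma>) \<le> \<tau> powr (\<alpha> - \<gamma>)" using \<tau> \<tau>1 \<alpha> by (intro powr_mono') auto
      ultimately show ?thesis using C(1) K1 K2 by (intro mult_left_mono add_mono) auto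
    qed
    finally show ?thesis using E2 E3 E4 \<open>0 \<le> H\<close> unfolding \<tau>_def by (simp add: algebra_simps)
  next
    case 2
    then show ?thesis using H[of k l] l E1 E2 E3 E4 unfolding \<tau>_def by linarith
  next
    case 3
    have "real (s\<^sup>2 * m) < real k" using 3 mp unfolding \<tau>_def by (simp add: less_divide_eq)
    then have ks: "s\<^sup>2 * m \<le> k" by linarith
    have s2: "1 \<le> (real s)\<^sup>2" "real s \<le> (real s)\<^sup>2" using sp by (simp_all add: one_le_power self_le_power)
    have \<tau>1: "1 \<le> \<tau>" using s2 3 by linarith
    have \<tau>\<rho>: "\<tau> * \<rho> \<tau> \<le> C" using C(3)[OF \<tau>1] \<tau> by (simp add: le_divide_eq mult.commute)
    have T\<rho>: "(real s)\<^sup>2 * \<rho> ((real s)\<^sup>2) \<le> C" using C(3)[OF s2(1)] sp by (simp add: le_divide_eq mult.commute)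
    have T\<rho>0: "0 \<le> \<rho> ((real s)\<^sup>2)" using \<rho>[of "(real s)\<^sup>2"] sp by simp
    define b where "b = K3 / sqrt (real s)"
    have Bj: "\<bar>B j\<bar> \<le> \<tau> * b" if "j \<le> k" for j using B2[OF ks that] by (simp add: \<tau>_def b_def mult.commute)
    obtain u where u: "u \<in> U" "l = nat \<lfloor>real k * u\<rfloor>" using l by (auto simp: floor_multiples_def)
    \<comment> \<open>The increment from \<open>l\<close> to \<open>k\<close> is longest when
      \<open>u\<close> is smallest. Rounding lengthens it by at most 1, which yields the term
      \<open>C * K1 / s\<close>.\<close>
    have "real k * u0 \<le> real k * u" using u0(2)[OF u(1)] by (intro mult_left_mono) auto
    then have "real k - real l \<le> real k * (1 - u0) + 1" unfolding u(2) by (simp add: algebra_simps) linarith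
    then have "(real k - real l) / real m \<le> (real k * (1 - u0) + 1) / real m" using mp by (intro divide_right_mono) auto
    also have "\<dots> = \<tau> * (1 - u0) + 1 / real m" by (simp add: \<tau>_def add_divide_distrib)
    finally have "(real k - real l) / real m * \<bar>A\<bar> \<le> (\<tau> * (1 - u0) + 1 / real m) * \<bar>A\<bar>" by (intro mult_right_mono) auto
    then have "\<bar>(B k + real k / real m * A) - (B l + real l / real m * A)\<bar> \<le>
        (\<tau> * (1 - u0) + 1 / real m) * \<bar>A\<bar> + 2 * (\<tau> * b)"
      unfolding diff incr[symmetric] by (rule upper[OF Bj[OF order_refl] Bj[OF lk]])
    then have "\<rho> \<tau> * \<bar>(B k + real k / real m * A) - (B l + real l / real m * A)\<bar> \<le>
        \<rho> \<tau> * ((\<tau> * (1 - u0) + 1 / real m) * \<bar>A\<bar> + 2 * (\<tau> * b))"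
      using \<rho>\<tau> by (intro mult_left_mono) auto
    also have "\<dots> = (\<tau> * \<rho> \<tau>) * (1 - u0) * \<bar>A\<bar> + \<rho> \<tau> * (1 / real m) * \<bar>A\<bar> + 2 * ((\<tau> * \<rho> \<tau>) * b)"
      by (simp add: algebra_simps)
    finally have tail: "\<rho> \<tau> * \<bar>(B k + real k / real m * A) - (B l + real l / real m * A)\<bar> \<le>
        (\<tau> * \<rho> \<tau>) * (1 - u0) * \<bar>A\<bar> + \<rho> \<tau> * (1 / real m) * \<bar>A\<bar> + 2 * ((\<tau> * \<rho> \<tau>) * b)" .
    have b0: "0 \<le> b" using K3 by (simp add: b_def)
    have t2: "2 * ((\<tau> * \<rho> \<tau>) * b) \<le> 2 * (C * b)" using \<tau>\<rho> b0 by (intro mult_left_mono mult_right_mono) auto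
    have t1: "\<rho> \<tau> * (1 / real m) * \<bar>A\<bar> \<le> C * K1 / real s"
    proof -
      have "\<rho> \<tau> * (1 / real m) \<le> C / \<tau> * (1 / real m)" using C(3)[OF \<tau>1] by (intro mult_right_mono) auto
      also have "\<dots> = C / real k" using k mp by (simp add: \<tau>_def)
      also have "\<dots> \<le> C / real s"
      proof -
        have "(real s)\<^sup>2 * 1 \<le> (real s)\<^sup>2 * real m" using m by (intro mult_left_mono) auto
        then have "(real s)\<^sup>2 \<le> real (s\<^sup>2 * m)" by simp
        then have "real s \<le> real k" using s2 \<open>real (s\<^sup>2 * m) < real k\<close> by linarith
        then show ?thesis using C(1) sp k by (intro divide_left_mono) auto
      qed
      finally have "\<rho> \<tau> * (1 / real m) * \<bar>A\<bar> \<le> C / real s * K1" using A C(1) sp by (intro mult_mono) auto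
      then show ?thesis by simp
    qed
    \<comment> \<open>The right end \<open>s\<^sup>2\<close> of the window is itself a grid point,
      and \<open>l0\<close> realises the longest increment there. Since the floor rounds down, its
      length is at least \<open>k0 * (1 - u0)\<close>, so \<open>H\<close> bounds the drift at
      \<open>s\<^sup>2\<close> up to the fluctuation \<open>2 * (C * b)\<close>.\<close>
    define k0 where "k0 = s\<^sup>2 * m"
    define l0 where "l0 = nat \<lfloor>real k0 * u0\<rfloor>"
    have k0: "real k0 / real m = (real s)\<^sup>2" "1 \<le> k0" using m s mp by (auto simp: k0_def)
    have l0: "l0 \<in> floor_multiples U k0" unfolding l0_def using k0(2) by (rule u0(3))
    have l0k: "l0 \<le> k0" using floor_multiples_le[OF U l0] .
    have B0j: "\<bar>B j\<bar> \<le> (real s)\<^sup>2 * b" if "j \<le> k0" for j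
      using B2[of k0 j] that unfolding k0(1) by (simp add: k0_def b_def mult.commute)
    have u0k: "real k0 * (1 - u0) \<le> real k0 - real l0"
      unfolding l0_def using u0(1) by (simp add: algebra_simps)
    have T\<tau>: "1 / real s \<le> (real s)\<^sup>2" using s2 sp by (meson divide_le_eq_1_pos le_divide_eq_1_pos order_trans)
    have h1: "\<rho> ((real s)\<^sup>2) * \<bar>(B k0 + real k0 / real m * A) - (B l0 + real l0 / real m * A)\<bar> \<le> H"
      using H[of k0 l0] T\<tau> l0 unfolding k0(1) by simp
    have h2: "\<rho> ((real s)\<^sup>2) * ((real s)\<^sup>2 * (1 - u0) * \<bar>A\<bar> - 2 * ((real s)\<^sup>2 * b)) \<le>
        \<rho> ((real s)\<^sup>2) * \<bar>(B k0 + real k0 / real m * A) - (B l0 + real l0 / real m * A)\<bar>"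
    proof (rule mult_left_mono[OF _ T\<rho>0])
      have diff0: "(B k0 + real k0 / real m * A) - (B l0 + real l0 / real m * A) = B k0 - B l0 + (real k0 - real l0) / real m * A"
        by (simp add: diff_divide_distrib algebra_simps)
      have incr0: "\<bar>(real k0 - real l0) / real m * A\<bar> = (real k0 - real l0) / real m * \<bar>A\<bar>"
        using l0k by (simp add: abs_mult abs_divide)
      have "(real s)\<^sup>2 * (1 - u0) * \<bar>A\<bar> \<le> (real k0 - real l0) / real m * \<bar>A\<bar>"
      proof (rule mult_right_mono)
        have "real k0 * (1 - u0) / real m \<le> (real k0 - real l0) / real m" using u0k by (intro divide_right_mono) auto
        moreover have "real k0 * (1 - u0) / real m = (real s)\<^sup>2 * (1 - u0)" unfolding k0(1)[symmetric] by simp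
        ultimately show "(real s)\<^sup>2 * (1 - u0) \<le> (real k0 - real l0) / real m" by linarith
      qed simp
      then show "(real s)\<^sup>2 * (1 - u0) * \<bar>A\<bar> - 2 * ((real s)\<^sup>2 * b) \<le>
          \<bar>(B k0 + real k0 / real m * A) - (B l0 + real l0 / real m * A)\<bar>"
        unfolding diff0 incr0[symmetric] by (rule lower[OF B0j[OF order_refl] B0j[OF l0k]])
    qed
    have h3: "\<rho> ((real s)\<^sup>2) * ((real s)\<^sup>2 * (1 - u0) * \<bar>A\<bar> - 2 * ((real s)\<^sup>2 * b)) =
        ((real s)\<^sup>2 * \<rho> ((real s)\<^sup>2)) * (1 - u0) * \<bar>A\<bar> - 2 * (((real s)\<^sup>2 * \<rho> ((real s)\<^sup>2)) * b)"
      by (simp add: algebra_simps)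
    have h4: "2 * (((real s)\<^sup>2 * \<rho> ((real s)\<^sup>2)) * b) \<le> 2 * (C * b)"
      using T\<rho> b0 by (intro mult_left_mono mult_right_mono) auto
    have "((real s)\<^sup>2 * \<rho> ((real s)\<^sup>2)) * (1 - u0) * \<bar>A\<bar> - 2 * (((real s)\<^sup>2 * \<rho> ((real s)\<^sup>2)) * b) \<le> H"
      using order_trans[OF h2 h1] unfolding h3 .
    with h4 have HT: "((real s)\<^sup>2 * \<rho> ((real s)\<^sup>2)) * (1 - u0) * \<bar>A\<bar> \<le> H + 2 * (C * b)" by linarith
    have u01: "u0 \<le> 1" using u0(2)[OF u(1)] u(1) U by (meson atLeastAtMost_iff order_trans subset_iff)
    \<comment> \<open>Drift in the tail and drift at the endpoint share the factor
      \<open>(1 - u0) * \<bar>A\<bar>\<close>; they differ only through \<open>t * \<rho> t\<close>,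
      hence by at most \<open>\<delta> * K1\<close>.\<close>
    have main: "(\<tau> * \<rho> \<tau>) * (1 - u0) * \<bar>A\<bar> \<le> ((real s)\<^sup>2 * \<rho> ((real s)\<^sup>2)) * (1 - u0) * \<bar>A\<bar> + \<delta> * K1"
    proof -
      have "(\<tau> * \<rho> \<tau> - (real s)\<^sup>2 * \<rho> ((real s)\<^sup>2)) * ((1 - u0) * \<bar>A\<bar>) \<le> \<delta> * ((1 - u0) * \<bar>A\<bar>)"
        using osc[of \<tau>] 3 u01 by (intro mult_right_mono) auto
      also have "\<dots> \<le> \<delta> * (1 * K1)" using \<delta> A u0(1) u01 K1 by (intro mult_left_mono mult_mono) auto
      finally show ?thesis by (simp add: algebra_simps)
    qed
    have e8: "8 * K3 * C / sqrt (real s) = 8 * (C * b)" by (simp add: b_def)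
    have Cb: "0 \<le> C * b" using C(1) b0 by simp
    note tail
    also have "\<tau> * \<rho> \<tau> * (1 - u0) * \<bar>A\<bar> + \<rho> \<tau> * (1 / real m) * \<bar>A\<bar> + 2 * (\<tau> * \<rho> \<tau> * b) \<le>
        (H + 2 * (C * b) + \<delta> * K1) + C * K1 / real s + 2 * (C * b)"
      using order_trans[OF main add_right_mono[OF HT]] t1 t2 by (intro add_mono)
    also have "\<dots> \<le> H + (C * (K1 + 2 * K2) * (1 / real s) powr (\<alpha> - \<gamma>) + \<delta> * K1 + C * K1 / real s + 8 * K3 * C / sqrt (real s))"
      unfolding e8 using E1 Cb by simp
    finally show ?thesis unfolding \<tau>_def .
  qed
qed

section \<open>Hoeffding decomposition of the monitoring statistic\<close>

context monitoring_data
begin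

definition rem_sum :: "nat \<Rightarrow> nat \<Rightarrow> 'a \<Rightarrow> real" where
  "rem_sum m k \<omega> = (\<Sum>i=1..m. \<Sum>j=m+1..m+k. hoeffding_rem M Y h (Y (int i) \<omega>) (Y (int j) \<omega>))"

abbreviation gamma_stat :: "nat \<Rightarrow> nat \<Rightarrow> 'a \<Rightarrow> real" where
  "gamma_stat \<equiv> Gamma_stat h (kernel_mean M Y h) (\<lambda>i. Y (int i))"

lemma measurable_rem_sum [measurable]: "rem_sum m k \<in> borel_measurable M"
  unfolding rem_sum_def hoeffding_rem_def by measurable

lemma gamma_stat_decomposition:
  assumes "0 < m"
  shows "gamma_stat m k \<omega> / sqrt (real m) =
    monitored m k \<omega> + real k / real m * hist m \<omega> + rem_sum m k \<omega> / (real m * sqrt (real m))"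
proof -
  have "h (Y (int i) \<omega>) (Y (int j) \<omega>) - kernel_mean M Y h =
      score1 i \<omega> + score2 j \<omega> + hoeffding_rem M Y h (Y (int i) \<omega>) (Y (int j) \<omega>)" for i j
    by (simp add: score1_def score2_def hoeffding_rem_def)
  then have "(\<Sum>i=1..m. \<Sum>j=m+1..m+k. h (Y (int i) \<omega>) (Y (int j) \<omega>) - kernel_mean M Y h) =
      real k * (\<Sum>i=1..m. score1 i \<omega>) + real m * (\<Sum>j=m+1..m+k. score2 j \<omega>) + rem_sum m k \<omega>"
    by (simp add: sum.distrib rem_sum_def sum_distrib_left)
  then show ?thesis
    using assms unfolding Gamma_stat_def hist_def monitored_def by (simp add: field_simps)
qed

lemma rem_sum_diff:
  assumes "a < b"
  shows "rem_sum m b \<omega> - rem_sum m a \<omega> =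
    (\<Sum>i=1..m. \<Sum>j=m+a+1..m+b. hoeffding_rem M Y h (Y (int i) \<omega>) (Y (int j) \<omega>))"
proof -
  have "(\<Sum>j=m+1..m+b. f j) = (\<Sum>j=m+1..m+a. f j) + (\<Sum>j=m+a+1..m+b. f j)" for f :: "nat \<Rightarrow> real"
    using sum.ub_add_nat[of "m + 1" "m + a" f "b - a"] assms by simp
  then show ?thesis unfolding rem_sum_def by (simp add: sum_subtractf[symmetric])
qed

lemma \<rho>_pos: "0 < t \<Longrightarrow> 0 < \<rho> t" using weight by (simp add: weight_conditions_def)

lemma \<gamma>_range: "0 \<le> \<gamma>" "\<gamma> < 1 / 2" using weight by (auto simp: weight_conditions_def)

lemma \<rho>_bound:
  obtains C where "C > 0" "\<And>t. 0 < t \<Longrightarrow> t \<le> 2 \<Longrightarrow> \<rho> t \<le> C * t powr (- \<gamma>)" "\<And>t. t \<ge> 1 \<Longrightarrow> \<rho> t \<le> C / t"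
proof -
  obtain c0 c1 where "((\<lambda>t. t powr \<gamma> * \<rho> t) \<longlongrightarrow> c0) (at_right 0)" "((\<lambda>t. t * \<rho> t) \<longlongrightarrow> c1) at_top"
    using weight unfolding weight_conditions_def by blast
  from weight_function_bound[OF continuous_\<rho> this] show ?thesis using that by blast
qed

lemma rem_sum_negligible:
  assumes "e > 0" "\<epsilon> > 0"
  shows "\<forall>\<^sub>F m in sequentially. measure M {\<omega>\<in>space M. \<exists>k\<ge>1. \<exists>l\<le>k.
      e < \<rho> (real k / real m) * (\<bar>rem_sum m l \<omega>\<bar> / (real m * sqrt (real m)))} \<le> \<epsilon>"
proof -
  obtain u where u: "\<And>m k1 k2. 1 \<le> m \<Longrightarrow> m + 1 \<le> k1 \<Longrightarrow> k1 \<le> k2 \<Longrightarrow>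
      integrable M (\<lambda>\<omega>. \<bar>\<Sum>i=1..m. \<Sum>j=k1..k2. hoeffding_rem M Y h (Y (int i) \<omega>) (Y (int j) \<omega>)\<bar>\<^sup>2) \<and>
      (LINT \<omega>|M. \<bar>\<Sum>i=1..m. \<Sum>j=k1..k2. hoeffding_rem M Y h (Y (int i) \<omega>) (Y (int j) \<omega>)\<bar>\<^sup>2)
        \<le> u m * (real k2 - real k1 + 1)"
    and lim: "(\<lambda>m. u m / real m powr (2 - 2 * \<gamma>) * (ln (real m))\<^sup>2) \<longlonglongrightarrow> 0"
    using remainder unfolding remainder_condition_def Let_def by blast
  obtain C where C: "C > 0" "\<And>t. 0 < t \<Longrightarrow> t \<le> 2 \<Longrightarrow> \<rho> t \<le> C * t powr (- \<gamma>)" "\<And>t. t \<ge> 1 \<Longrightarrow> \<rho> t \<le> C / t"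
    by (rule \<rho>_bound) blast
  show ?thesis
  proof (rule M.remainder_negligible[OF measurable_rem_sum _ _ _ lim \<gamma>_range(1) C assms])
    show "rem_sum m 0 \<omega> = 0" for m \<omega> by (simp add: rem_sum_def)
    show "integrable M (\<lambda>\<omega>. (rem_sum m b \<omega> - rem_sum m a \<omega>)\<^sup>2)" if "1 \<le> m" "a < b" for m a b
      using u[of m "m + a + 1" "m + b"] that unfolding rem_sum_diff[OF that(2)] by simp
    show "(LINT \<omega>|M. (rem_sum m b \<omega> - rem_sum m a \<omega>)\<^sup>2) \<le> u m * real (b - a)" if "1 \<le> m" "a < b" for m a b
      using u[of m "m + a + 1" "m + b"] that unfolding rem_sum_diff[OF that(2)] by (simp add: of_nat_diff)
  qed
qed

text \<open>Convergence of \<open>t * \<rho> t\<close> as a Cauchy property, anchored at the right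
  end of the window because the tail will be compared with the value there.\<close>

lemma scaled_weight_oscillation:
  assumes "e > 0"
  shows "\<forall>\<^sub>F s in sequentially. \<forall>t\<ge>(real s)\<^sup>2. \<bar>t * \<rho> t - (real s)\<^sup>2 * \<rho> ((real s)\<^sup>2)\<bar> \<le> e"
proof -
  obtain c1 where "((\<lambda>t. t * \<rho> t) \<longlongrightarrow> c1) at_top" using weight unfolding weight_conditions_def by blast
  then have "\<forall>\<^sub>F t in at_top. dist (t * \<rho> t) c1 < e / 2" using \<open>e > 0\<close> by (intro tendstoD) auto
  then obtain Q where Q: "\<And>t. t \<ge> Q \<Longrightarrow> \<bar>t * \<rho> t - c1\<bar> < e / 2"
    unfolding eventually_at_top_linorder dist_real_def by blast
  have "\<forall>\<^sub>F s in sequentially. max 1 Q \<le> real s"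
    using filterlim_real_sequentially unfolding filterlim_at_top by blast
  then show ?thesis
  proof eventually_elim
    case (elim s)
    have "1 \<le> real s" "Q \<le> real s" using elim by auto
    then have "Q \<le> (real s)\<^sup>2" using self_le_power[of "real s" 2] by linarith
    then show ?case using Q[of "(real s)\<^sup>2"] Q by (smt (verit) field_sum_of_halves)
  qed
qed

section \<open>A weighted maximum of increments covering all three schemes\<close>

context
  fixes U :: "real set" and u0 :: real and Psi :: "nat \<Rightarrow> nat \<Rightarrow> 'a \<Rightarrow> real"
  assumes U: "U \<subseteq> {0..1}" "U \<noteq> {}"
    and u0: "0 \<le> u0" "\<And>u. u \<in> U \<Longrightarrow> u0 \<le> u" "\<And>k. 1 \<le> k \<Longrightarrow> nat \<lfloor>real k * u0\<rfloor> \<in> floor_multiples U k"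
    and Psi_meas: "\<And>m k. Psi m k \<in> borel_measurable M"
    and Psi_upper: "\<And>m k l \<omega>. \<lbrakk>\<omega> \<in> space M; 1 \<le> k; l \<in> floor_multiples U k\<rbrakk> \<Longrightarrow>
        \<bar>gamma_stat m k \<omega> - gamma_stat m l \<omega>\<bar> \<le> Psi m k \<omega>"
    and Psi_attained: "\<And>m k \<omega>. \<lbrakk>\<omega> \<in> space M; 1 \<le> k\<rbrakk> \<Longrightarrow>
        \<exists>l\<in>floor_multiples U k. Psi m k \<omega> = \<bar>gamma_stat m k \<omega> - gamma_stat m l \<omega>\<bar>"
begin

definition monitor_stat :: "nat \<Rightarrow> 'a \<Rightarrow> ereal" where
  "monitor_stat m \<omega> = (SUP k\<in>{1..}. ereal (w m k * Psi m k \<omega>))"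

text \<open>The parameter \<open>s = n + 2\<close> starts at 2, because \<open>s = 1\<close> would
  give the degenerate window consisting of the single time 1. The windows increase with
  \<open>n\<close> and exhaust the positive half line.\<close>

definition level_stat :: "nat \<Rightarrow> nat \<Rightarrow> 'a \<Rightarrow> real" where
  "level_stat n m \<omega> = grid_stat U (1 / real (n + 2)) ((real (n + 2))\<^sup>2) m \<omega>"

definition level_limit :: "nat \<Rightarrow> 'b \<Rightarrow> real" where
  "level_limit n \<omega> = path_sup \<rho> U (1 / real (n + 2)) ((real (n + 2))\<^sup>2) (limit_path \<omega>)"

lemma level_range: "0 < 1 / real (n + 2)" "1 / real (n + 2) < (real (n + 2))\<^sup>2"
proof -
  show "0 < 1 / real (n + 2)" by simp
  have "1 / real (n + 2) < 1" by simp
  also have "\<dots> \<le> (real (n + 2))\<^sup>2" by (rule one_le_power) simp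
  finally show "1 / real (n + 2) < (real (n + 2))\<^sup>2" .
qed

lemma level_continuous: "\<omega> \<in> space N \<Longrightarrow> continuous_on {0..T} (limit_path \<omega>)"
  by (rule continuous_on_subset[OF continuous_limit_path]) auto

lemma level_stat_eq:
  assumes "0 < m"
  shows "level_stat n m \<omega> = grid_sup \<rho> U (1 / real (n + 2)) ((real (n + 2))\<^sup>2) m
    (\<lambda>t. monitored m (nat \<lfloor>real m * t\<rfloor>) \<omega> + t * hist m \<omega>)"
  unfolding level_stat_def grid_stat_def
proof (rule grid_sup_cong[OF U(1)])
  fix k
  have "nat \<lfloor>real m * (real k / real m)\<rfloor> = k" using assms by simp
  then show "monitor_path (\<lambda>t. partial_path m (nat \<lfloor>real m * t\<rfloor>) \<omega>) (real k / real m) =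
      monitored m (nat \<lfloor>real m * (real k / real m)\<rfloor>) \<omega> + real k / real m * hist m \<omega>"
    unfolding monitor_path_partial_path[OF assms] by simp
qed

lemma level_stat_le_iff:
  assumes "0 < m"
  shows "level_stat n m \<omega> \<le> x \<longleftrightarrow> 0 \<le> x \<and> (\<forall>k l. 1 / real (n + 2) \<le> real k / real m \<and> real k / real m \<le> (real (n + 2))\<^sup>2 \<and>
     l \<in> floor_multiples U k \<longrightarrow> \<rho> (real k / real m) *
       \<bar>(monitored m k \<omega> + real k / real m * hist m \<omega>) - (monitored m l \<omega> + real l / real m * hist m \<omega>)\<bar> \<le> x)"
proof -
  have "nat \<lfloor>real m * (real k / real m)\<rfloor> = k" for k using assms by simp
  then show ?thesis unfolding level_stat_eq[OF assms] grid_sup_le_iff[OF U(1) level_range(1)] by simp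
qed

lemma weighted_gamma_diff:
  assumes "0 < m" "1 \<le> k" "l \<in> floor_multiples U k"
    and r: "\<And>l. l \<le> k \<Longrightarrow> \<rho> (real k / real m) * (\<bar>rem_sum m l \<omega>\<bar> / (real m * sqrt (real m))) \<le> e"
  shows "\<bar>\<rho> (real k / real m) * (1 / sqrt (real m) * \<bar>gamma_stat m k \<omega> - gamma_stat m l \<omega>\<bar>) -
     \<rho> (real k / real m) * \<bar>(monitored m k \<omega> + real k / real m * hist m \<omega>) - (monitored m l \<omega> + real l / real m * hist m \<omega>)\<bar>\<bar> \<le> 2 * e"
proof -
  define D where "D = (\<lambda>j. monitored m j \<omega> + real j / real m * hist m \<omega>)"
  define E where "E = (\<lambda>j. rem_sum m j \<omega> / (real m * sqrt (real m)))"
  have \<rho>0: "0 \<le> \<rho> (real k / real m)" using \<rho>_pos[of "real k / real m"] assms by simp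
  have E: "\<rho> (real k / real m) * \<bar>E j\<bar> \<le> e" if "j \<le> k" for j
    using r[OF that] by (simp add: E_def abs_mult)
  have "1 / sqrt (real m) * \<bar>gamma_stat m k \<omega> - gamma_stat m l \<omega>\<bar> =
      \<bar>gamma_stat m k \<omega> / sqrt (real m) - gamma_stat m l \<omega> / sqrt (real m)\<bar>"
    by (simp add: diff_divide_distrib[symmetric])
  also have "\<dots> = \<bar>(D k + E k) - (D l + E l)\<bar>"
    unfolding gamma_stat_decomposition[OF assms(1)] D_def E_def by simp
  finally have eq: "1 / sqrt (real m) * \<bar>gamma_stat m k \<omega> - gamma_stat m l \<omega>\<bar> = \<bar>(D k + E k) - (D l + E l)\<bar>" .
  have "\<bar>\<bar>(D k + E k) - (D l + E l)\<bar> - \<bar>D k - D l\<bar>\<bar> \<le> \<bar>E k\<bar> + \<bar>E l\<bar>" by linarith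
  then have "\<rho> (real k / real m) * \<bar>\<bar>(D k + E k) - (D l + E l)\<bar> - \<bar>D k - D l\<bar>\<bar> \<le> \<rho> (real k / real m) * (\<bar>E k\<bar> + \<bar>E l\<bar>)"
    using \<rho>0 by (intro mult_left_mono)
  also have "\<dots> \<le> 2 * e"
    using E[OF order_refl] E[OF floor_multiples_le[OF U(1) assms(3)]] by (simp add: distrib_left)
  also have "\<rho> (real k / real m) * \<bar>\<bar>(D k + E k) - (D l + E l)\<bar> - \<bar>D k - D l\<bar>\<bar> =
     \<bar>\<rho> (real k / real m) * \<bar>(D k + E k) - (D l + E l)\<bar> - \<rho> (real k / real m) * \<bar>D k - D l\<bar>\<bar>"
    using \<rho>0 by (simp add: abs_mult right_diff_distrib[symmetric])
  finally show ?thesis unfolding eq D_def .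
qed

lemma weight_cases:
  obtains b where "(\<lambda>m. b m / real m) \<longlonglongrightarrow> 0"
    "\<And>m k. 1 \<le> m \<Longrightarrow> 1 \<le> k \<Longrightarrow> w m k = 1 / sqrt (real m) * (if real k > b m then \<rho> (real k / real m) else 0)"
proof -
  obtain b where b: "(\<lambda>m. b m / real m) \<longlonglongrightarrow> 0"
    "\<forall>m\<ge>1. \<forall>k\<ge>1. w m k = real m powr (- 1 / 2) * (if real k > b m then \<rho> (real k / real m) else 0)"
    using weight unfolding weight_conditions_def by blast
  have "real m powr (- 1 / 2) = 1 / sqrt (real m)" if "1 \<le> m" for m
    using that powr_minus_divide[of "real m" "1 / 2"] by (simp add: powr_half_sqrt)
  then show ?thesis using b by (intro that[of b]) auto
qed

lemma weighted_stat_nonneg: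
  assumes "1 \<le> m" "1 \<le> k" "\<omega> \<in> space M"
  shows "0 \<le> w m k * Psi m k \<omega>"
proof -
  obtain b where "\<And>m k. 1 \<le> m \<Longrightarrow> 1 \<le> k \<Longrightarrow> w m k = 1 / sqrt (real m) * (if real k > b m then \<rho> (real k / real m) else 0)"
    by (rule weight_cases) blast
  then have "0 \<le> w m k" using assms \<rho>_pos[of "real k / real m"] by simp
  moreover have "0 \<le> Psi m k \<omega>" using Psi_attained[OF assms(3,2), of m] by auto
  ultimately show ?thesis by simp
qed

lemma measurable_monitor_stat [measurable]: "monitor_stat m \<in> borel_measurable M"
  unfolding monitor_stat_def using Psi_meas by measurable

lemma measurable_level_stat [measurable]: "level_stat n m \<in> borel_measurable M"
  unfolding level_stat_def by (rule measurable_grid_stat[OF U(1) level_range(1)])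

text \<open>For a fixed window \<open>l_m / m\<close> is eventually below its left end, so no grid
  point of the window is hit by the cut-off of the weight. What remains is the Hoeffding remainder,
  which appears at \<open>k\<close> and at \<open>l\<close> and is therefore allowed
  \<open>e / 2\<close> each.\<close>

lemma level_stat_le_monitor_stat:
  assumes "e > 0" "\<epsilon> > 0"
  shows "\<forall>\<^sub>F m in sequentially. measure M {\<omega>\<in>space M. monitor_stat m \<omega> < ereal (level_stat n m \<omega> - e)} \<le> \<epsilon>"
proof -
  obtain b where b: "(\<lambda>m. b m / real m) \<longlonglongrightarrow> 0"
    "\<And>m k. 1 \<le> m \<Longrightarrow> 1 \<le> k \<Longrightarrow> w m k = 1 / sqrt (real m) * (if real k > b m then \<rho> (real k / real m) else 0)"
    by (rule weight_cases) blast
  have "\<forall>\<^sub>F m in sequentially. b m / real m < 1 / real (n + 2)"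
    using b(1) by (rule order_tendstoD) simp
  moreover have "\<forall>\<^sub>F m in sequentially. measure M {\<omega>\<in>space M. \<exists>k\<ge>1. \<exists>l\<le>k.
      e / 2 < \<rho> (real k / real m) * (\<bar>rem_sum m l \<omega>\<bar> / (real m * sqrt (real m)))} \<le> \<epsilon>"
    using assms by (intro rem_sum_negligible) auto
  ultimately show ?thesis using eventually_gt_at_top[of 0]
  proof eventually_elim
    case (elim m)
    have "measure M {\<omega>\<in>space M. monitor_stat m \<omega> < ereal (level_stat n m \<omega> - e)} \<le>
      measure M {\<omega>\<in>space M. \<exists>k\<ge>1. \<exists>l\<le>k. e / 2 < \<rho> (real k / real m) * (\<bar>rem_sum m l \<omega>\<bar> / (real m * sqrt (real m)))}"
    proof (intro M.finite_measure_mono subsetI)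
      fix \<omega> assume \<omega>: "\<omega> \<in> {\<omega>\<in>space M. monitor_stat m \<omega> < ereal (level_stat n m \<omega> - e)}"
      show "\<omega> \<in> {\<omega>\<in>space M. \<exists>k\<ge>1. \<exists>l\<le>k. e / 2 < \<rho> (real k / real m) * (\<bar>rem_sum m l \<omega>\<bar> / (real m * sqrt (real m)))}"
      proof (rule ccontr)
        assume "\<not> ?thesis"
        then have r: "\<And>k l. 1 \<le> k \<Longrightarrow> l \<le> k \<Longrightarrow> \<rho> (real k / real m) * (\<bar>rem_sum m l \<omega>\<bar> / (real m * sqrt (real m))) \<le> e / 2"
          using \<omega> by (auto simp: not_less)
        have up: "ereal (w m k * Psi m k \<omega>) \<le> monitor_stat m \<omega>" if "1 \<le> k" for k
          unfolding monitor_stat_def using that by (intro SUP_upper) auto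
        \<comment> \<open>The window supremum contains the inserted 0, so nonnegativity of
          \<open>v\<close> has to be checked; the term at \<open>k = 1\<close> provides it.\<close>
        have "ereal 0 \<le> ereal (w m 1 * Psi m 1 \<omega>)" using weighted_stat_nonneg[of m 1 \<omega>] elim(3) \<omega> by simp
        also have "\<dots> \<le> monitor_stat m \<omega>" by (rule up) simp
        finally obtain v where v: "monitor_stat m \<omega> = ereal v" "0 \<le> v"
          using \<omega> by (cases "monitor_stat m \<omega>") auto
        have "level_stat n m \<omega> \<le> v + e"
          unfolding level_stat_le_iff[OF elim(3)]
        proof (intro conjI allI impI)
          show "0 \<le> v + e" using v assms by simp
          fix k l assume kl: "1 / real (n + 2) \<le> real k / real m \<and> real k / real m \<le> (real (n + 2))\<^sup>2 \<and> l \<in> floor_multiples U k"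
          have k1: "1 \<le> k" using kl level_range(1)[of n] by (cases k) auto
          have "b m < real k"
          proof -
            have "b m / real m < real k / real m" using elim(1) kl by linarith
            then show ?thesis using elim(3) by (simp add: divide_less_cancel)
          qed
          then have wm: "w m k = 1 / sqrt (real m) * \<rho> (real k / real m)" using b(2)[of m k] elim(3) k1 by simp
          have \<rho>0: "0 \<le> 1 / sqrt (real m) * \<rho> (real k / real m)" using \<rho>_pos[of "real k / real m"] elim(3) k1 by simp
          have "\<rho> (real k / real m) * (1 / sqrt (real m) * \<bar>gamma_stat m k \<omega> - gamma_stat m l \<omega>\<bar>) \<le> w m k * Psi m k \<omega>"
            using mult_left_mono[OF Psi_upper[of \<omega> k l m] \<rho>0] \<omega> k1 kl unfolding wm by (simp add: mult_ac)
          also have "\<dots> \<le> v" using up[OF k1] v(1) by simp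
          finally have "\<rho> (real k / real m) * (1 / sqrt (real m) * \<bar>gamma_stat m k \<omega> - gamma_stat m l \<omega>\<bar>) \<le> v" .
          then show "\<rho> (real k / real m) * \<bar>(monitored m k \<omega> + real k / real m * hist m \<omega>) - (monitored m l \<omega> + real l / real m * hist m \<omega>)\<bar> \<le> v + e"
            using weighted_gamma_diff[OF elim(3) k1, of l \<omega> "e / 2", OF _ r[OF k1]] kl by simp
        qed
        then show False using \<omega> v by simp
      qed
    qed measurable
    then show ?case using elim(2) by linarith
  qed
qed

text \<open>The order of choices matters: \<open>K1\<close>, \<open>K2\<close>, \<open>K3\<close>
  depend on \<open>\<epsilon>\<close> alone, then the window parameter \<open>s\<close> makes the
  deterministic error small, and finally \<open>m\<close> grows. Four exceptional events (remainder,
  late sums, historic sum, early sums) take \<open>\<epsilon> / 4\<close> each; outside of them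
  \<open>weighted_increment_bound\<close> applies.\<close>

lemma monitor_stat_le_level_stat:
  assumes "e > 0" "\<epsilon> > 0"
  shows "\<exists>n. \<forall>\<^sub>F m in sequentially. measure M {\<omega>\<in>space M. ereal (level_stat n m \<omega> + e) < monitor_stat m \<omega>} \<le> \<epsilon>"
proof -
  obtain b where b: "\<And>m k. 1 \<le> m \<Longrightarrow> 1 \<le> k \<Longrightarrow> w m k = 1 / sqrt (real m) * (if real k > b m then \<rho> (real k / real m) else 0)"
    by (rule weight_cases) blast
  obtain C where C: "C > 0" "\<And>t. 0 < t \<Longrightarrow> t \<le> 2 \<Longrightarrow> \<rho> t \<le> C * t powr (- \<gamma>)" "\<And>t. t \<ge> 1 \<Longrightarrow> \<rho> t \<le> C / t"
    by (rule \<rho>_bound) blast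
  \<comment> \<open>The midpoint of \<open>\<gamma>\<close> and 1/2: above \<open>\<gamma>\<close>
    so that the early sums beat the weight, below 1/2 as the early sum condition demands.\<close>
  define \<alpha> where "\<alpha> = (\<gamma> + 1 / 2) / 2"
  have \<alpha>: "0 \<le> \<alpha>" "\<gamma> < \<alpha>" "\<alpha> < 1 / 2" "\<alpha> < 1" using \<gamma>_range by (auto simp: \<alpha>_def)
  have \<epsilon>: "\<epsilon> / 4 > 0" using assms by simp
  obtain K1 where K1: "K1 > 0" "\<forall>\<^sub>F m in sequentially. measure M {\<omega>\<in>space M. K1 < \<bar>hist m \<omega>\<bar>} \<le> \<epsilon> / 4"
    using hist_tight[OF \<epsilon>] by blast
  obtain K2 where K2: "K2 > 0" "\<forall>\<^sub>F m in sequentially. measure M {\<omega>\<in>space M. \<exists>l\<in>{1..m}.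
     K2 * (real l / real m) powr \<alpha> < \<bar>monitored m l \<omega>\<bar>} \<le> \<epsilon> / 4"
    using prob_monitored_early[OF \<alpha>(1,3) \<epsilon>] by blast
  obtain K3 where K3: "K3 > 0" "\<And>s::nat. s \<ge> 1 \<Longrightarrow> \<forall>\<^sub>F m in sequentially. measure M {\<omega>\<in>space M. \<exists>k. s\<^sup>2 * m \<le> k \<and> (\<exists>l\<le>k.
     K3 * (real k / real m) / sqrt (real s) < \<bar>monitored m l \<omega>\<bar>)} \<le> \<epsilon> / 4"
    using prob_monitored_late[OF \<epsilon>] by blast
  \<comment> \<open>Each of the four deterministic error terms receives \<open>e / 8\<close>. The
    other half of \<open>e\<close> is reserved for the remainder, which enters twice with
    \<open>e / 4\<close>.\<close>
  define \<delta> where "\<delta> = e / (8 * K1)"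
  have \<delta>: "\<delta> > 0" "\<delta> * K1 = e / 8" using assms K1(1) by (auto simp: \<delta>_def)
  have "(\<lambda>s::nat. C * (K1 + 2 * K2) * (1 / real s) powr (\<alpha> - \<gamma>)) \<longlonglongrightarrow> 0" using \<alpha>(2) by real_asymp
  then have "\<forall>\<^sub>F s::nat in sequentially. C * (K1 + 2 * K2) * (1 / real s) powr (\<alpha> - \<gamma>) < e / 8"
    using assms by (intro order_tendstoD) auto
  moreover have "(\<lambda>s::nat. C * K1 / real s) \<longlonglongrightarrow> 0" by real_asymp
  then have "\<forall>\<^sub>F s::nat in sequentially. C * K1 / real s < e / 8" using assms by (intro order_tendstoD) auto
  moreover have "(\<lambda>s::nat. 8 * K3 * C / sqrt (real s)) \<longlonglongrightarrow> 0" by real_asymp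
  then have "\<forall>\<^sub>F s::nat in sequentially. 8 * K3 * C / sqrt (real s) < e / 8" using assms by (intro order_tendstoD) auto
  moreover have "\<forall>\<^sub>F s in sequentially. \<forall>t\<ge>(real s)\<^sup>2. \<bar>t * \<rho> t - (real s)\<^sup>2 * \<rho> ((real s)\<^sup>2)\<bar> \<le> \<delta>"
    by (rule scaled_weight_oscillation[OF \<delta>(1)])
  ultimately have "\<forall>\<^sub>F s::nat in sequentially. 2 \<le> s \<and> (\<forall>t\<ge>(real s)\<^sup>2. \<bar>t * \<rho> t - (real s)\<^sup>2 * \<rho> ((real s)\<^sup>2)\<bar> \<le> \<delta>) \<and>
      C * (K1 + 2 * K2) * (1 / real s) powr (\<alpha> - \<gamma>) + \<delta> * K1 + C * K1 / real s + 8 * K3 * C / sqrt (real s) \<le> e / 2"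
    using eventually_ge_at_top[of 2]
  proof eventually_elim
    case (elim s)
    have "C * (K1 + 2 * K2) * (1 / real s) powr (\<alpha> - \<gamma>) + \<delta> * K1 + C * K1 / real s + 8 * K3 * C / sqrt (real s) \<le> e / 2"
      using elim(1-3) \<delta>(2) by linarith
    with elim(4,5) show ?case by blast
  qed
  then obtain s :: nat where s: "2 \<le> s" "\<And>t. t \<ge> (real s)\<^sup>2 \<Longrightarrow> \<bar>t * \<rho> t - (real s)\<^sup>2 * \<rho> ((real s)\<^sup>2)\<bar> \<le> \<delta>"
    and small: "C * (K1 + 2 * K2) * (1 / real s) powr (\<alpha> - \<gamma>) + \<delta> * K1 + C * K1 / real s + 8 * K3 * C / sqrt (real s) \<le> e / 2"
    by (auto simp: eventually_sequentially)
  define n where "n = s - 2"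
  have n: "n + 2 = s" using s(1) by (simp add: n_def)
  show ?thesis
  proof (intro exI[of _ n])
    have "\<forall>\<^sub>F m in sequentially. measure M {\<omega>\<in>space M. \<exists>k\<ge>1. \<exists>l\<le>k.
      e / 4 < \<rho> (real k / real m) * (\<bar>rem_sum m l \<omega>\<bar> / (real m * sqrt (real m)))} \<le> \<epsilon> / 4"
      using assms by (intro rem_sum_negligible) auto
    moreover have "\<forall>\<^sub>F m in sequentially. measure M {\<omega>\<in>space M. \<exists>k. s\<^sup>2 * m \<le> k \<and> (\<exists>l\<le>k.
     K3 * (real k / real m) / sqrt (real s) < \<bar>monitored m l \<omega>\<bar>)} \<le> \<epsilon> / 4" using s(1) by (intro K3(2)) simp
    ultimately show "\<forall>\<^sub>F m in sequentially. measure M {\<omega>\<in>space M. ereal (level_stat n m \<omega> + e) < monitor_stat m \<omega>} \<le> \<epsilon>"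
      using K1(2) K2(2) eventually_gt_at_top[of 0]
    proof eventually_elim
      case (elim m)
      have m1: "1 \<le> m" using elim(5) by simp
      let ?R = "{\<omega>\<in>space M. \<exists>k\<ge>1. \<exists>l\<le>k. e / 4 < \<rho> (real k / real m) * (\<bar>rem_sum m l \<omega>\<bar> / (real m * sqrt (real m)))}"
      let ?L = "{\<omega>\<in>space M. \<exists>k. s\<^sup>2 * m \<le> k \<and> (\<exists>l\<le>k. K3 * (real k / real m) / sqrt (real s) < \<bar>monitored m l \<omega>\<bar>)}"
      let ?A = "{\<omega>\<in>space M. K1 < \<bar>hist m \<omega>\<bar>}"
      let ?E = "{\<omega>\<in>space M. \<exists>l\<in>{1..m}. K2 * (real l / real m) powr \<alpha> < \<bar>monitored m l \<omega>\<bar>}"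
      have "measure M {\<omega>\<in>space M. ereal (level_stat n m \<omega> + e) < monitor_stat m \<omega>} \<le> measure M ((?R \<union> ?L) \<union> (?A \<union> ?E))"
      proof (intro M.finite_measure_mono subsetI)
        fix \<omega> assume \<omega>: "\<omega> \<in> {\<omega>\<in>space M. ereal (level_stat n m \<omega> + e) < monitor_stat m \<omega>}"
        then obtain k where k: "1 \<le> k" "level_stat n m \<omega> + e < w m k * Psi m k \<omega>"
          unfolding monitor_stat_def by (auto simp: less_SUP_iff)
        show "\<omega> \<in> (?R \<union> ?L) \<union> (?A \<union> ?E)"
        proof (rule ccontr)
          assume neg: "\<not> ?thesis"
          have \<omega>M: "\<omega> \<in> space M" using \<omega> by simp
          have r: "\<rho> (real k / real m) * (\<bar>rem_sum m l \<omega>\<bar> / (real m * sqrt (real m))) \<le> e / 4" if "1 \<le> k" "l \<le> k" for k l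
            using neg \<omega>M that by (auto simp: not_less)
          have gL: "\<bar>monitored m l \<omega>\<bar> \<le> K3 * (real k / real m) / sqrt (real s)" if "s\<^sup>2 * m \<le> k" "l \<le> k" for k l
            using neg \<omega>M that by (auto simp: not_less)
          have gA: "\<bar>hist m \<omega>\<bar> \<le> K1" using neg \<omega>M by (auto simp: not_less)
          have gE: "\<bar>monitored m l \<omega>\<bar> \<le> K2 * (real l / real m) powr \<alpha>" if "1 \<le> l" "l \<le> m" for l
            using neg \<omega>M that by (auto simp: not_less)
          obtain l where l: "l \<in> floor_multiples U k" "Psi m k \<omega> = \<bar>gamma_stat m k \<omega> - gamma_stat m l \<omega>\<bar>"
            using Psi_attained[OF \<omega>M k(1)] by blast
          have H: "0 \<le> level_stat n m \<omega>"
            "\<And>k l. 1 / real s \<le> real k / real m \<Longrightarrow> real k / real m \<le> (real s)\<^sup>2 \<Longrightarrow> l \<in> floor_multiples U k \<Longrightarrow>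
              \<rho> (real k / real m) * \<bar>(monitored m k \<omega> + real k / real m * hist m \<omega>) - (monitored m l \<omega> + real l / real m * hist m \<omega>)\<bar> \<le> level_stat n m \<omega>"
            using level_stat_le_iff[OF elim(5), of n \<omega> "level_stat n m \<omega>"] unfolding n by auto
          have m0: "monitored m 0 \<omega> = 0" by (simp add: monitored_def)
          have "\<rho> (real k / real m) * \<bar>(monitored m k \<omega> + real k / real m * hist m \<omega>) - (monitored m l \<omega> + real l / real m * hist m \<omega>)\<bar> \<le>
             level_stat n m \<omega> + (C * (K1 + 2 * K2) * (1 / real s) powr (\<alpha> - \<gamma>) + \<delta> * K1 + C * K1 / real s + 8 * K3 * C / sqrt (real s))"
            by (rule weighted_increment_bound[where B = "\<lambda>k. monitored m k \<omega>" and A = "hist m \<omega>" and ?u0.0 = u0 and U = U,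
                OF m1 s(1) U(1) u0 \<rho>_pos C \<alpha>(2,4) gA m0 less_imp_le[OF K2(1)] gE \<alpha>(1) gL less_imp_le[OF K3(1)] s(2) H(2,1) k(1) l(1)])
          then have "\<rho> (real k / real m) * \<bar>(monitored m k \<omega> + real k / real m * hist m \<omega>) - (monitored m l \<omega> + real l / real m * hist m \<omega>)\<bar> \<le>
             level_stat n m \<omega> + e / 2" using small by linarith
          then have "\<rho> (real k / real m) * (1 / sqrt (real m) * \<bar>gamma_stat m k \<omega> - gamma_stat m l \<omega>\<bar>) \<le> level_stat n m \<omega> + e"
            using weighted_gamma_diff[OF elim(5) k(1) l(1) r[OF k(1)]] by linarith
          \<comment> \<open>In this direction the cut-off of the weight only helps:
            \<open>w m k\<close> is either 0 or the full weight.\<close>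
          moreover have "w m k * Psi m k \<omega> \<le> \<rho> (real k / real m) * (1 / sqrt (real m) * \<bar>gamma_stat m k \<omega> - gamma_stat m l \<omega>\<bar>)"
            using b[OF m1 k(1)] l(2) \<rho>_pos[of "real k / real m"] k(1) elim(5) by simp
          ultimately show False using k(2) by linarith
        qed
      qed measurable
      also have "\<dots> \<le> measure M (?R \<union> ?L) + measure M (?A \<union> ?E)" by (rule measure_Un_le) measurable
      also have "\<dots> \<le> (measure M ?R + measure M ?L) + (measure M ?A + measure M ?E)"
        by (intro add_mono measure_Un_le) measurable
      also have "\<dots> \<le> (\<epsilon> / 4 + \<epsilon> / 4) + (\<epsilon> / 4 + \<epsilon> / 4)" by (intro add_mono elim)
      finally show ?case by simp
    qed
  qed
qed

lemma monitor_stat_converges: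
  "conv_in_distr M monitor_stat N (\<lambda>\<omega>. SUP t\<in>{0<..}. SUP u\<in>U. ereal (\<rho> t * \<bar>limit_path \<omega> t - limit_path \<omega> (t * u)\<bar>))"
proof (rule conv_in_distr_truncation[where V = monitor_stat and H = level_stat and G = level_limit,
      OF M N.prob_space_axioms measurable_monitor_stat measurable_level_stat])
  note limits = grid_stat_limit[OF U(1) level_range, folded level_stat_def level_limit_def]
  show "\<forall>\<^sub>F m in sequentially. measure M {\<omega>\<in>space M. level_stat n m \<omega> \<le> a}
      \<le> measure N {\<omega>\<in>space N. level_limit n \<omega> \<le> a + e} + \<epsilon>" if "e > 0" "\<epsilon> > 0" for n a e \<epsilon>
    by (rule limits(1)[OF that])
  show "\<forall>\<^sub>F m in sequentially. measure N {\<omega>\<in>space N. level_limit n \<omega> \<le> a}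
      \<le> measure M {\<omega>\<in>space M. level_stat n m \<omega> \<le> a + e} + \<epsilon>" if "e > 0" "\<epsilon> > 0" for n a e \<epsilon>
    by (rule limits(2)[OF that])
  show "\<exists>n. \<forall>\<^sub>F m in sequentially. measure M {\<omega>\<in>space M. ereal (level_stat n m \<omega> + e) < monitor_stat m \<omega>} \<le> \<epsilon>"
    if "e > 0" "\<epsilon> > 0" for e \<epsilon>
    by (rule monitor_stat_le_level_stat[OF that])
  show "\<forall>\<^sub>F m in sequentially. measure M {\<omega>\<in>space M. monitor_stat m \<omega> < ereal (level_stat n m \<omega> - e)} \<le> \<epsilon>"
    if "e > 0" "\<epsilon> > 0" for n e \<epsilon>
    by (rule level_stat_le_monitor_stat[OF that])
  show "level_limit n \<in> borel_measurable N" for n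
    unfolding level_limit_def by (rule measurable_path_sup_limit[OF U(1) level_range continuous_\<rho>])
  fix \<omega> assume \<omega>: "\<omega> \<in> space N"
  have le_iff: "level_limit n \<omega> \<le> x \<longleftrightarrow> 0 \<le> x \<and> (\<forall>t u. 1 / real (n + 2) \<le> t \<and> t \<le> (real (n + 2))\<^sup>2 \<and> u \<in> U \<longrightarrow>
      \<rho> t * \<bar>limit_path \<omega> t - limit_path \<omega> (t * u)\<bar> \<le> x)" for n x
    unfolding level_limit_def
    by (rule path_sup_le_iff[OF U(1) level_range(1) continuous_\<rho> level_continuous[OF \<omega>]])
  have upper: "\<rho> t * \<bar>limit_path \<omega> t - limit_path \<omega> (t * u)\<bar> \<le> level_limit n \<omega>"
    if "1 / real (n + 2) \<le> t" "t \<le> (real (n + 2))\<^sup>2" "u \<in> U" for n t u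
    unfolding level_limit_def
    by (rule path_sup_upper[OF U(1) level_range(1) continuous_\<rho> level_continuous[OF \<omega>] that])
  show nonneg: "0 \<le> level_limit n \<omega>" for n using le_iff[of n "level_limit n \<omega>"] by simp
  show "level_limit n \<omega> \<le> level_limit (Suc n) \<omega>" for n
    unfolding le_iff[of n]
  proof (intro conjI allI impI nonneg)
    fix t u assume tu: "1 / real (n + 2) \<le> t \<and> t \<le> (real (n + 2))\<^sup>2 \<and> u \<in> U"
    have "1 / real (Suc n + 2) \<le> 1 / real (n + 2)" by (intro divide_left_mono) auto
    moreover have "(real (n + 2))\<^sup>2 \<le> (real (Suc n + 2))\<^sup>2" by (intro power_mono) auto
    ultimately show "\<rho> t * \<bar>limit_path \<omega> t - limit_path \<omega> (t * u)\<bar> \<le> level_limit (Suc n) \<omega>"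
      using tu by (intro upper) linarith+
  qed
  \<comment> \<open>Every pair \<open>(t, u)\<close> lies in some window, so the supremum over all
    positive times is the supremum of the window suprema. It may still be infinite here, hence the
    case distinction on its value below.\<close>
  let ?S = "SUP t\<in>{0<..}. SUP u\<in>U. ereal (\<rho> t * \<bar>limit_path \<omega> t - limit_path \<omega> (t * u)\<bar>)"
  show "?S = (SUP n. ereal (level_limit n \<omega>))"
  proof (rule antisym)
    show "?S \<le> (SUP n. ereal (level_limit n \<omega>))"
    proof (intro SUP_least)
      fix t u assume tu: "t \<in> {0::real<..}" "u \<in> U"
      obtain n :: nat where n: "max (1 / t) t \<le> real n" using real_arch_simple by blast
      have "1 / t \<le> real (n + 2)" using n by simp
      then have "1 / real (n + 2) \<le> t" using tu by (simp add: field_simps)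
      moreover have "t \<le> (real (n + 2))\<^sup>2"
      proof -
        have "t \<le> real (n + 2)" using n by simp
        also have "\<dots> \<le> (real (n + 2))\<^sup>2" by (rule self_le_power) auto
        finally show ?thesis .
      qed
      ultimately have "ereal (\<rho> t * \<bar>limit_path \<omega> t - limit_path \<omega> (t * u)\<bar>) \<le> ereal (level_limit n \<omega>)"
        using tu upper[of n t u] by simp
      also have "\<dots> \<le> (SUP n. ereal (level_limit n \<omega>))" by (rule SUP_upper) simp
      finally show "ereal (\<rho> t * \<bar>limit_path \<omega> t - limit_path \<omega> (t * u)\<bar>) \<le> (SUP n. ereal (level_limit n \<omega>))" .
    qed
    show "(SUP n. ereal (level_limit n \<omega>)) \<le> ?S"
    proof (rule SUP_least)
      fix n
      have up: "ereal (\<rho> t * \<bar>limit_path \<omega> t - limit_path \<omega> (t * u)\<bar>) \<le> ?S" if "0 < t" "u \<in> U" for t u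
        by (rule SUP_upper2[of t], use that in simp, rule SUP_upper[OF that(2)])
      obtain u where u: "u \<in> U" using U(2) by blast
      have "ereal 0 \<le> ereal (\<rho> 1 * \<bar>limit_path \<omega> 1 - limit_path \<omega> (1 * u)\<bar>)" using \<rho>_pos[of 1] by simp
      also have "\<dots> \<le> ?S" by (rule up) (use u in auto)
      finally have S0: "ereal 0 \<le> ?S" .
      show "ereal (level_limit n \<omega>) \<le> ?S"
      proof (cases ?S)
        case (real x)
        have "level_limit n \<omega> \<le> x"
          unfolding le_iff
        proof (intro conjI allI impI)
          show "0 \<le> x" using S0 real by simp
          fix t u assume tu: "1 / real (n + 2) \<le> t \<and> t \<le> (real (n + 2))\<^sup>2 \<and> u \<in> U"
          then have "0 < t" using level_range(1)[of n] by linarith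
          then show "\<rho> t * \<bar>limit_path \<omega> t - limit_path \<omega> (t * u)\<bar> \<le> x" using up[of t u] tu real by simp
        qed
        then show ?thesis using real by simp
      qed (use S0 in auto)
    qed
  qed
qed

lemma weighted_sup_converges:
  "conv_in_distr M (\<lambda>m \<omega>. SUP k\<in>{1..}. ereal (w m k * Psi m k \<omega>))
     N (\<lambda>\<omega>. SUP t\<in>{0<..}. SUP u\<in>U. ereal (\<rho> t * \<bar>limit_path \<omega> t - limit_path \<omega> (t * u)\<bar>))"
  using monitor_stat_converges unfolding monitor_stat_def .

end

end

section \<open>Specialisation to the three monitoring schemes\<close>

lemma conv_in_distr_cong:
  assumes "conv_in_distr M X N Z"
    and X: "\<And>m \<omega>. \<omega> \<in> space M \<Longrightarrow> X' m \<omega> = X m \<omega>" and Z: "\<And>\<omega>. \<omega> \<in> space N \<Longrightarrow> Z' \<omega> = Z \<omega>"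
  shows "conv_in_distr M X' N Z'"
proof -
  have "(X' m \<in> borel_measurable M) = (X m \<in> borel_measurable M)" for m
    by (rule measurable_cong) (rule X)
  moreover have "(Z' \<in> borel_measurable N) = (Z \<in> borel_measurable N)" by (rule measurable_cong) (rule Z)
  moreover have "(AE \<omega> in N. \<bar>Z' \<omega>\<bar> \<noteq> \<infinity>) = (AE \<omega> in N. \<bar>Z \<omega>\<bar> \<noteq> \<infinity>)" by (rule AE_cong) (simp add: Z)
  moreover have "{\<omega>\<in>space M. X' m \<omega> \<le> x} = {\<omega>\<in>space M. X m \<omega> \<le> x}" for m x using X by auto
  moreover have "{\<omega>\<in>space N. Z' \<omega> \<le> x} = {\<omega>\<in>space N. Z \<omega> \<le> x}" for x using Z by auto
  ultimately show ?thesis using assms(1) unfolding conv_in_distr_def by simp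
qed

text \<open>The index 0 is reached although 0 is not in the interval: \<open>u = 1 / (2 * k)\<close>
  rounds down to it. This reconciles \<open>0 \<le> l\<close> in the Page statistic with
  \<open>0 < s\<close> in its limit.\<close>

lemma floor_multiples_unit:
  assumes "1 \<le> k"
  shows "floor_multiples {0<..1} k = {0..k}"
proof (intro antisym subsetI)
  fix l assume "l \<in> floor_multiples {0<..1} k"
  then show "l \<in> {0..k}" using floor_multiples_le[of "{0<..1}" l k] by force
next
  fix l assume l: "l \<in> {0..k}"
  show "l \<in> floor_multiples {0<..1} k"
  proof (cases "l = 0")
    case True
    have "real k * (1 / (2 * real k)) = 1 / 2" using assms by simp
    then have "l = nat \<lfloor>real k * (1 / (2 * real k))\<rfloor>" using True by simp
    moreover have "1 / (2 * real k) \<in> {0<..1}" using assms by (simp add: divide_le_eq)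
    ultimately show ?thesis unfolding floor_multiples_def by (rule image_eqI)
  next
    case False
    have "l = nat \<lfloor>real k * (real l / real k)\<rfloor>" using assms by simp
    moreover have "real l / real k \<in> {0<..1}" using assms l False by (simp add: divide_le_eq)
    ultimately show ?thesis unfolding floor_multiples_def by (rule image_eqI)
  qed
qed

theorem theorem1:
  fixes M :: "'a measure" and Y :: "int \<Rightarrow> 'a \<Rightarrow> real" and X :: "nat \<Rightarrow> 'a \<Rightarrow> real"
    and h :: "real \<Rightarrow> real \<Rightarrow> real" and b \<theta> :: real
    and w :: "nat \<Rightarrow> nat \<Rightarrow> real" and \<rho> :: "real \<Rightarrow> real" and \<gamma> :: real
    and P :: "'p measure" and Z :: "real \<Rightarrow> 'p \<Rightarrow> real \<times> real" and c \<sigma>1 \<sigma>2 :: real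
    and N :: "'b measure" and W1 W2 :: "real \<Rightarrow> 'b \<Rightarrow> real"
  assumes "prob_space M"
    and "stationary_series M Y"
    and "(\<lambda>(x, y). h x y) \<in> borel_measurable (borel \<Otimes>\<^sub>M borel)"
    and "kernel_expectations_exist M Y h"
    and "\<theta> = kernel_mean M Y h"
    and "0 < b" and "b < 1"
    and H0: "\<And>i \<omega>. i \<ge> 1 \<Longrightarrow> \<omega> \<in> space M \<Longrightarrow> X i \<omega> = Y (int i) \<omega>"
    and "weight_conditions w \<rho> \<gamma>"
    and "remainder_condition M Y h \<gamma>"
    and "fclt_condition M Y h \<sigma>1 \<sigma>2 c P Z"
    and "early_sum_condition M Y h"
    and "late_sum_condition M Y h"
    and "standard_wiener_process N W1" and "standard_wiener_process N W2"
    and "indep_processes N W1 W2"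
  shows "conv_in_distr
           M (\<lambda>m \<omega>. SUP k\<in>{1..}. ereal (w m k * \<bar>Psi1 h \<theta> X m k \<omega>\<bar>))
           N (\<lambda>\<omega>. SUP t\<in>{0<..}. ereal (\<rho> t * \<bar>\<sigma>2 * W2 t \<omega> + t * \<sigma>1 * W1 1 \<omega>\<bar>))
       \<and> conv_in_distr
           M (\<lambda>m \<omega>. SUP k\<in>{1..}. ereal (w m k * \<bar>Psi2 b h \<theta> X m k \<omega>\<bar>))
           N (\<lambda>\<omega>. SUP t\<in>{0<..}. ereal (\<rho> t *
                \<bar>\<sigma>2 * (W2 t \<omega> - W2 (t * b) \<omega>) + t * (1 - b) * \<sigma>1 * W1 1 \<omega>\<bar>))
       \<and> conv_in_distr
           M (\<lambda>m \<omega>. SUP k\<in>{1..}. ereal (w m k * \<bar>Psi3 h \<theta> X m k \<omega>\<bar>))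
           N (\<lambda>\<omega>. SUP t\<in>{0<..}. ereal (\<rho> t) * (SUP s\<in>{0<..t}.
                ereal \<bar>\<sigma>2 * (W2 t \<omega> - W2 s \<omega>) + (t - s) * \<sigma>1 * W1 1 \<omega>\<bar>))"
proof (intro conjI)
  interpret monitoring_data P Z c \<sigma>1 \<sigma>2 N W1 W2 M Y h w \<rho> \<gamma>
    using assms unfolding monitoring_data_def monitoring_data_axioms_def wiener_limits_def fclt_condition_def
    by blast
  have gamma: "Gamma_stat h \<theta> X m k \<omega> = gamma_stat m k \<omega>" if "\<omega> \<in> space M" for m k \<omega>
    unfolding Gamma_stat_def \<open>\<theta> = kernel_mean M Y h\<close>
    by (intro arg_cong2[where f = "(*)"] refl sum.cong) (auto simp: H0[OF _ that])
  have gamma0: "gamma_stat m 0 \<omega> = 0" for m \<omega> by (simp add: Gamma_stat_def)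
  have [measurable]: "gamma_stat m k \<in> borel_measurable M" for m k unfolding Gamma_stat_def by measurable
  have limit0: "limit_path \<omega> 0 = 0" if "\<omega> \<in> space N" for \<omega>
    using wiener_processD(3)[OF W2 that] by (simp add: limit_path_def)
  have limit_diff: "limit_path \<omega> t - limit_path \<omega> s = \<sigma>2 * (W2 t \<omega> - W2 s \<omega>) + (t - s) * \<sigma>1 * W1 1 \<omega>" for \<omega> t s
    by (simp add: limit_path_def algebra_simps)
  \<comment> \<open>With \<open>U = {0}\<close> the subtracted terms vanish:
    \<open>gamma_stat m 0\<close> is an empty sum and the limit path starts at 0.\<close>
  have "conv_in_distr M (\<lambda>m \<omega>. SUP k\<in>{1..}. ereal (w m k * \<bar>gamma_stat m k \<omega>\<bar>))
     N (\<lambda>\<omega>. SUP t\<in>{0<..}. SUP u\<in>{0}. ereal (\<rho> t * \<bar>limit_path \<omega> t - limit_path \<omega> (t * u)\<bar>))"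
    by (rule weighted_sup_converges[where ?u0.0 = 0]) (auto simp: floor_multiples_def gamma0)
  then show "conv_in_distr
           M (\<lambda>m \<omega>. SUP k\<in>{1..}. ereal (w m k * \<bar>Psi1 h \<theta> X m k \<omega>\<bar>))
           N (\<lambda>\<omega>. SUP t\<in>{0<..}. ereal (\<rho> t * \<bar>\<sigma>2 * W2 t \<omega> + t * \<sigma>1 * W1 1 \<omega>\<bar>))"
    by (rule conv_in_distr_cong) (simp add: Psi1_def gamma, simp add: limit0, simp add: limit_path_def)
  have "conv_in_distr M (\<lambda>m \<omega>. SUP k\<in>{1..}. ereal (w m k * \<bar>gamma_stat m k \<omega> - gamma_stat m (nat \<lfloor>real k * b\<rfloor>) \<omega>\<bar>))
     N (\<lambda>\<omega>. SUP t\<in>{0<..}. SUP u\<in>{b}. ereal (\<rho> t * \<bar>limit_path \<omega> t - limit_path \<omega> (t * u)\<bar>))"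
    by (rule weighted_sup_converges[where ?u0.0 = b]) (use assms(6,7) in \<open>auto simp: floor_multiples_def\<close>)
  then show "conv_in_distr
           M (\<lambda>m \<omega>. SUP k\<in>{1..}. ereal (w m k * \<bar>Psi2 b h \<theta> X m k \<omega>\<bar>))
           N (\<lambda>\<omega>. SUP t\<in>{0<..}. ereal (\<rho> t *
                \<bar>\<sigma>2 * (W2 t \<omega> - W2 (t * b) \<omega>) + t * (1 - b) * \<sigma>1 * W1 1 \<omega>\<bar>))"
  proof (rule conv_in_distr_cong)
    have "t - t * b = t * (1 - b)" for t by (simp add: algebra_simps)
    then show "(SUP t\<in>{0<..}. ereal (\<rho> t *
          \<bar>\<sigma>2 * (W2 t \<omega> - W2 (t * b) \<omega>) + t * (1 - b) * \<sigma>1 * W1 1 \<omega>\<bar>)) =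
        (SUP t\<in>{0<..}. SUP u\<in>{b}. ereal (\<rho> t * \<bar>limit_path \<omega> t - limit_path \<omega> (t * u)\<bar>))" for \<omega>
      by (simp add: limit_diff)
  qed (simp add: Psi2_def gamma)
  define Psi where "Psi = (\<lambda>m k \<omega>. SUP l\<in>{0..k}. \<bar>gamma_stat m k \<omega> - gamma_stat m l \<omega>\<bar>)"
  \<comment> \<open>A supremum over finitely many indices is a maximum, which supplies both the
    upper bounds and the attaining index required of \<open>Psi\<close>.\<close>
  have Psi_Max: "Psi m k \<omega> = Max ((\<lambda>l. \<bar>gamma_stat m k \<omega> - gamma_stat m l \<omega>\<bar>) ` {0..k})" for m k \<omega>
    unfolding Psi_def by (rule cSup_eq_Max) auto
  have upper: "\<bar>gamma_stat m k \<omega> - gamma_stat m l \<omega>\<bar> \<le> Psi m k \<omega>" if "l \<le> k" for m k l \<omega>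
    unfolding Psi_Max using that by (intro Max_ge) auto
  have attained: "\<exists>l\<in>{0..k}. Psi m k \<omega> = \<bar>gamma_stat m k \<omega> - gamma_stat m l \<omega>\<bar>" for m k \<omega>
  proof -
    have "Psi m k \<omega> \<in> (\<lambda>l. \<bar>gamma_stat m k \<omega> - gamma_stat m l \<omega>\<bar>) ` {0..k}"
      unfolding Psi_Max by (rule Max_in) auto
    then show ?thesis by auto
  qed
  have Psi_nonneg: "0 \<le> Psi m k \<omega>" for m k \<omega> using upper[of k k m \<omega>] by simp
  have "conv_in_distr M (\<lambda>m \<omega>. SUP k\<in>{1..}. ereal (w m k * Psi m k \<omega>))
     N (\<lambda>\<omega>. SUP t\<in>{0<..}. SUP u\<in>{0<..1}. ereal (\<rho> t * \<bar>limit_path \<omega> t - limit_path \<omega> (t * u)\<bar>))"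
  \<comment> \<open>Here \<open>u0 = 0\<close> is the infimum of \<open>{0<..1}\<close> but not a
    member; its rounded multiple 0 still occurs by \<open>floor_multiples_unit\<close>.\<close>
  proof (rule weighted_sup_converges[where ?u0.0 = 0])
    show "Psi m k \<in> borel_measurable M" for m k unfolding Psi_Max[abs_def] by measurable
  qed (use upper attained in \<open>auto simp: floor_multiples_unit\<close>)
  then show "conv_in_distr
           M (\<lambda>m \<omega>. SUP k\<in>{1..}. ereal (w m k * \<bar>Psi3 h \<theta> X m k \<omega>\<bar>))
           N (\<lambda>\<omega>. SUP t\<in>{0<..}. ereal (\<rho> t) * (SUP s\<in>{0<..t}.
                ereal \<bar>\<sigma>2 * (W2 t \<omega> - W2 s \<omega>) + (t - s) * \<sigma>1 * W1 1 \<omega>\<bar>))"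
  proof (rule conv_in_distr_cong)
    fix m \<omega> assume "\<omega> \<in> space M"
    then have "Psi3 h \<theta> X m k \<omega> = Psi m k \<omega>" for k by (simp add: Psi3_def Psi_def gamma)
    then show "(SUP k\<in>{1..}. ereal (w m k * \<bar>Psi3 h \<theta> X m k \<omega>\<bar>)) = (SUP k\<in>{1..}. ereal (w m k * Psi m k \<omega>))"
      by (simp add: Psi_nonneg)
  next
    fix \<omega>
    show "(SUP t\<in>{0<..}. ereal (\<rho> t) * (SUP s\<in>{0<..t}.
                ereal \<bar>\<sigma>2 * (W2 t \<omega> - W2 s \<omega>) + (t - s) * \<sigma>1 * W1 1 \<omega>\<bar>)) =
      (SUP t\<in>{0<..}. SUP u\<in>{0<..1}. ereal (\<rho> t * \<bar>limit_path \<omega> t - limit_path \<omega> (t * u)\<bar>))"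
    proof (rule SUP_cong[OF refl])
      fix t :: real assume "t \<in> {0<..}"
      then have t: "0 < t" by simp
      have "(\<lambda>u. t * u) ` {0<..1} = {0<..t}"
      proof (intro antisym subsetI)
        fix s assume "s \<in> {0<..t}"
        then have "s = t * (s / t)" "s / t \<in> {0<..1}" using t by auto
        then show "s \<in> (\<lambda>u. t * u) ` {0<..1}" by blast
      qed (use t in \<open>auto intro: mult_left_le\<close>)
      then have "(SUP s\<in>{0<..t}. ereal \<bar>limit_path \<omega> t - limit_path \<omega> s\<bar>) =
          (SUP u\<in>{0<..1}. ereal \<bar>limit_path \<omega> t - limit_path \<omega> (t * u)\<bar>)"
        by (metis (no_types, lifting) SUP_cong image_image)
      then have "ereal (\<rho> t) * (SUP s\<in>{0<..t}. ereal \<bar>limit_path \<omega> t - limit_path \<omega> s\<bar>) =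
          (SUP u\<in>{0<..1}. ereal (\<rho> t) * ereal \<bar>limit_path \<omega> t - limit_path \<omega> (t * u)\<bar>)"
        using \<rho>_pos[OF t] by (subst SUP_ereal_mult_left) auto
      then show "ereal (\<rho> t) * (SUP s\<in>{0<..t}. ereal \<bar>\<sigma>2 * (W2 t \<omega> - W2 s \<omega>) + (t - s) * \<sigma>1 * W1 1 \<omega>\<bar>) =
          (SUP u\<in>{0<..1}. ereal (\<rho> t * \<bar>limit_path \<omega> t - limit_path \<omega> (t * u)\<bar>))"
        by (simp add: limit_diff)
    qed
  qed
qed

end
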